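(* Fix a finite action set $\mathcal{A}\subset\mathbb{R}^d$, a time horizon $T\in\mathbb{N}$, a variance bound $\sigma^2=\Theta(1)$, and a batch size $B\in\{1,\dots,T\}$. For any $\delta\in(0,1)$ there exists an algorithm for the batched linear bandit problem with 1-bit feedback that, for every admissible parameter $\theta$ and noise law, with probability at least $1-\delta$ incurs regret at most $$R_T=\widetilde{O}\Bigl(dB\log\bigl(\tfrac1\delta\bigr)+d\sqrt{T\log\bigl(\tfrac1\delta\bigr)}\Bigr),$$ where $\widetilde O$ hides logarithmic dependencies on $d$ and $T$. In particular the bound does not depend on $|\mathcal{A}|$.
   Context: Batched linear bandit with 1-bit feedback. $\mathcal{A}\subset\mathbb{R}^d$ is a finite set of distinct vectors spanning $\mathbb{R}^d$, and $\theta\in\mathbb{R}^d$ is unknown with $|\langle a,\theta\rangle|\le 1$ for all $a\in\mathcal{A}$. In each round $t=1,\dots,T$ an action $A_t\in\mathcal{A}$ is played and a reward $Y_t=\langle A_t,\theta\rangle+\xi_t$ is generated, where $(\xi_t)$ are i.i.d. with $\mathbb{E}[\xi_t]=0$ and $\mathbb{E}[\xi_t^2]\le\sigma^2$ for a known $\sigma>0$ (nothing else is assumed about the noise). The rounds are split into $M=\lceil T/B\rceil$ consecutive batches of size $B$ (the last possibly shorter). At the beginning of batch $m$ the learner chooses all actions of the batch and a quantization function $Q_m:\mathbb{R}^B\to\{0,1\}$; these choices may depend only on the bits received from batches $1,\dots,m-1$ and on internal randomness. After batch $m$ the learner receives only the single bit $Q_m(\text{rewards of batch } m)$. The algorithm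 may use $\mathcal{A},B,T,\sigma,\delta$. The cumulative regret is $R_T=\sum_{t=1}^T\langle a^*-A_t,\theta\rangle$ with $a^*\in\arg\max_{a\in\mathcal{A}}\langle a,\theta\rangle$. $\sigma^2=\Theta(1)$ means $\sigma$ lies between two fixed positive constants. $\widetilde O(f)$ means at most $C(1+\log d+\log T)^C f$ with $C$ depending only on those two constants; $\log(1/\delta)$ inside $\widetilde O$ is read as $\max\{1,\log(1/\delta)\}$. *)

theory Defs
  imports "HOL-Probability.Probability" "Jordan_Normal_Form.VS_Connect"
begin

text \<open>
  Vectors of \<open>\<real>\<^sup>d\<close> are elements of \<^term>\<open>carrier_vec d :: real vec set\<close>, so that the dimension
  is an ordinary variable and constants can be required to be uniform in it.
  Rounds, batches and positions inside a batch are numbered from 0.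
\<close>

definition spans :: "nat \<Rightarrow> real vec set \<Rightarrow> bool" where
  "spans d A \<longleftrightarrow>
     LinearCombinations.module.span class_ring (module_vec TYPE(real) d) A = carrier_vec d"

definition num_batches :: "nat \<Rightarrow> nat \<Rightarrow> nat" where
  "num_batches T B = nat \<lceil>real T / real B\<rceil>"

definition batch_len :: "nat \<Rightarrow> nat \<Rightarrow> nat \<Rightarrow> nat" where
  "batch_len T B m = min B (T - m * B)"

text \<open>
  The internal randomness of the learner is one seed \<open>u\<close>, drawn from an arbitrary law on the reals
  before the first round; a real seed can encode fresh randomness for every batch.
  In \<open>action alg u h i\<close> and \<open>quantizer alg u h y\<close> the list \<open>h\<close> holds the bits received so far in
  chronological order, so \<open>length h\<close> is the index of the current batch; \<open>i\<close> is the position of the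
  round inside this batch, and \<open>y\<close> is the vector of its rewards, an extensional function on
  \<open>{..<batch_len T B (length h)}\<close>.
\<close>

record bandit_alg =
  seed_law :: "real measure"
  action :: "real \<Rightarrow> bool list \<Rightarrow> nat \<Rightarrow> real vec"
  quantizer :: "real \<Rightarrow> bool list \<Rightarrow> (nat \<Rightarrow> real) \<Rightarrow> bool"

text \<open>Measurability into \<^term>\<open>count_space A\<close> also says that all played actions lie in \<open>A\<close>.\<close>

definition valid_alg :: "real vec set \<Rightarrow> nat \<Rightarrow> nat \<Rightarrow> bandit_alg \<Rightarrow> bool" where
  "valid_alg A T B alg \<longleftrightarrow>
     prob_space (seed_law alg) \<and> sets (seed_law alg) = sets borel \<and>
     (\<forall>h. length h < num_batches T B \<longrightarrow>
        (\<forall>i < batch_len T B (length h).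
           (\<lambda>u. action alg u h i) \<in> measurable (seed_law alg) (count_space A)) \<and>
        (\<lambda>(u, y). quantizer alg u h y)
          \<in> measurable (seed_law alg \<Otimes>\<^sub>M (\<Pi>\<^sub>M i\<in>{..<batch_len T B (length h)}. borel))
              (count_space UNIV))"

definition noise_law :: "real \<Rightarrow> real measure \<Rightarrow> bool" where
  "noise_law \<sigma> \<nu> \<longleftrightarrow>
     prob_space \<nu> \<and> sets \<nu> = sets borel \<and>
     integrable \<nu> (\<lambda>x. x) \<and> (LINT x|\<nu>. x) = 0 \<and>
     integrable \<nu> (\<lambda>x. x\<^sup>2) \<and> (LINT x|\<nu>. x\<^sup>2) \<le> \<sigma>\<^sup>2"

definition admissible_param :: "nat \<Rightarrow> real vec set \<Rightarrow> real vec \<Rightarrow> bool" where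
  "admissible_param d A \<theta> \<longleftrightarrow> \<theta> \<in> carrier_vec d \<and> (\<forall>a\<in>A. \<bar>scalar_prod a \<theta>\<bar> \<le> 1)"

text \<open>
  Outcomes are pairs of the seed and the noise sequence: the noise is i.i.d. with law \<open>\<nu>\<close> and
  independent of the seed.
\<close>

definition run_space :: "nat \<Rightarrow> real measure \<Rightarrow> bandit_alg \<Rightarrow> (real \<times> (nat \<Rightarrow> real)) measure" where
  "run_space T \<nu> alg = seed_law alg \<Otimes>\<^sub>M (\<Pi>\<^sub>M t\<in>{..<T}. \<nu>)"

fun feedback ::
  "nat \<Rightarrow> nat \<Rightarrow> real vec \<Rightarrow> bandit_alg \<Rightarrow> real \<times> (nat \<Rightarrow> real) \<Rightarrow> nat \<Rightarrow> bool list" where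
  "feedback T B \<theta> alg \<omega> 0 = []"
| "feedback T B \<theta> alg \<omega> (Suc m) =
     (let h = feedback T B \<theta> alg \<omega> m;
          rewards = (\<lambda>i\<in>{..<batch_len T B m}.
                       scalar_prod (action alg (fst \<omega>) h i) \<theta> + snd \<omega> (m * B + i))
      in h @ [quantizer alg (fst \<omega>) h rewards])"

definition played ::
  "nat \<Rightarrow> nat \<Rightarrow> real vec \<Rightarrow> bandit_alg \<Rightarrow> real \<times> (nat \<Rightarrow> real) \<Rightarrow> nat \<Rightarrow> real vec" where
  "played T B \<theta> alg \<omega> t =
     action alg (fst \<omega>) (feedback T B \<theta> alg \<omega> (t div B)) (t mod B)"

definition regret ::
  "real vec set \<Rightarrow> nat \<Rightarrow> nat \<Rightarrow> real vec \<Rightarrow> bandit_alg \<Rightarrow> real \<times> (nat \<Rightarrow> real) \<Rightarrow> real" where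
  "regret A T B \<theta> alg \<omega> =
     (let a_star = arg_max_on (\<lambda>a. scalar_prod a \<theta>) A
      in \<Sum>t<T. scalar_prod (a_star - played T B \<theta> alg \<omega> t) \<theta>)"

text \<open>The argument \<open>C\<close> is the single constant hidden in the soft-O notation.\<close>

definition regret_bound :: "real \<Rightarrow> nat \<Rightarrow> nat \<Rightarrow> nat \<Rightarrow> real \<Rightarrow> real" where
  "regret_bound C d T B \<delta> =
     (let L = max 1 (ln (1 / \<delta>))
      in C * (1 + ln (real d) + ln (real T)) powr C *
           (real d * real B * L + real d * sqrt (real T * L)))"

end

theory Submission
  imports Defs
begin

text \<open>
  The learner is deterministic and proceeds by phased elimination.

  Among all families of \<open>2 * d\<close> active arms, one that maximises the determinant of the (regularised)
  Gram matrix represents every active arm with coefficients of Euclidean norm at most 1; estimating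
  these \<open>2 * d\<close> arms to precision \<open>\<epsilon> / sqrt (2 * d)\<close> therefore estimates all active arms to precision
  \<open>\<epsilon>\<close>, without a union bound over the actions.

  The mean \<open>\<mu>\<close> of an arm is found from a guess \<open>c\<close> at a scale \<open>R\<close> with \<open>(\<mu> - c)\<^sup>2 + \<sigma>\<^sup>2 / B \<le> R\<^sup>2\<close> by comparing
  batch means with the thresholds \<open>c \<plusminus> R * (exp (\<beta> * k) - 1)\<close>. The weighted sum of the bits estimates
  \<open>\<mu>\<close> with bias \<open>O(\<beta> R)\<close> and variance \<open>O(\<beta> R\<^sup>2)\<close> per copy of the grid, as only second moments enter, and a
  Bernstein bound applies to \<open>O(log (1 / \<delta>) / \<beta>)\<close> copies. Iterating this with halved scales localises the
  arm down to the scale \<open>\<sigma> / sqrt B\<close> at the cost of a logarithmic factor.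

  The history takes finitely many values and the noise of the next batch is independent of it, so the
  run is a finite decision tree whose leaf probabilities are products.
\<close>

text \<open>Precision is expensive when the noise has two moments and a batch yields one bit. A
  refinement at resolution \<beta> asks about log (1 / \<beta>) / \<beta> thresholds in L / \<beta>
  copies, so an arm costs order L / \<beta>^2 batches up to logarithms. Phase p needs 1 / \<beta> of
  order 1 + S * sqrt (d / B) * 2^p, because the batch means have standard deviation at most S / sqrt
  B. Each of its batches has regret of order B * 2^-p, so the phase costs order d * L * (B * 2^-p +
  S^2 * d * 2^p). The first terms sum to the dB part of the bound; the second ones are dominated by
  the last phase. The scales are halved because the error of a refinement is proportional to its
  scale: at scale about 1 the error would be of order \<beta> instead of \<beta> * S / sqrt B. The
  ridge in the Gram matrix is there because surviving arms need not span the space. Learning need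
  not fit into the horizon: all costs are nonnegative, so cutting the tree off only lowers the
  regret.\<close>

no_notation Finite_Cartesian_Product.vec.vec_nth (infixl "$" 90)

section \<open>Small designs\<close>

text \<open>Matrix determinant lemma at the identity. Multiplying the bordered matrix
  \<open>?A\<close> by the same unipotent \<open>?L\<close> on the left and on the right gives two
  block triangular matrices; their determinants agree, and one is the left side, the other the right
  side.\<close>

lemma det_one_plus_outer:
  fixes x m :: "real vec"
  assumes x: "x \<in> carrier_vec d" and m: "m \<in> carrier_vec d"
  shows "Determinant.det (mat d d (\<lambda>(i, k). (if i = k then 1 else 0) + m $ i * x $ k)) =
    1 + scalar_prod x m"
proof -
  let ?X = "mat 1 d (\<lambda>(i, k). x $ k)" and ?M = "mat d 1 (\<lambda>(i, k). m $ i)"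
  let ?R = "mat d d (\<lambda>(i, k). (if i = k then 1 else 0) + m $ i * x $ k)"
  have R: "?R = 1\<^sub>m d + ?M * ?X"
    by (rule eq_matI) (auto simp: scalar_prod_def row_def col_def)
  have X: "?X \<in> carrier_mat 1 d" and M: "?M \<in> carrier_mat d 1" by auto
  have XM: "?X * ?M = mat 1 1 (\<lambda>_. scalar_prod x m)"
    using m by (intro eq_matI) (auto simp: scalar_prod_def row_def col_def)
  let ?A = "four_block_mat (1\<^sub>m 1) (- ?X) ?M (1\<^sub>m d)"
  let ?L = "four_block_mat (1\<^sub>m 1) (0\<^sub>m 1 d) (- ?M) (1\<^sub>m d)"
  have "?L * ?A = four_block_mat (1\<^sub>m 1 * 1\<^sub>m 1 + 0\<^sub>m 1 d * ?M) (1\<^sub>m 1 * (- ?X) + 0\<^sub>m 1 d * 1\<^sub>m d)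
      ((- ?M) * 1\<^sub>m 1 + 1\<^sub>m d * ?M) ((- ?M) * (- ?X) + 1\<^sub>m d * 1\<^sub>m d)"
    by (rule mult_four_block_mat) auto
  also have "\<dots> = four_block_mat (1\<^sub>m 1) (- ?X) (0\<^sub>m d 1) ?R"
  proof (rule arg_cong4[where f = four_block_mat])
    show "1\<^sub>m 1 * 1\<^sub>m 1 + 0\<^sub>m 1 d * ?M = 1\<^sub>m 1" using M by simp
    show "1\<^sub>m 1 * - ?X + 0\<^sub>m 1 d * 1\<^sub>m d = - ?X" by auto
    show "- ?M * 1\<^sub>m 1 + 1\<^sub>m d * ?M = 0\<^sub>m d 1" by auto
    show "- ?M * - ?X + 1\<^sub>m d * 1\<^sub>m d = ?R"
      by (rule eq_matI) (auto simp: scalar_prod_def row_def col_def)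
  qed
  finally have LA: "Determinant.det (?L * ?A) = Determinant.det ?R"
    by (simp add: det_four_block_mat_lower_left_zero[of _ 1 _ d] del: One_nat_def)
  have "?A * ?L = four_block_mat (1\<^sub>m 1 * 1\<^sub>m 1 + (- ?X) * (- ?M)) (1\<^sub>m 1 * 0\<^sub>m 1 d + (- ?X) * 1\<^sub>m d)
      (?M * 1\<^sub>m 1 + 1\<^sub>m d * (- ?M)) (?M * 0\<^sub>m 1 d + 1\<^sub>m d * 1\<^sub>m d)"
    by (rule mult_four_block_mat) auto
  also have "\<dots> = four_block_mat (mat 1 1 (\<lambda>_. 1 + scalar_prod x m)) (- ?X) (0\<^sub>m d 1) (1\<^sub>m d)"
  proof (rule arg_cong4[where f = four_block_mat])
    show "1\<^sub>m 1 * 1\<^sub>m 1 + (- ?X) * (- ?M) = mat 1 1 (\<lambda>_. 1 + scalar_prod x m)"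
      using m by (intro eq_matI) (auto simp: scalar_prod_def row_def col_def)
    show "1\<^sub>m 1 * 0\<^sub>m 1 d + (- ?X) * 1\<^sub>m d = - ?X" by auto
    show "?M * 1\<^sub>m 1 + 1\<^sub>m d * (- ?M) = 0\<^sub>m d 1" by auto
    show "?M * 0\<^sub>m 1 d + 1\<^sub>m d * 1\<^sub>m d = 1\<^sub>m d"
      using M by auto
  qed
  finally have "Determinant.det (?A * ?L) = 1 + scalar_prod x m"
    by (simp add: det_four_block_mat_lower_left_zero[of _ 1 _ d] det_single del: One_nat_def)
  moreover have "Determinant.det (?L * ?A) = Determinant.det (?A * ?L)"
    using det_mult[of ?L "1 + d" ?A] det_mult[of ?A "1 + d" ?L] by (simp add: mult.commute del: One_nat_def)
  ultimately show ?thesis using LA by simp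
qed

text \<open>The ridge \<open>l\<close> makes the matrix invertible for every family of arms,
  spanning or not; \<open>small_design\<close> removes it by a limit.\<close>

definition reg_gram :: "nat \<Rightarrow> real \<Rightarrow> 'i set \<Rightarrow> ('i \<Rightarrow> real vec) \<Rightarrow> real mat" where
  "reg_gram d l I F = mat d d (\<lambda>(i, k). (if i = k then l else 0) + (\<Sum>j\<in>I. F j $ i * F j $ k))"

lemma reg_gram_carrier [simp]: "reg_gram d l I F \<in> carrier_mat d d"
  by (simp add: reg_gram_def)

lemma reg_gram_mult_vec:
  assumes u: "u \<in> carrier_vec d" and i: "i < d"
  shows "(reg_gram d l I F *\<^sub>v u) $ i = l * u $ i + (\<Sum>j\<in>I. F j $ i * scalar_prod (F j) u)"
proof -
  have "(reg_gram d l I F *\<^sub>v u) $ i =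
      (\<Sum>k<d. ((if i = k then l else 0) + (\<Sum>j\<in>I. F j $ i * F j $ k)) * u $ k)"
    using u i by (simp add: reg_gram_def scalar_prod_def row_def atLeast0LessThan)
  also have "\<dots> = (\<Sum>k<d. (if i = k then l * u $ k else 0)) + (\<Sum>k<d. \<Sum>j\<in>I. F j $ i * F j $ k * u $ k)"
    by (simp add: distrib_right sum.distrib sum_distrib_right if_distrib[of "\<lambda>z. z * _"] cong: if_cong)
  also have "(\<Sum>k<d. \<Sum>j\<in>I. F j $ i * F j $ k * u $ k) = (\<Sum>j\<in>I. F j $ i * scalar_prod (F j) u)"
    using u by (subst sum.swap) (simp add: scalar_prod_def sum_distrib_left mult.assoc atLeast0LessThan)
  finally show ?thesis using i by simp
qed

lemma scalar_prod_reg_gram: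
  assumes u: "u \<in> carrier_vec d" and v: "v \<in> carrier_vec d"
    and F: "F \<in> I \<rightarrow> carrier_vec d"
  shows "scalar_prod v (reg_gram d l I F *\<^sub>v u) =
    l * scalar_prod v u + (\<Sum>j\<in>I. scalar_prod (F j) v * scalar_prod (F j) u)"
proof -
  have dim: "dim_vec (reg_gram d l I F *\<^sub>v u) = d" by (simp add: reg_gram_def)
  have "scalar_prod v (reg_gram d l I F *\<^sub>v u) =
      (\<Sum>i<d. v $ i * (l * u $ i + (\<Sum>j\<in>I. F j $ i * scalar_prod (F j) u)))"
    unfolding scalar_prod_def[of v "reg_gram d l I F *\<^sub>v u"] dim atLeast0LessThan
    by (intro sum.cong refl) (simp add: reg_gram_mult_vec[OF u])
  also have "\<dots> = l * (\<Sum>i<d. v $ i * u $ i) + (\<Sum>j\<in>I. (\<Sum>i<d. F j $ i * v $ i) * scalar_prod (F j) u)"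
    by (simp add: distrib_left sum.distrib sum_distrib_left sum_distrib_right mult_ac)
      (rule sum.swap)
  also have "(\<Sum>j\<in>I. (\<Sum>i<d. F j $ i * v $ i) * scalar_prod (F j) u) =
      (\<Sum>j\<in>I. scalar_prod (F j) v * scalar_prod (F j) u)"
    using v by (simp add: scalar_prod_def atLeast0LessThan)
  finally show ?thesis using u by (simp add: scalar_prod_def atLeast0LessThan)
qed

lemma scalar_prod_self_nonneg: "0 \<le> scalar_prod u (u :: real vec)"
  by (simp add: scalar_prod_def sum_nonneg)

lemma det_reg_gram_nonzero:
  assumes l: "0 < l" and F: "F \<in> I \<rightarrow> carrier_vec d"
  shows "Determinant.det (reg_gram d l I F) \<noteq> 0"
proof
  assume "Determinant.det (reg_gram d l I F) = 0"
  then obtain v where v: "v \<in> carrier_vec d" "v \<noteq> 0\<^sub>v d" "reg_gram d l I F *\<^sub>v v = 0\<^sub>v d"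
    using det_0_iff_vec_prod_zero_field[OF reg_gram_carrier] by blast
  have "0 = l * scalar_prod v v + (\<Sum>j\<in>I. (scalar_prod (F j) v)\<^sup>2)"
    using scalar_prod_reg_gram[OF v(1) v(1) F, of l] v by (simp add: power2_eq_square)
  moreover have "0 \<le> (\<Sum>j\<in>I. (scalar_prod (F j) v)\<^sup>2)" by (simp add: sum_nonneg)
  ultimately have "l * scalar_prod v v \<le> 0" by linarith
  with l have "scalar_prod v v = 0"
    using scalar_prod_self_nonneg[of v] by (simp add: mult_le_0_iff)
  then have "\<forall>i<d. v $ i = 0"
    using v(1) by (simp add: scalar_prod_def sum_nonneg_eq_0_iff)
  with v show False by (metis carrier_vecD eq_vecI index_zero_vec)
qed

lemma obtain_right_inverse:
  fixes V :: "real mat"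
  assumes V: "V \<in> carrier_mat d d" and "Determinant.det V \<noteq> 0"
  obtains U where "U \<in> carrier_mat d d" "V * U = 1\<^sub>m d" "U * V = 1\<^sub>m d"
proof
  let ?U = "(1 / Determinant.det V) \<cdot>\<^sub>m adj_mat V"
  show U: "?U \<in> carrier_mat d d" using adj_mat(1)[OF V] by simp
  show "V * ?U = 1\<^sub>m d"
    using adj_mat[OF V] assms by (simp add: mult_smult_distrib[OF V adj_mat(1)[OF V]], auto)
  then show "?U * V = 1\<^sub>m d"
    by (rule mat_mult_left_right_inverse[OF V U])
qed

lemma reg_gram_solve:
  assumes l: "0 < l" and F: "F \<in> I \<rightarrow> carrier_vec d" and a: "a \<in> carrier_vec d"
  obtains u where "u \<in> carrier_vec d" "reg_gram d l I F *\<^sub>v u = a"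
proof -
  obtain U where U: "U \<in> carrier_mat d d" "reg_gram d l I F * U = 1\<^sub>m d"
    using obtain_right_inverse[OF reg_gram_carrier det_reg_gram_nonzero[OF l F]]
    by blast
  show ?thesis
  proof (rule that[of "U *\<^sub>v a"])
    show "U *\<^sub>v a \<in> carrier_vec d" using U a by simp
    show "reg_gram d l I F *\<^sub>v (U *\<^sub>v a) = a"
      using U a by (simp flip: assoc_mult_mat_vec[OF reg_gram_carrier U(1) a])
  qed
qed

text \<open>With \<open>m\<close> the preimage of \<open>F j\<close>, the rank-one update factors as
  the old Gram matrix times the identity plus the outer product of \<open>m\<close> and
  \<open>F j\<close>.\<close>

lemma det_reg_gram_insert:
  assumes I: "finite I" "j \<notin> I"
    and x: "F j \<in> carrier_vec d" and m: "m \<in> carrier_vec d" and sol: "reg_gram d l I F *\<^sub>v m = F j"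
  shows "Determinant.det (reg_gram d l (insert j I) F) =
    Determinant.det (reg_gram d l I F) * (1 + scalar_prod (F j) m)"
proof -
  let ?R = "mat d d (\<lambda>(i, k). (if i = k then 1 else 0) + m $ i * F j $ k)"
  let ?G = "reg_gram d l I F"
  have "reg_gram d l (insert j I) F = ?G * ?R"
  proof (rule eq_matI)
    fix i k assume "i < dim_row (?G * ?R)" "k < dim_col (?G * ?R)"
    then have ik: "i < d" "k < d" by (auto simp: reg_gram_def)
    have "(?G * ?R) $$ (i, k) = (\<Sum>q<d. ?G $$ (i, q) * ((if q = k then 1 else 0) + m $ q * F j $ k))"
      using ik by (simp add: scalar_prod_def row_def col_def reg_gram_def atLeast0LessThan)
    also have "\<dots> = ?G $$ (i, k) + (\<Sum>q<d. ?G $$ (i, q) * m $ q) * F j $ k"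
      using ik by (simp add: distrib_left sum.distrib sum_distrib_right mult.assoc
          if_distrib[of "\<lambda>z. _ * z"] cong: if_cong)
    also have "(\<Sum>q<d. ?G $$ (i, q) * m $ q) = (?G *\<^sub>v m) $ i"
      using ik m by (simp add: scalar_prod_def row_def reg_gram_def atLeast0LessThan)
    finally show "reg_gram d l (insert j I) F $$ (i, k) = (?G * ?R) $$ (i, k)"
      using ik I by (simp add: sol) (simp add: reg_gram_def)
  qed (auto simp: reg_gram_def)
  then show ?thesis
    using det_mult[of ?G d ?R] by (simp add: det_one_plus_outer[OF x m])
qed

text \<open>\<open>scalar_prod m a\<close> is the squared norm of \<open>a\<close> in the inverse
  Gram matrix. Evaluating the quadratic form at \<open>m\<close> shows that it controls both the
  ridge term and the numbers \<open>scalar_prod (F j) m\<close>, which become the design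
  coefficients of \<open>a\<close>.\<close>

lemma reg_gram_sol_nonneg:
  assumes "0 < l" and "F \<in> I \<rightarrow> carrier_vec d"
    and "m \<in> carrier_vec d" and "reg_gram d l I F *\<^sub>v m = a"
  shows "l * scalar_prod m m + (\<Sum>j\<in>I. (scalar_prod (F j) m)\<^sup>2) = scalar_prod m a"
    and "0 \<le> scalar_prod m a"
proof -
  show *: "l * scalar_prod m m + (\<Sum>j\<in>I. (scalar_prod (F j) m)\<^sup>2) = scalar_prod m a"
    using scalar_prod_reg_gram[OF assms(3,3,2), of l] assms(4) by (simp add: power2_eq_square)
  show "0 \<le> scalar_prod m a"
    unfolding *[symmetric] using assms(1) scalar_prod_self_nonneg[of m] by (simp add: sum_nonneg)
qed

lemma det_reg_gram_pos:
  assumes l: "0 < l" and "finite I" and "F \<in> I \<rightarrow> carrier_vec d"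
  shows "0 < Determinant.det (reg_gram d l I F)"
  using assms(2,3)
proof (induction I rule: finite_induct)
  case empty
  have "reg_gram d l {} F = l \<cdot>\<^sub>m 1\<^sub>m d" by (rule eq_matI) (auto simp: reg_gram_def)
  then show ?case using l by simp
next
  case (insert j I)
  obtain m where m: "m \<in> carrier_vec d" "reg_gram d l I F *\<^sub>v m = F j"
    using reg_gram_solve[OF l, of F I d "F j"] insert.prems by auto
  have "0 \<le> scalar_prod (F j) m"
    using reg_gram_sol_nonneg(2)[OF l _ m] insert.prems m comm_scalar_prod[of m d "F j"] by simp
  then show ?case
    using insert by (simp add: det_reg_gram_insert[OF _ _ _ m] zero_less_mult_iff)
qed

text \<open>Optimality compares \<open>a\<close> and \<open>F j\<close> in the metric of the Gram matrix without \<open>F j\<close>;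
  Sherman--Morrison moves the comparison to the full Gram matrix.\<close>

lemma reg_gram_exchange:
  assumes l: "0 < l" and I: "finite I" "j \<notin> I" and F: "F \<in> insert j I \<rightarrow> carrier_vec d"
    and a: "a \<in> carrier_vec d"
    and opt: "Determinant.det (reg_gram d l (insert j I) (F(j := a))) \<le>
      Determinant.det (reg_gram d l (insert j I) F)"
    and u: "u \<in> carrier_vec d" "reg_gram d l (insert j I) F *\<^sub>v u = a"
    and v: "v \<in> carrier_vec d" "reg_gram d l (insert j I) F *\<^sub>v v = F j"
  shows "scalar_prod u a * (1 - scalar_prod v (F j)) \<le> scalar_prod v (F j)"
proof -
  let ?W = "reg_gram d l I F" and ?V = "reg_gram d l (insert j I) F"
  have FI: "F \<in> I \<rightarrow> carrier_vec d" and b: "F j \<in> carrier_vec d" using F by auto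
  obtain m where m: "m \<in> carrier_vec d" "?W *\<^sub>v m = a"
    using reg_gram_solve[OF l FI a] by blast
  obtain n where n: "n \<in> carrier_vec d" "?W *\<^sub>v n = F j"
    using reg_gram_solve[OF l FI b] by blast
  have W': "reg_gram d l I (F(j := a)) = ?W"
    using I unfolding reg_gram_def by (intro cong_mat refl) (auto intro!: sum.cong)
  have "Determinant.det (reg_gram d l (insert j I) (F(j := a))) = Determinant.det ?W * (1 + scalar_prod a m)"
    using det_reg_gram_insert[OF I, of "F(j := a)" d m l] a m W' by simp
  moreover have "Determinant.det ?V = Determinant.det ?W * (1 + scalar_prod (F j) n)"
    by (rule det_reg_gram_insert[OF I b n])
  moreover have "0 < Determinant.det ?W" by (rule det_reg_gram_pos[OF l I(1) FI])
  ultimately have le: "scalar_prod a m \<le> scalar_prod (F j) n" using opt by simp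
  have split: "scalar_prod w (?V *\<^sub>v z) = scalar_prod w (?W *\<^sub>v z) + scalar_prod (F j) w * scalar_prod (F j) z"
    if "w \<in> carrier_vec d" "z \<in> carrier_vec d" for w z
    using scalar_prod_reg_gram[of z d w F "insert j I" l] scalar_prod_reg_gram[of z d w F I l] that F I
    by simp
  have sym: "scalar_prod w (?W *\<^sub>v z) = scalar_prod z (?W *\<^sub>v w)"
    if "w \<in> carrier_vec d" "z \<in> carrier_vec d" for w z
    using scalar_prod_reg_gram[of z d w F I l] scalar_prod_reg_gram[of w d z F I l] that FI
      comm_scalar_prod[of w d z]
    by (simp add: mult.commute)
  \<comment> \<open>In the inverse of \<open>?V\<close>, \<alpha> and \<gamma> are the squared norms
    of \<open>a\<close> and \<open>F j\<close>, and \<eta> is their inner product; \<open>h\<close>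
    is the squared norm of \<open>F j\<close> in the inverse of \<open>?W\<close>.\<close>
  define \<alpha> where "\<alpha> = scalar_prod u a"
  define \<gamma> where "\<gamma> = scalar_prod v (F j)"
  define \<eta> where "\<eta> = scalar_prod (F j) u"
  define h where "h = scalar_prod (F j) n"
  have \<gamma>': "scalar_prod (F j) v = \<gamma>"
    unfolding \<gamma>_def using comm_scalar_prod[OF b v(1)] .
  have am: "scalar_prod m a = scalar_prod a m" "scalar_prod u a = scalar_prod a u"
    "scalar_prod (F j) n = scalar_prod n (F j)" "scalar_prod (F j) m = scalar_prod m (F j)"
    using comm_scalar_prod a b u(1) m(1) n(1) by blast+
  have e1: "h = \<gamma> + h * \<gamma>"
  proof -
    have "scalar_prod n (?V *\<^sub>v v) = scalar_prod n (?W *\<^sub>v v) + h * \<gamma>"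
      using split[OF n(1) v(1)] by (simp add: h_def \<gamma>')
    then show ?thesis using sym[OF n(1) v(1)] v n am by (simp add: h_def \<gamma>_def)
  qed
  have h0: "0 \<le> h"
    using reg_gram_sol_nonneg(2)[OF l FI n] am by (simp add: h_def)
  have e2: "scalar_prod m (F j) = \<eta> + scalar_prod m (F j) * \<gamma>"
  proof -
    have "scalar_prod m (?V *\<^sub>v v) = scalar_prod m (?W *\<^sub>v v) + scalar_prod (F j) m * \<gamma>"
      using split[OF m(1) v(1)] by (simp add: \<gamma>')
    moreover have "scalar_prod v a = \<eta>"
      using scalar_prod_reg_gram[of u d v F "insert j I" l] scalar_prod_reg_gram[of v d u F "insert j I" l]
        F u v comm_scalar_prod[of u d v] comm_scalar_prod[OF b u(1)]
      by (simp add: \<eta>_def mult.commute)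
    ultimately show ?thesis using sym[OF m(1) v(1)] v m am by (simp add: \<eta>_def)
  qed
  have e3: "scalar_prod m a = \<alpha> + scalar_prod m (F j) * \<eta>"
  proof -
    have "scalar_prod m (?V *\<^sub>v u) = scalar_prod m (?W *\<^sub>v u) + scalar_prod (F j) m * \<eta>"
      using split[OF m(1) u(1)] by (simp add: \<eta>_def)
    then show ?thesis using sym[OF m(1) u(1)] u m am by (simp add: \<alpha>_def)
  qed
  have \<gamma>1: "\<gamma> * (1 + h) = h" using e1 by (simp add: algebra_simps)
  then have "(1 - \<gamma>) * (1 + h) = 1" by (simp add: algebra_simps)
  with h0 have \<gamma>lt: "0 < 1 - \<gamma>"
    by (smt (verit) mult_nonpos_nonneg)
  \<comment> \<open>\<open>z\<close> is the inner product of \<open>a\<close> and \<open>F j\<close>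
    in the inverse of \<open>?W\<close>. Passing to \<open>?V\<close> subtracts z * \<eta> = z^2 *
    (1 - \<gamma>) >= 0 from the squared norm of \<open>a\<close>, and optimality bounds the norm
    before subtraction by \<open>h\<close> = \<gamma> / (1 - \<gamma>).\<close>
  define z where "z = scalar_prod m (F j)"
  have "z * (1 - \<gamma>) = \<eta>" using e2 by (simp add: z_def algebra_simps)
  then have "z * \<eta> = z\<^sup>2 * (1 - \<gamma>)" by (simp add: power2_eq_square flip: mult.assoc)
  with \<gamma>lt have "0 \<le> z * \<eta>" by simp
  with e3 have "\<alpha> \<le> scalar_prod m a" by (simp add: z_def)
  also have "\<dots> \<le> h" using le am by (simp add: h_def)
  finally have "\<alpha> * (1 - \<gamma>) \<le> h * (1 - \<gamma>)" using \<gamma>lt by (simp add: mult_right_mono)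
  also have "\<dots> = \<gamma>" using e1 by (simp add: algebra_simps)
  finally show ?thesis by (simp add: \<alpha>_def \<gamma>_def)
qed

text \<open>The sum of leverages is the trace of V^-1 (V - l I) = I - l V^-1, that is, d minus
  \<open>l\<close> times a trace with nonnegative diagonal entries.\<close>

lemma sum_leverage_le:
  assumes l: "0 < l" and I: "finite I" and F: "F \<in> I \<rightarrow> carrier_vec d"
    and v: "v \<in> I \<rightarrow> carrier_vec d" "\<And>j. j \<in> I \<Longrightarrow> reg_gram d l I F *\<^sub>v v j = F j"
  shows "(\<Sum>j\<in>I. scalar_prod (v j) (F j)) \<le> real d"
proof -
  let ?V = "reg_gram d l I F"
  obtain U where U: "U \<in> carrier_mat d d" "?V * U = 1\<^sub>m d" "U * ?V = 1\<^sub>m d"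
    using obtain_right_inverse[OF reg_gram_carrier det_reg_gram_nonzero[OF l F]]
    by blast
  have vj: "v j = U *\<^sub>v F j" if "j \<in> I" for j
  proof -
    have "U *\<^sub>v F j = (U * ?V) *\<^sub>v v j"
      using v(2)[OF that] assoc_mult_mat_vec[OF U(1) reg_gram_carrier funcset_mem[OF v(1) that]] by metis
    then show ?thesis using funcset_mem[OF v(1) that] U by simp
  qed
  have Uii: "0 \<le> U $$ (i, i)" if i: "i < d" for i
  proof -
    have c: "col U i \<in> carrier_vec d" using U(1) i by auto
    have e: "?V *\<^sub>v col U i = unit_vec d i"
      using U i col_mult2[OF reg_gram_carrier U(1) i] by (metis col_one)
    have "0 \<le> scalar_prod (col U i) (unit_vec d i)"
      by (rule reg_gram_sol_nonneg(2)[OF l F c e])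
    then show ?thesis using U(1) i c by (simp add: scalar_prod_right_unit)
  qed
  have "(\<Sum>j\<in>I. scalar_prod (v j) (F j)) = (\<Sum>j\<in>I. \<Sum>i<d. \<Sum>k<d. U $$ (i, k) * F j $ k * F j $ i)"
  proof (rule sum.cong[OF refl])
    fix j assume j: "j \<in> I"
    show "scalar_prod (v j) (F j) = (\<Sum>i<d. \<Sum>k<d. U $$ (i, k) * F j $ k * F j $ i)"
      using funcset_mem[OF F j] U(1) by (simp add: vj[OF j] scalar_prod_def atLeast0LessThan sum_distrib_right)
  qed
  also have "\<dots> = (\<Sum>i<d. \<Sum>k<d. U $$ (i, k) * (\<Sum>j\<in>I. F j $ k * F j $ i))"
    by (subst sum.swap, rule sum.cong[OF refl], subst sum.swap) (simp add: sum_distrib_left mult.assoc)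
  also have "\<dots> = (\<Sum>i<d. \<Sum>k<d. U $$ (i, k) * (?V $$ (k, i) - (if k = i then l else 0)))"
    by (intro sum.cong refl) (auto simp: reg_gram_def)
  also have "\<dots> = (\<Sum>i<d. (\<Sum>k<d. U $$ (i, k) * ?V $$ (k, i)) - l * U $$ (i, i))"
    by (simp add: right_diff_distrib sum_subtractf if_distrib[of "\<lambda>z. _ * z"] mult.commute cong: if_cong)
  also have "\<dots> = (\<Sum>i<d. 1 - l * U $$ (i, i))"
  proof (rule sum.cong[OF refl])
    fix i assume "i \<in> {..<d}"
    then have i: "i < d" by simp
    have "(\<Sum>k<d. U $$ (i, k) * ?V $$ (k, i)) = (U * ?V) $$ (i, i)"
      using U(1) i by (simp add: scalar_prod_def row_def col_def reg_gram_def atLeast0LessThan)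
    then show "(\<Sum>k<d. U $$ (i, k) * ?V $$ (k, i)) - l * U $$ (i, i) = 1 - l * U $$ (i, i)"
      using U i by simp
  qed
  also have "\<dots> \<le> (\<Sum>i<d. 1)" using l Uii by (intro sum_mono) simp
  finally show ?thesis by simp
qed

text \<open>Here the number \<open>2 * d\<close> is decided. Summing \<alpha> * (1 - leverage) <=
  leverage over all arms of an optimal family, with total leverage at most d, gives \<alpha> * (2 d
  - d) <= d, hence \<alpha> <= 1. The coefficients \<open>scalar_prod (F j) u\<close> leave the
  residual l * u, whose entries have square at most l because l * |u|^2 <= \<alpha> <= 1.\<close>

lemma reg_design:
  fixes A :: "real vec set"
  assumes A: "finite A" "A \<noteq> {}" "A \<subseteq> carrier_vec d" and l: "0 < l" and d: "1 \<le> d"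
  shows "\<exists>F\<in>{..<2 * d} \<rightarrow>\<^sub>E A. \<forall>a\<in>A. \<exists>c. (\<Sum>j<2 * d. (c j)\<^sup>2) \<le> 1 \<and>
       (\<forall>i<d. (a $ i - (\<Sum>j<2 * d. c j * F j $ i))\<^sup>2 \<le> l)"
proof -
  let ?I = "{..<2 * d}"
  let ?det = "\<lambda>F. Determinant.det (reg_gram d l ?I F)"
  have fin: "finite (?I \<rightarrow>\<^sub>E A)" and ne: "?I \<rightarrow>\<^sub>E A \<noteq> {}"
    using A by (auto intro!: finite_PiE simp: PiE_eq_empty_iff)
  obtain F where F: "F \<in> ?I \<rightarrow>\<^sub>E A" and opt: "\<And>F'. F' \<in> ?I \<rightarrow>\<^sub>E A \<Longrightarrow> ?det F' \<le> ?det F"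
  proof -
    have "Max (?det ` (?I \<rightarrow>\<^sub>E A)) \<in> ?det ` (?I \<rightarrow>\<^sub>E A)"
      using fin ne by (intro Max_in) auto
    then obtain F where "F \<in> ?I \<rightarrow>\<^sub>E A" "?det F = Max (?det ` (?I \<rightarrow>\<^sub>E A))" by auto
    then show thesis using fin by (intro that[of F]) auto
  qed
  have Fc: "F \<in> ?I \<rightarrow> carrier_vec d" using F A(3) by blast
  have "\<exists>c. (\<Sum>j<2 * d. (c j)\<^sup>2) \<le> 1 \<and> (\<forall>i<d. (a $ i - (\<Sum>j<2 * d. c j * F j $ i))\<^sup>2 \<le> l)"
    if a: "a \<in> A" for a
  proof -
    have ac: "a \<in> carrier_vec d" using a A(3) by blast
    obtain u where u: "u \<in> carrier_vec d" "reg_gram d l ?I F *\<^sub>v u = a"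
      by (rule reg_gram_solve[OF l Fc ac])
    have "\<exists>w. w \<in> carrier_vec d \<and> reg_gram d l ?I F *\<^sub>v w = F j" if "j \<in> ?I" for j
      using Fc that by (auto intro: reg_gram_solve[OF l Fc, of "F j"])
    then obtain v where v: "v \<in> ?I \<rightarrow> carrier_vec d"
        "\<And>j. j \<in> ?I \<Longrightarrow> reg_gram d l ?I F *\<^sub>v v j = F j"
      by (metis Pi_I)
    define \<alpha> where "\<alpha> = scalar_prod u a"
    have step: "\<alpha> * (1 - scalar_prod (v j) (F j)) \<le> scalar_prod (v j) (F j)" if j: "j \<in> ?I" for j
    proof -
      have ins: "insert j (?I - {j}) = ?I" using j by auto
      have "F(j := a) \<in> ?I \<rightarrow>\<^sub>E A" using F a j by (auto simp: PiE_iff extensional_def)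
      then show ?thesis
        unfolding \<alpha>_def
        using reg_gram_exchange[OF l, of "?I - {j}" j F d a u "v j"] Fc ac opt u v j
        unfolding ins by auto
    qed
    have lev: "(\<Sum>j\<in>?I. scalar_prod (v j) (F j)) \<le> real d"
      by (rule sum_leverage_le[OF l _ Fc v]) auto
    have \<alpha>0: "0 \<le> \<alpha>" unfolding \<alpha>_def by (rule reg_gram_sol_nonneg(2)[OF l Fc u])
    have "\<alpha> * real d \<le> \<alpha> * (2 * real d - (\<Sum>j\<in>?I. scalar_prod (v j) (F j)))"
      using \<alpha>0 lev by (intro mult_left_mono) auto
    also have "\<dots> = (\<Sum>j\<in>?I. \<alpha> * (1 - scalar_prod (v j) (F j)))"
      by (simp add: sum_distrib_left[symmetric] sum_subtractf)
    also have "\<dots> \<le> (\<Sum>j\<in>?I. scalar_prod (v j) (F j))" using step by (intro sum_mono) auto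
    also have "\<dots> \<le> 1 * real d" using lev by simp
    finally have \<alpha>1: "\<alpha> \<le> 1" using d by (simp add: mult_le_cancel_right)
    have eq: "l * scalar_prod u u + (\<Sum>j\<in>?I. (scalar_prod (F j) u)\<^sup>2) = \<alpha>"
      unfolding \<alpha>_def by (rule reg_gram_sol_nonneg(1)[OF l Fc u])
    show ?thesis
    proof (intro exI[of _ "\<lambda>j. scalar_prod (F j) u"] conjI allI impI)
      show "(\<Sum>j<2 * d. (scalar_prod (F j) u)\<^sup>2) \<le> 1"
        using eq \<alpha>1 l scalar_prod_self_nonneg[of u] by (smt (verit) mult_nonneg_nonneg)
      fix i assume i: "i < d"
      have "a $ i - (\<Sum>j<2 * d. scalar_prod (F j) u * F j $ i) = l * u $ i"
        using reg_gram_mult_vec[OF u(1) i, of l ?I F] u(2) by (simp add: mult.commute)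
      moreover have "l * (u $ i)\<^sup>2 \<le> 1"
      proof -
        have "(u $ i)\<^sup>2 \<le> scalar_prod u u"
          using i u(1) member_le_sum[of i "{..<d}" "\<lambda>i. u $ i * u $ i"]
          by (simp add: scalar_prod_def power2_eq_square atLeast0LessThan)
        then have "l * (u $ i)\<^sup>2 \<le> l * scalar_prod u u" using l by simp
        also have "\<dots> \<le> 1"
          using eq \<alpha>1 sum_nonneg[of ?I "\<lambda>j. (scalar_prod (F j) u)\<^sup>2"] by simp
        finally show ?thesis .
      qed
      then have "l * (l * (u $ i)\<^sup>2) \<le> l * 1" using l by (intro mult_left_mono) auto
      ultimately show "(a $ i - (\<Sum>j<2 * d. scalar_prod (F j) u * F j $ i))\<^sup>2 \<le> l"
        by (simp add: power_mult_distrib power2_eq_square mult_ac)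
    qed
  qed
  then show ?thesis by (intro bexI[OF _ F] ballI)
qed

lemma bounded_sequences_common_subseq:
  fixes c :: "nat \<Rightarrow> nat \<Rightarrow> real"
  assumes "\<And>n j. j < N \<Longrightarrow> \<bar>c n j\<bar> \<le> 1"
  shows "\<exists>r e. strict_mono (r :: nat \<Rightarrow> nat) \<and> (\<forall>j<N. (\<lambda>n. c (r n) j) \<longlonglongrightarrow> e j)"
  using assms
proof (induction N)
  case 0
  then show ?case by (intro exI[of _ id]) (auto simp: strict_mono_def)
next
  case (Suc N)
  then obtain r e where r: "strict_mono r" "\<And>j. j < N \<Longrightarrow> (\<lambda>n. c (r n) j) \<longlonglongrightarrow> e j"
    by (metis less_Suc_eq)
  have "bounded (range (\<lambda>n. c (r n) N))"
    using Suc.prems by (auto simp: bounded_iff)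
  then obtain x s where s: "strict_mono s" "((\<lambda>n. c (r n) N) \<circ> s) \<longlonglongrightarrow> x"
    using bounded_imp_convergent_subsequence by blast
  have "(\<lambda>n. c ((r \<circ> s) n) j) \<longlonglongrightarrow> (e(N := x)) j" if "j < Suc N" for j
    using that s LIMSEQ_subseq_LIMSEQ[OF r(2) s(1), of j]
    by (cases "j = N") (auto simp: o_def)
  then show ?case using strict_mono_o[OF r(1) s(1)] by blast
qed

text \<open>Letting the regularisation tend to 0: some family is optimal infinitely often, and its
  coefficients have a convergent subsequence.\<close>

lemma small_design:
  fixes A :: "real vec set"
  assumes A: "finite A" "A \<noteq> {}" "A \<subseteq> carrier_vec d" and d: "1 \<le> d"
  shows "\<exists>F c. (\<forall>j<2 * d. F j \<in> A) \<and> (\<forall>a\<in>A. (\<Sum>j<2 * d. (c a j)\<^sup>2) \<le> 1 \<and>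
       (\<forall>i<d. a $ i = (\<Sum>j<2 * d. c a j * F j $ i)))"
proof -
  let ?P = "\<lambda>l F. \<forall>a\<in>A. \<exists>c. (\<Sum>j<2 * d. (c j)\<^sup>2) \<le> 1 \<and>
       (\<forall>i<d. (a $ i - (\<Sum>j<2 * d. c j * F j $ i))\<^sup>2 \<le> l)"
  have fin: "finite ({..<2 * d} \<rightarrow>\<^sub>E A)" using A by (auto intro!: finite_PiE)
  have "\<exists>F\<in>{..<2 * d} \<rightarrow>\<^sub>E A. ?P (1 / real (Suc n)) F" for n
    by (rule reg_design[OF A _ d]) simp
  then have "\<forall>n\<in>UNIV. \<exists>F\<in>{..<2 * d} \<rightarrow>\<^sub>E A. ?P (1 / real (Suc n)) F" by (rule ballI)
  from pigeonhole_infinite_rel[OF infinite_UNIV_nat fin this]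
  obtain F where F: "F \<in> {..<2 * d} \<rightarrow>\<^sub>E A" and inf: "infinite {n \<in> UNIV. ?P (1 / real (Suc n)) F}"
    by (rule bexE)
  have "\<exists>e. (\<Sum>j<2 * d. (e j)\<^sup>2) \<le> 1 \<and> (\<forall>i<d. a $ i = (\<Sum>j<2 * d. e j * F j $ i))" if a: "a \<in> A" for a
  proof -
    have "\<exists>c. (\<Sum>j<2 * d. (c j)\<^sup>2) \<le> 1 \<and>
       (\<forall>i<d. (a $ i - (\<Sum>j<2 * d. c j * F j $ i))\<^sup>2 \<le> 1 / real (Suc n))" for n
    proof -
      \<comment> \<open>The condition weakens as \<open>l\<close> grows, so a family that is good at
        infinitely many levels is good at every level \<open>n\<close>.\<close>
      obtain m where m: "n \<le> m" "m \<in> {n \<in> UNIV. ?P (1 / real (Suc n)) F}"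
        using inf unfolding infinite_nat_iff_unbounded_le by (elim allE[of _ n] exE conjE)
      have "1 / real (Suc m) \<le> 1 / real (Suc n)" using m(1) by (simp add: frac_le)
      moreover obtain c where "(\<Sum>j<2 * d. (c j)\<^sup>2) \<le> 1"
        "\<forall>i<d. (a $ i - (\<Sum>j<2 * d. c j * F j $ i))\<^sup>2 \<le> 1 / real (Suc m)"
        using bspec[OF conjunct2[OF m(2)[unfolded mem_Collect_eq]] a] by (elim exE conjE)
      ultimately show ?thesis by (intro exI[of _ c]) (auto intro: order_trans)
    qed
    from choice[OF allI[OF this]] obtain c where c: "\<forall>n. (\<Sum>j<2 * d. (c n j)\<^sup>2) \<le> 1 \<and>
       (\<forall>i<d. (a $ i - (\<Sum>j<2 * d. c n j * F j $ i))\<^sup>2 \<le> 1 / real (Suc n))"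
      by (rule exE)
    have c1: "(\<Sum>j<2 * d. (c n j)\<^sup>2) \<le> 1" for n using c by simp
    have c2: "(a $ i - (\<Sum>j<2 * d. c n j * F j $ i))\<^sup>2 \<le> 1 / real (Suc n)" if "i < d" for n i
      using spec[OF conjunct2[OF spec[OF c, of n]], of i] that by (rule mp)
    have "\<bar>c n j\<bar> \<le> 1" if "j < 2 * d" for n j
    proof -
      have "(c n j)\<^sup>2 \<le> (\<Sum>j<2 * d. (c n j)\<^sup>2)"
        using that by (intro member_le_sum) auto
      then show ?thesis using c1[of n] by (simp add: order_trans flip: abs_square_le_1)
    qed
    from bounded_sequences_common_subseq[of "2 * d" c, OF this]
    obtain r e where r: "strict_mono (r :: nat \<Rightarrow> nat)" "\<And>j. j < 2 * d \<Longrightarrow> (\<lambda>n. c (r n) j) \<longlonglongrightarrow> e j"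
      by metis
    have "(\<lambda>n. \<Sum>j<2 * d. (c (r n) j)\<^sup>2) \<longlonglongrightarrow> (\<Sum>j<2 * d. (e j)\<^sup>2)"
      by (intro tendsto_sum tendsto_power r) auto
    then have "(\<Sum>j<2 * d. (e j)\<^sup>2) \<le> 1"
      by (rule LIMSEQ_le_const2) (use c1 in auto)
    moreover have "a $ i = (\<Sum>j<2 * d. e j * F j $ i)" if i: "i < d" for i
    proof -
      have "(\<lambda>n. (a $ i - (\<Sum>j<2 * d. c (r n) j * F j $ i))\<^sup>2) \<longlonglongrightarrow>
          (a $ i - (\<Sum>j<2 * d. e j * F j $ i))\<^sup>2"
        by (intro tendsto_intros r) auto
      moreover have "(\<lambda>n. 1 / real (Suc (r n))) \<longlonglongrightarrow> 0"
        using LIMSEQ_subseq_LIMSEQ[OF lim_1_over_n r(1)] LIMSEQ_subseq_LIMSEQ[OF LIMSEQ_inverse_real_of_nat r(1)]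
        by (simp add: o_def inverse_eq_divide)
      ultimately have "(a $ i - (\<Sum>j<2 * d. e j * F j $ i))\<^sup>2 \<le> 0"
        by (rule LIMSEQ_le) (use c2[OF i] in auto)
      then show ?thesis by simp
    qed
    ultimately show ?thesis by (intro exI[of _ e] conjI allI impI)
  qed
  then have "\<forall>a\<in>A. \<exists>e. (\<Sum>j<2 * d. (e j)\<^sup>2) \<le> 1 \<and> (\<forall>i<d. a $ i = (\<Sum>j<2 * d. e j * F j $ i))"
    by (rule ballI)
  from bchoice[OF this] obtain c where c: "\<forall>a\<in>A. (\<Sum>j<2 * d. (c a j)\<^sup>2) \<le> 1 \<and>
       (\<forall>i<d. a $ i = (\<Sum>j<2 * d. c a j * F j $ i))"
    by (rule exE)
  have "\<forall>j<2 * d. F j \<in> A" using F by auto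
  with c show ?thesis by (intro exI conjI)
qed

section \<open>Adaptive protocols with one-bit answers\<close>

text \<open>\<open>Ask a s t k\<close> plays arm \<open>a\<close> during one batch, receives the bit \<open>t < s * x\<close> for the mean reward \<open>x\<close> of
  the batch, and continues with \<open>k\<close>; \<open>Ret\<close> marks the end of learning.\<close>

datatype ('a, 'r) prot = Ret 'r | Ask 'a real real "bool \<Rightarrow> ('a, 'r) prot"

primrec bind_prot :: "('a, 'r) prot \<Rightarrow> ('r \<Rightarrow> ('a, 's) prot) \<Rightarrow> ('a, 's) prot" where
  "bind_prot (Ret r) f = f r"
| "bind_prot (Ask a s t k) f = Ask a s t (\<lambda>b. bind_prot (k b) f)"

primrec all_prot :: "('a \<Rightarrow> bool) \<Rightarrow> ('r \<Rightarrow> bool) \<Rightarrow> ('a, 'r) prot \<Rightarrow> bool" where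
  "all_prot P Q (Ret r) \<longleftrightarrow> Q r"
| "all_prot P Q (Ask a s t k) \<longleftrightarrow> P a \<and> (\<forall>b. all_prot P Q (k b))"

lemma all_prot_bind:
  assumes "all_prot P Q p" and "\<And>r. Q r \<Longrightarrow> all_prot P Q' (f r)"
  shows "all_prot P Q' (bind_prot p f)"
  using assms(1) by (induction p) (auto simp: assms(2))

text \<open>The noise enters only through \<open>pr a s t\<close>, the probability of a yes to a
  query; \<open>g a\<close> is the cost charged for one batch of arm \<open>a\<close>. The answers
  are independent given the queries, which is built into \<open>ex\<close>.\<close>

locale answer_model =
  fixes pr :: "'a \<Rightarrow> real \<Rightarrow> real \<Rightarrow> real" and g :: "'a \<Rightarrow> real"
  assumes pr_nonneg: "0 \<le> pr a s t" and pr_le_1: "pr a s t \<le> 1"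
begin

text \<open>\<open>F\<close> receives the returned value and the cost accumulated on the way to it.\<close>

primrec ex :: "('a, 'r) prot \<Rightarrow> ('r \<Rightarrow> real \<Rightarrow> real) \<Rightarrow> real" where
  "ex (Ret r) = (\<lambda>F. F r 0)"
| "ex (Ask a s t k) = (\<lambda>F. pr a s t * ex (k True) (\<lambda>r c. F r (g a + c)) +
     (1 - pr a s t) * ex (k False) (\<lambda>r c. F r (g a + c)))"

lemma ex_mono: "(\<And>r c. F r c \<le> H r c) \<Longrightarrow> ex p F \<le> ex p H"
proof (induction p arbitrary: F H)
  case (Ask a s t k)
  then show ?case
    by (auto intro!: add_mono mult_left_mono simp: pr_nonneg pr_le_1)
qed simp

lemma ex_const: "ex p (\<lambda>_ _. x) = x"
  by (induction p) (auto simp: algebra_simps)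

lemma ex_add: "ex p (\<lambda>r c. F r c + H r c) = ex p F + ex p H"
  by (induction p arbitrary: F H) (auto simp: algebra_simps)

lemma ex_cmult: "ex p (\<lambda>r c. x * F r c) = x * ex p F"
  by (induction p arbitrary: F) (auto simp: algebra_simps)

lemma ex_bind: "ex (bind_prot p f) F = ex p (\<lambda>r c. ex (f r) (\<lambda>r' c'. F r' (c + c')))"
  by (induction p arbitrary: F) (auto simp: add.assoc)

definition fail :: "('a, 'r) prot \<Rightarrow> ('r \<Rightarrow> real \<Rightarrow> bool) \<Rightarrow> real" where
  "fail p Q = ex p (\<lambda>r c. if Q r c then 0 else 1)"

lemma fail_Ret: "Q r 0 \<Longrightarrow> fail (Ret r) Q = 0"
  by (simp add: fail_def)

lemma fail_mono: "(\<And>r c. Q r c \<Longrightarrow> Q' r c) \<Longrightarrow> fail p Q' \<le> fail p Q"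
  unfolding fail_def by (intro ex_mono) auto

lemma fail_le_1: "fail p Q \<le> 1"
  using ex_mono[of "\<lambda>r c. if Q r c then 0 else 1" "\<lambda>_ _. 1" p] by (simp add: fail_def ex_const)

text \<open>A union bound along the tree: branches violating the intermediate event \<open>Q\<close>
  are charged to \<open>x\<close>, since no continuation fails with probability above 1; the others
  fail with probability at most \<open>y\<close>. The cost \<open>c\<close> already paid is carried
  into the continuation.\<close>

lemma fail_bind:
  assumes p: "fail p Q \<le> x" and f: "\<And>r c. Q r c \<Longrightarrow> fail (f r) (\<lambda>r' c'. Q' r' (c + c')) \<le> y" and y: "0 \<le> y"
  shows "fail (bind_prot p f) Q' \<le> x + y"
proof -
  have "fail (bind_prot p f) Q' = ex p (\<lambda>r c. fail (f r) (\<lambda>r' c'. Q' r' (c + c')))"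
    by (simp add: fail_def ex_bind)
  also have "\<dots> \<le> ex p (\<lambda>r c. (if Q r c then 0 else 1) + y)"
  proof (rule ex_mono)
    fix r c
    show "fail (f r) (\<lambda>r' c'. Q' r' (c + c')) \<le> (if Q r c then 0 else 1) + y"
      using f[of r c] fail_le_1[of "f r" "\<lambda>r' c'. Q' r' (c + c')"] y by (cases "Q r c") auto
  qed
  also have "\<dots> = fail p Q + y" by (simp add: ex_add ex_const fail_def)
  finally show ?thesis using p by simp
qed

lemma fail_bind_Ret: "fail (bind_prot p (\<lambda>r. Ret (f r))) Q = fail p (\<lambda>r c. Q (f r) c)"
  by (simp add: fail_def ex_bind)

end

section \<open>Bernstein bound for weighted sums of answers\<close>

lemma exp_le_quadratic:
  fixes x :: real
  assumes "\<bar>x\<bar> \<le> 1"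
  shows "exp x \<le> 1 + x + x\<^sup>2"
proof (cases "0 \<le> x")
  case True
  then show ?thesis using assms exp_bound[of x] by simp
next
  case False
  define y where "y = - x"
  have y: "0 < y" using False by (simp add: y_def)
  have "exp x = 1 / exp y" by (simp add: y_def exp_minus inverse_eq_divide)
  also have "\<dots> \<le> 1 / (1 + y)" using y by (intro divide_left_mono) (auto intro: exp_ge_add_one_self add_pos_pos)
  also have "\<dots> \<le> 1 - y + y\<^sup>2"
  proof -
    have "1 \<le> (1 - y + y\<^sup>2) * (1 + y)"
      using y by (simp add: algebra_simps power2_eq_square)
    then show ?thesis using y by (simp add: divide_le_eq)
  qed
  finally show ?thesis by (simp add: y_def)
qed

text \<open>A query is a triple of weight, sign and threshold; a yes adds the weight to the
  accumulator. The queries are fixed in advance, so the answers are independent.\<close>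

primrec ask_all :: "'a \<Rightarrow> (real \<times> real \<times> real) list \<Rightarrow> real \<Rightarrow> ('a, real) prot" where
  "ask_all a [] v = Ret v"
| "ask_all a (q # qs) v =
     Ask a (fst (snd q)) (snd (snd q)) (\<lambda>b. ask_all a qs (v + (if b then fst q else 0)))"

lemma all_prot_ask_all: "P a \<Longrightarrow> (\<And>r. Q r) \<Longrightarrow> all_prot P Q (ask_all a qs v)"
  by (induction qs arbitrary: v) auto

context answer_model
begin

lemma ex_ask_all_cost:
  "ex (ask_all a qs v) F = ex (ask_all a qs v) (\<lambda>r c. F r (real (length qs) * g a))"
proof (induction qs arbitrary: v F)
  case (Cons q qs)
  show ?case
    using Cons.IH[of _ "\<lambda>r c. F r (g a + c)"] by (simp add: algebra_simps)
qed simp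

abbreviation yes :: "'a \<Rightarrow> real \<times> real \<times> real \<Rightarrow> real" where
  "yes a q \<equiv> pr a (fst (snd q)) (snd (snd q))"

text \<open>Each query contributes a factor 1 + p * (exp x - 1) <= exp (p * (x + x^2)). Keeping the
  yes-probability p in front of x^2 is essential: large weights belong to high thresholds, which are
  rarely exceeded.\<close>

lemma ex_ask_all_exp:
  assumes "\<And>q. q \<in> set qs \<Longrightarrow> \<bar>l * fst q\<bar> \<le> 1"
  shows "ex (ask_all a qs v) (\<lambda>r c. exp (l * r)) \<le>
    exp (l * v + (\<Sum>q\<leftarrow>qs. yes a q * (l * fst q + (l * fst q)\<^sup>2)))"
  using assms
proof (induction qs arbitrary: v)
  case (Cons q qs)
  let ?S = "\<Sum>q\<leftarrow>qs. yes a q * (l * fst q + (l * fst q)\<^sup>2)"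
  let ?p = "yes a q" and ?x = "l * fst q"
  have p: "0 \<le> ?p" "?p \<le> 1" by (simp_all add: pr_nonneg pr_le_1)
  have IH: "ex (ask_all a qs v) (\<lambda>r c. exp (l * r)) \<le> exp (l * v + ?S)" for v
    using Cons by simp
  have "ex (ask_all a (q # qs) v) (\<lambda>r c. exp (l * r)) \<le>
      ?p * exp (l * (v + fst q) + ?S) + (1 - ?p) * exp (l * v + ?S)"
    using p IH[of "v + fst q"] IH[of v] by (simp add: add_mono mult_left_mono)
  also have "\<dots> = exp (l * v + ?S) * (1 + ?p * (exp ?x - 1))"
    by (simp add: algebra_simps exp_add)
  also have "\<dots> \<le> exp (l * v + ?S) * (1 + ?p * (?x + ?x\<^sup>2))"
    using exp_le_quadratic[of ?x] Cons.prems[of q] p by (intro mult_left_mono add_left_mono) auto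
  also have "\<dots> \<le> exp (l * v + ?S) * exp (?p * (?x + ?x\<^sup>2))"
    by (intro mult_left_mono exp_ge_add_one_self) simp
  also have "\<dots> = exp (l * v + (\<Sum>q\<leftarrow>q # qs. yes a q * (l * fst q + (l * fst q)\<^sup>2)))"
    by (simp add: exp_add algebra_simps)
  finally show ?case .
qed simp

text \<open>Exponential Markov inequality for both tails, whence the factor 2. The exponent
  \<open>l\<close> stays free so that it can be matched to the largest weight.\<close>

lemma fail_ask_all:
  assumes l: "0 < l" and w: "\<And>q. q \<in> set qs \<Longrightarrow> \<bar>l * fst q\<bar> \<le> 1"
    and m: "m = (\<Sum>q\<leftarrow>qs. yes a q * fst q)" and V: "(\<Sum>q\<leftarrow>qs. yes a q * (fst q)\<^sup>2) \<le> V"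
  shows "fail (ask_all a qs 0) (\<lambda>r c. \<bar>r - m\<bar> \<le> y \<and> c = real (length qs) * g a)
    \<le> 2 * exp (l\<^sup>2 * V - l * y)"
proof -
  have bnd: "ex (ask_all a qs 0) (\<lambda>r c. exp (l' * r)) \<le> exp (l' * m + l\<^sup>2 * V)" if "l' = l \<or> l' = - l" for l'
  proof -
    have w': "\<bar>l' * fst q\<bar> \<le> 1" if "q \<in> set qs" for q
      using w[OF that] \<open>l' = l \<or> l' = - l\<close> by auto
    have sq: "l'\<^sup>2 = l\<^sup>2" using that by auto
    have "(\<Sum>q\<leftarrow>qs. yes a q * (l' * fst q + (l' * fst q)\<^sup>2)) = l' * m + l\<^sup>2 * (\<Sum>q\<leftarrow>qs. yes a q * (fst q)\<^sup>2)"
      unfolding m sq[symmetric] by (induction qs) (simp_all add: algebra_simps power2_eq_square)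
    also have "\<dots> \<le> l' * m + l\<^sup>2 * V" using V by (simp add: mult_left_mono)
    finally have "exp (l' * 0 + (\<Sum>q\<leftarrow>qs. yes a q * (l' * fst q + (l' * fst q)\<^sup>2))) \<le> exp (l' * m + l\<^sup>2 * V)"
      by simp
    then show ?thesis using ex_ask_all_exp[of qs l' a 0] w' by (meson order_trans)
  qed
  have "fail (ask_all a qs 0) (\<lambda>r c. \<bar>r - m\<bar> \<le> y \<and> c = real (length qs) * g a) =
      ex (ask_all a qs 0) (\<lambda>r c. if \<bar>r - m\<bar> \<le> y then 0 else 1)"
    unfolding fail_def by (subst ex_ask_all_cost) simp
  also have "\<dots> \<le> ex (ask_all a qs 0) (\<lambda>r c. exp (- l * (m + y)) * exp (l * r) + exp (- l * (y - m)) * exp (- l * r))"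
  proof (rule ex_mono)
    fix r c :: real
    have "1 \<le> exp (- l * (m + y) + l * r)" if "m + y < r"
      using that l mult_left_mono[of "m + y" r l] by simp
    moreover have "1 \<le> exp (- l * (y - m) + - l * r)" if "r < m - y"
    proof -
      have "l * r \<le> l * (m - y)" using that l by (intro mult_left_mono) auto
      then show ?thesis by (simp add: algebra_simps)
    qed
    ultimately show "(if \<bar>r - m\<bar> \<le> y then 0 else 1) \<le>
        exp (- l * (m + y)) * exp (l * r) + exp (- l * (y - m)) * exp (- l * r)"
      by (auto simp: abs_le_iff not_le simp flip: exp_add intro: add_increasing add_increasing2)
  qed
  also have "\<dots> \<le> exp (- l * (m + y)) * exp (l * m + l\<^sup>2 * V) + exp (- l * (y - m)) * exp (- l * m + l\<^sup>2 * V)"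
    unfolding ex_add ex_cmult using bnd[of l] bnd[of "- l"] by (intro add_mono mult_left_mono) auto
  also have "\<dots> = 2 * exp (l\<^sup>2 * V - l * y)"
    by (simp flip: exp_add add: algebra_simps)
  finally show ?thesis .
qed

end

section \<open>One-bit estimation of a mean\<close>

text \<open>The spacing of the thresholds is proportional to 1 + threshold: fine enough for a bias of order
  \<open>\<beta>\<close> under a second moment bound, and coarse enough to reach \<open>1 / \<beta>\<close> with few thresholds.\<close>

definition grid_thr :: "real \<Rightarrow> nat \<Rightarrow> real" where
  "grid_thr \<beta> k = exp (\<beta> * real (Suc k)) - 1"

text \<open>The length of the cell that ends at threshold \<open>k\<close>, the first cell starting
  at 0. For x >= 0 the weights of the thresholds below x telescope, so their sum undershoots x by at
  most one cell as long as x lies within the grid.\<close>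

definition grid_wt :: "real \<Rightarrow> nat \<Rightarrow> real" where
  "grid_wt \<beta> k = exp (\<beta> * real (Suc k)) - exp (\<beta> * real k)"

text \<open>The number of cells after which exp (\<beta> * k) has reached 1 / \<beta>. Values beyond
  the grid are truncated, at an error that \<beta> times a second moment can absorb.\<close>

definition grid_size :: "real \<Rightarrow> nat" where
  "grid_size \<beta> = nat \<lceil>ln (1 / \<beta>) / \<beta>\<rceil>"

section \<open>Bias and second moment of the threshold grid\<close>

lemma grid_wt_nonneg: "0 \<le> \<beta> \<Longrightarrow> 0 \<le> grid_wt \<beta> k"
  by (simp add: grid_wt_def mult_left_mono)

lemma grid_wt_le: "grid_wt \<beta> k \<le> \<beta> * exp (\<beta> * real (Suc k))"
proof -
  have "exp (\<beta> * real k) = exp (\<beta> * real (Suc k)) * exp (- \<beta>)"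
    by (simp flip: exp_add add: algebra_simps)
  moreover have "exp (\<beta> * real (Suc k)) * (1 - \<beta>) \<le> exp (\<beta> * real (Suc k)) * exp (- \<beta>)"
    using exp_ge_add_one_self[of "- \<beta>"] by (intro mult_left_mono) auto
  ultimately show ?thesis by (simp add: grid_wt_def algebra_simps)
qed

lemma grid_step:
  assumes \<beta>: "0 < \<beta>" "\<beta> \<le> 1" and x: "exp (\<beta> * real k) - 1 \<le> x"
  shows "grid_wt \<beta> k \<le> 2 * \<beta> * (1 + x)"
proof -
  have "exp \<beta> - 1 \<le> 2 * \<beta>"
    using exp_le_quadratic[of \<beta>] \<beta> by (simp add: power2_eq_square mult_left_le_one_le) (smt (verit) mult_left_le)
  moreover have "0 \<le> 1 + x" using x exp_gt_zero[of "\<beta> * real k"] by linarith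
  ultimately have "exp (\<beta> * real k) * (exp \<beta> - 1) \<le> (1 + x) * (2 * \<beta>)"
    using \<beta> x by (intro mult_mono) auto
  then show ?thesis by (simp add: grid_wt_def algebra_simps exp_add)
qed

lemma grid_pos_sum:
  assumes \<beta>: "0 < \<beta>" "\<beta> \<le> 1" and x: "0 \<le> x"
  defines "\<Phi> n \<equiv> \<Sum>k<n. grid_wt \<beta> k * of_bool (grid_thr \<beta> k < x)"
  shows "\<Phi> n \<le> x" and "x \<le> exp (\<beta> * real n) - 1 \<Longrightarrow> x - \<Phi> n \<le> 2 * \<beta> * (1 + x)"
proof -
  \<comment> \<open>The third conjunct strengthens the induction: when x first falls into the new
    cell, the sum so far must be known exactly.\<close>
  have "\<Phi> n \<le> x \<and> (x \<le> exp (\<beta> * real n) - 1 \<longrightarrow> x - \<Phi> n \<le> 2 * \<beta> * (1 + x)) \<and>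
     (exp (\<beta> * real n) - 1 < x \<longrightarrow> \<Phi> n = exp (\<beta> * real n) - 1)"
  proof (induction n)
    case 0
    then show ?case using x \<beta> by (auto simp: \<Phi>_def)
  next
    case (Suc n)
    have mono: "exp (\<beta> * real n) \<le> exp (\<beta> * real (Suc n))" using \<beta> by (simp add: mult_left_mono)
    have \<Phi>: "\<Phi> (Suc n) = \<Phi> n + grid_wt \<beta> n * of_bool (exp (\<beta> * real (Suc n)) - 1 < x)"
      by (simp add: \<Phi>_def grid_thr_def)
    consider "exp (\<beta> * real (Suc n)) - 1 < x" | "x \<le> exp (\<beta> * real n) - 1"
      | "exp (\<beta> * real n) - 1 < x" "x \<le> exp (\<beta> * real (Suc n)) - 1" by linarith
    then show ?case
    proof cases
      case 1
      then have "exp (\<beta> * real n) - 1 < x" using mono by linarith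
      with 1 Suc \<Phi> show ?thesis by (simp add: grid_wt_def)
    next
      case 2
      then have no: "\<not> exp (\<beta> * real (Suc n)) - 1 < x" using mono by linarith
      then have "\<Phi> (Suc n) = \<Phi> n" using \<Phi> by simp
      with 2 Suc no show ?thesis by auto
    next
      case 3
      then have "\<Phi> (Suc n) = exp (\<beta> * real n) - 1" using Suc \<Phi> by simp
      moreover have "grid_wt \<beta> n \<le> 2 * \<beta> * (1 + x)" using 3 \<beta> by (intro grid_step) auto
      ultimately show ?thesis using 3 unfolding grid_wt_def by auto
    qed
  qed
  then show "\<Phi> n \<le> x" "x \<le> exp (\<beta> * real n) - 1 \<Longrightarrow> x - \<Phi> n \<le> 2 * \<beta> * (1 + x)" by auto
qed

lemma exp_grid_size:
  assumes \<beta>: "0 < \<beta>" "\<beta> \<le> 1"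
  shows "1 / \<beta> \<le> exp (\<beta> * real (grid_size \<beta>))" and "\<beta> * exp (\<beta> * real (grid_size \<beta>)) \<le> 3"
proof -
  have ln0: "0 \<le> ln (1 / \<beta>)" using \<beta> by simp
  have "0 \<le> ln (1 / \<beta>) / \<beta>" using ln0 \<beta> by (intro divide_nonneg_pos)
  then have up: "real (grid_size \<beta>) \<le> ln (1 / \<beta>) / \<beta> + 1" unfolding grid_size_def by linarith
  have lo: "ln (1 / \<beta>) / \<beta> \<le> real (grid_size \<beta>)" unfolding grid_size_def by (rule real_nat_ceiling_ge)
  have "ln (1 / \<beta>) \<le> \<beta> * real (grid_size \<beta>)" using lo \<beta> by (simp add: field_simps)
  then show "1 / \<beta> \<le> exp (\<beta> * real (grid_size \<beta>))"
    using \<beta> by (metis exp_le_cancel_iff exp_ln zero_less_divide_1_iff)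
  have "\<beta> * real (grid_size \<beta>) \<le> \<beta> * (ln (1 / \<beta>) / \<beta> + 1)" using up \<beta> by (intro mult_left_mono) auto
  also have "\<dots> = ln (1 / \<beta>) + \<beta>" using \<beta> by (simp add: field_simps)
  also have "\<dots> \<le> ln (1 / \<beta>) + 1" using \<beta> by simp
  finally have "exp (\<beta> * real (grid_size \<beta>)) \<le> exp (ln (1 / \<beta>) + 1)" by simp
  also have "\<dots> \<le> (1 / \<beta>) * 3" 
    using \<beta> exp_le by (simp add: exp_add divide_right_mono)
  finally show "\<beta> * exp (\<beta> * real (grid_size \<beta>)) \<le> 3" using \<beta> by (simp add: field_simps)
qed

text \<open>The estimate of a normalised value x from one copy of the grid, extended to negative x
  as an odd function by asking the same thresholds about -x.\<close>

definition grid_val :: "real \<Rightarrow> real \<Rightarrow> real" where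
  "grid_val \<beta> x = (\<Sum>k<grid_size \<beta>. grid_wt \<beta> k * (of_bool (grid_thr \<beta> k < x) - of_bool (grid_thr \<beta> k < - x)))"

text \<open>Its expectation is the variance proxy required by \<open>fail_ask_all\<close>, before
  division by the number of copies.\<close>

definition grid_sq :: "real \<Rightarrow> real \<Rightarrow> real" where
  "grid_sq \<beta> x = (\<Sum>k<grid_size \<beta>. (grid_wt \<beta> k)\<^sup>2 * (of_bool (grid_thr \<beta> k < x) + of_bool (grid_thr \<beta> k < - x)))"

lemma grid_thr_nonneg: "0 \<le> \<beta> \<Longrightarrow> 0 \<le> grid_thr \<beta> k"
  by (simp add: grid_thr_def)

lemma grid_val_minus: "grid_val \<beta> (- x) = - grid_val \<beta> x"
  by (simp add: grid_val_def sum_negf[symmetric] algebra_simps)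

lemma grid_sq_minus: "grid_sq \<beta> (- x) = grid_sq \<beta> x"
  by (simp add: grid_sq_def add.commute)

lemma grid_pos:
  assumes "0 \<le> \<beta>" "0 \<le> x"
  shows "grid_val \<beta> x = (\<Sum>k<grid_size \<beta>. grid_wt \<beta> k * of_bool (grid_thr \<beta> k < x))"
    and "grid_sq \<beta> x = (\<Sum>k<grid_size \<beta>. (grid_wt \<beta> k)\<^sup>2 * of_bool (grid_thr \<beta> k < x))"
proof -
  have "\<not> grid_thr \<beta> k < - x" for k using assms grid_thr_nonneg[of \<beta> k] by linarith
  then show "grid_val \<beta> x = (\<Sum>k<grid_size \<beta>. grid_wt \<beta> k * of_bool (grid_thr \<beta> k < x))"
    and "grid_sq \<beta> x = (\<Sum>k<grid_size \<beta>. (grid_wt \<beta> k)\<^sup>2 * of_bool (grid_thr \<beta> k < x))"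
    by (simp_all add: grid_val_def grid_sq_def)
qed

lemma abs_le_half_square: "\<bar>x\<bar> \<le> (1 + x\<^sup>2) / (2 :: real)"
  using zero_le_power2[of "\<bar>x\<bar> - 1"] by (simp add: power2_eq_square algebra_simps)

text \<open>Inside the grid the error is one cell, at most 2 * \<beta> * (1 + x). Beyond it, 1 <=
  \<beta> * (1 + x), so even the trivial error x is at most \<beta> * (1 + x) * x. Linear terms are
  traded for squares because the expectation is later controlled by a second moment.\<close>

lemma grid_bias_pos:
  assumes \<beta>: "0 < \<beta>" "\<beta> \<le> 1" and x: "0 \<le> x"
  shows "\<bar>grid_val \<beta> x - x\<bar> \<le> \<beta> * (7 + 5 * x\<^sup>2) / 2"
proof -
  let ?E = "exp (\<beta> * real (grid_size \<beta>))"
  have v: "grid_val \<beta> x \<le> x" using grid_pos_sum(1)[OF \<beta> x] grid_pos(1)[of \<beta> x] \<beta> x by simp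
  have v0: "0 \<le> grid_val \<beta> x" using grid_pos(1)[of \<beta> x] \<beta> x by (simp add: sum_nonneg grid_wt_nonneg)
  have "x - grid_val \<beta> x \<le> 2 * \<beta> * (1 + x) + \<beta> * (1 + x) * x"
  proof (cases "x \<le> ?E - 1")
    case True
    then have "x - grid_val \<beta> x \<le> 2 * \<beta> * (1 + x)"
      using grid_pos_sum(2)[OF \<beta> x] grid_pos(1)[of \<beta> x] \<beta> x by simp
    moreover have "0 \<le> \<beta> * (1 + x) * x" using \<beta> x by simp
    ultimately show ?thesis by linarith
  next
    case False
    then have "1 / \<beta> \<le> 1 + x" using exp_grid_size(1)[OF \<beta>] by linarith
    then have "1 \<le> \<beta> * (1 + x)" using \<beta> by (simp add: field_simps)
    then have "x \<le> \<beta> * (1 + x) * x" using x mult_right_mono[of 1 "\<beta> * (1 + x)" x] by simp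
    moreover have "0 \<le> 2 * \<beta> * (1 + x)" using \<beta> x by simp
    ultimately show ?thesis using v0 by linarith
  qed
  also have "\<dots> = \<beta> * (2 + 3 * x + x\<^sup>2)" by (simp add: algebra_simps power2_eq_square)
  also have "\<dots> \<le> \<beta> * (2 + 3 * ((1 + x\<^sup>2) / 2) + x\<^sup>2)"
    using abs_le_half_square[of x] \<beta> x by (intro mult_left_mono) auto
  finally show ?thesis using v by (simp add: field_simps)
qed

lemma grid_bias:
  assumes "0 < \<beta>" "\<beta> \<le> 1"
  shows "\<bar>grid_val \<beta> x - x\<bar> \<le> \<beta> * (7 + 5 * x\<^sup>2) / 2"
  using grid_bias_pos[OF assms, of x] grid_bias_pos[OF assms, of "- x"]
  by (cases "0 \<le> x") (auto simp: grid_val_minus abs_minus_commute)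

text \<open>A weight whose threshold lies below x is at most \<beta> * (1 + x). Pulling out one such
  factor leaves \<open>grid_val\<close>, which is at most x.\<close>

lemma grid_sq_bound:
  assumes \<beta>: "0 < \<beta>" "\<beta> \<le> 1"
  shows "grid_sq \<beta> x \<le> \<beta> * (1 + 3 * x\<^sup>2) / 2"
proof -
  have *: "grid_sq \<beta> x \<le> \<beta> * (1 + 3 * x\<^sup>2) / 2" if x: "0 \<le> x" for x
  proof -
    have "grid_sq \<beta> x \<le> (\<Sum>k<grid_size \<beta>. \<beta> * (1 + x) * (grid_wt \<beta> k * of_bool (grid_thr \<beta> k < x)))"
      unfolding grid_pos(2)[OF less_imp_le[OF \<beta>(1)] x]
    proof (intro sum_mono)
      fix k
      show "(grid_wt \<beta> k)\<^sup>2 * of_bool (grid_thr \<beta> k < x) \<le>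
          \<beta> * (1 + x) * (grid_wt \<beta> k * of_bool (grid_thr \<beta> k < x))"
      proof (cases "grid_thr \<beta> k < x")
        case True
        have "grid_wt \<beta> k \<le> \<beta> * exp (\<beta> * real (Suc k))" by (rule grid_wt_le)
        also have "\<dots> \<le> \<beta> * (1 + x)" using True \<beta> by (intro mult_left_mono) (auto simp: grid_thr_def)
        finally show ?thesis using True grid_wt_nonneg[of \<beta> k] \<beta>
          by (simp add: power2_eq_square mult_right_mono)
      qed simp
    qed
    also have "\<dots> = \<beta> * (1 + x) * grid_val \<beta> x"
      unfolding grid_pos(1)[OF less_imp_le[OF \<beta>(1)] x] sum_distrib_left ..
    also have "\<dots> \<le> \<beta> * (1 + x) * x"
      using grid_pos_sum(1)[OF \<beta> x] grid_pos(1)[of \<beta> x] \<beta> x by (intro mult_left_mono) auto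
    also have "\<dots> = \<beta> * (x + x\<^sup>2)" by (simp add: algebra_simps power2_eq_square)
    also have "\<dots> \<le> \<beta> * ((1 + x\<^sup>2) / 2 + x\<^sup>2)"
      using abs_le_half_square[of x] \<beta> x by (intro mult_left_mono) auto
    finally show ?thesis by (simp add: field_simps)
  qed
  show ?thesis using *[of x] *[of "- x"] by (cases "0 \<le> x") (auto simp: grid_sq_minus)
qed

lemma grid_wt_le_3:
  assumes "0 < \<beta>" "\<beta> \<le> 1" "k < grid_size \<beta>"
  shows "grid_wt \<beta> k \<le> 3"
proof -
  have "grid_wt \<beta> k \<le> \<beta> * exp (\<beta> * real (Suc k))" by (rule grid_wt_le)
  also have "\<dots> \<le> \<beta> * exp (\<beta> * real (grid_size \<beta>))" using assms by simp
  finally show ?thesis using exp_grid_size(2)[OF assms(1,2)] by linarith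
qed

text \<open>For R > 0, the query with threshold \<open>c + R * grid_thr \<beta> k\<close> asks
  whether the normalised reward (x - c) / R exceeds \<open>grid_thr \<beta> k\<close>. The second
  list asks the same about its negative, with negative weights. Dividing by \<open>G\<close>
  averages the copies.\<close>

definition grid_queries :: "real \<Rightarrow> nat \<Rightarrow> real \<Rightarrow> real \<Rightarrow> (real \<times> real \<times> real) list" where
  "grid_queries \<beta> G c R = concat (replicate G
     (map (\<lambda>k. (grid_wt \<beta> k / real G, 1, c + R * grid_thr \<beta> k)) [0..<grid_size \<beta>] @
      map (\<lambda>k. (- grid_wt \<beta> k / real G, - 1, - c + R * grid_thr \<beta> k)) [0..<grid_size \<beta>]))"

definition refine :: "'a \<Rightarrow> real \<Rightarrow> nat \<Rightarrow> real \<Rightarrow> real \<Rightarrow> ('a, real) prot" where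
  "refine a \<beta> G c R = bind_prot (ask_all a (grid_queries \<beta> G c R) 0) (\<lambda>v. Ret (c + R * v))"

lemma length_grid_queries: "length (grid_queries \<beta> G c R) = 2 * grid_size \<beta> * G"
  by (simp add: grid_queries_def length_concat sum_list_replicate)

lemma sum_list_concat_replicate:
  "(\<Sum>x\<leftarrow>concat (replicate G xs). f x) = real G * (\<Sum>x\<leftarrow>xs. f x)"
  by (induction G) (auto simp: algebra_simps)

text \<open>\<zeta> stands for the law of the mean noise of a whole batch, so \<open>s\<close> is of
  order 1 / sqrt B in the application.\<close>

locale batch_noise = prob_space \<zeta> for \<zeta> :: "real measure" +
  fixes \<mu> :: "'a \<Rightarrow> real" and g :: "'a \<Rightarrow> real" and s :: real
  assumes sets_noise: "sets \<zeta> = sets borel"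
    and int1: "integrable \<zeta> (\<lambda>z. z)" and mean: "expectation (\<lambda>z. z) = 0"
    and int2: "integrable \<zeta> (\<lambda>z. z\<^sup>2)" and var: "expectation (\<lambda>z. z\<^sup>2) \<le> s\<^sup>2"
    and s_nonneg: "0 \<le> s"
begin

sublocale answer_model "\<lambda>a s t. prob {z. t < s * (\<mu> a + z)}" g
  by unfold_locales auto

text \<open>The hypothesis \<open>near\<close> makes the second moment of the normalised reward
  \<open>X\<close> at most 1. Then the bias is at most \<beta> * (7 + 5) / 2 = 6 * \<beta> and the
  variance proxy at most 2 * \<beta> / G; allowing a deviation of 2 * \<beta> gives the total 8 *
  \<beta>, rescaled by \<open>R\<close>.\<close>

lemma fail_refine:
  assumes \<beta>: "0 < \<beta>" "\<beta> \<le> 1" and G: "0 < G" and R: "0 < R" and near: "(\<mu> a - c)\<^sup>2 + s\<^sup>2 \<le> R\<^sup>2"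
  shows "fail (refine a \<beta> G c R)
      (\<lambda>r k. \<bar>r - \<mu> a\<bar> \<le> 8 * \<beta> * R \<and> k = real (2 * grid_size \<beta> * G) * g a) \<le> 2 * exp (- (4 / 9) * \<beta> * real G)"
proof -
  let ?n = "grid_size \<beta>" and ?qs = "grid_queries \<beta> G c R"
  define X where "X z = (\<mu> a + z - c) / R" for z
  have space: "space \<zeta> = UNIV" using sets_eq_imp_space_eq[OF sets_noise] by simp
  note [measurable_cong] = sets_noise
  have pos: "prob {z. c + R * grid_thr \<beta> k < 1 * (\<mu> a + z)} = expectation (\<lambda>z. of_bool (grid_thr \<beta> k < X z))" for k
  proof -
    have "(\<lambda>z. of_bool (grid_thr \<beta> k < X z)) = indicat_real {z. c + R * grid_thr \<beta> k < 1 * (\<mu> a + z)}"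
      using R by (auto simp: fun_eq_iff X_def indicator_def field_simps)
    then show ?thesis by (simp add: space)
  qed
  have neg: "prob {z. - c + R * grid_thr \<beta> k < - 1 * (\<mu> a + z)} = expectation (\<lambda>z. of_bool (grid_thr \<beta> k < - X z))" for k
  proof -
    have "(\<lambda>z. of_bool (grid_thr \<beta> k < - X z)) = indicat_real {z. - c + R * grid_thr \<beta> k < - 1 * (\<mu> a + z)}"
      using R by (auto simp: fun_eq_iff X_def indicator_def field_simps)
    then show ?thesis by (simp add: space)
  qed
  have Xm [measurable]: "X \<in> borel_measurable \<zeta>" unfolding X_def by measurable
  have ib [simp]: "integrable \<zeta> (\<lambda>z. of_bool (grid_thr \<beta> k < X z) :: real)"
     "integrable \<zeta> (\<lambda>z. of_bool (grid_thr \<beta> k < - X z) :: real)" for k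
    by (rule integrable_const_bound[of _ 1]; simp)+
  have iX: "integrable \<zeta> X" unfolding X_def using int1 by simp
  have sqX: "(X z)\<^sup>2 = ((\<mu> a - c)\<^sup>2 + 2 * (\<mu> a - c) * z + z\<^sup>2) / R\<^sup>2" for z
    by (simp add: X_def power_divide power2_eq_square algebra_simps)
  have iX2: "integrable \<zeta> (\<lambda>z. (X z)\<^sup>2)" unfolding sqX using int1 int2 by simp
  have EX: "expectation X = (\<mu> a - c) / R" unfolding X_def using int1 mean by (simp add: prob_space)
  have "expectation (\<lambda>z. (X z)\<^sup>2) = ((\<mu> a - c)\<^sup>2 + expectation (\<lambda>z. z\<^sup>2)) / R\<^sup>2"
    unfolding sqX using int1 int2 mean by (simp add: prob_space)
  also have "\<dots> \<le> R\<^sup>2 / R\<^sup>2" using near var by (intro divide_right_mono) auto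
  finally have EX2: "expectation (\<lambda>z. (X z)\<^sup>2) \<le> 1" using R by simp
  have iv: "integrable \<zeta> (\<lambda>z. grid_val \<beta> (X z))" "integrable \<zeta> (\<lambda>z. grid_sq \<beta> (X z))"
    unfolding grid_val_def grid_sq_def by simp_all
  let ?m = "expectation (\<lambda>z. grid_val \<beta> (X z))"
  \<comment> \<open>The function \<open>f\<close> is arbitrary so that one computation serves both
    the mean and the second moment of the weights.\<close>
  have sums: "(\<Sum>q\<leftarrow>?qs. f (yes a q) (fst q)) = real G *
      ((\<Sum>k<?n. f (expectation (\<lambda>z. of_bool (grid_thr \<beta> k < X z))) (grid_wt \<beta> k / real G)) +
       (\<Sum>k<?n. f (expectation (\<lambda>z. of_bool (grid_thr \<beta> k < - X z))) (- grid_wt \<beta> k / real G)))"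
    for f :: "real \<Rightarrow> real \<Rightarrow> real"
    unfolding grid_queries_def sum_list_concat_replicate
    by (simp add: o_def interv_sum_list_conv_sum_set_nat atLeast0LessThan flip: pos neg)
  have Em: "?m = (\<Sum>k<?n. grid_wt \<beta> k * (expectation (\<lambda>z. of_bool (grid_thr \<beta> k < X z)) -
      expectation (\<lambda>z. of_bool (grid_thr \<beta> k < - X z))))"
    unfolding grid_val_def by (subst Bochner_Integration.integral_sum) simp_all
  have m: "?m = (\<Sum>q\<leftarrow>?qs. yes a q * fst q)"
    using G unfolding sums Em
    by (simp add: right_diff_distrib sum_subtractf sum_negf mult.commute flip: sum_divide_distrib)
  have Eq: "expectation (\<lambda>z. grid_sq \<beta> (X z)) = (\<Sum>k<?n. (grid_wt \<beta> k)\<^sup>2 *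
      (expectation (\<lambda>z. of_bool (grid_thr \<beta> k < X z)) + expectation (\<lambda>z. of_bool (grid_thr \<beta> k < - X z))))"
    unfolding grid_sq_def by (subst Bochner_Integration.integral_sum) simp_all
  have "(\<Sum>q\<leftarrow>?qs. yes a q * (fst q)\<^sup>2) = expectation (\<lambda>z. grid_sq \<beta> (X z)) / real G"
    using G unfolding sums[of "\<lambda>p w. p * w\<^sup>2"] Eq
    by (simp add: distrib_left sum.distrib power_divide mult.commute flip: sum_divide_distrib)
      (simp add: field_simps power2_eq_square)
  also have "\<dots> \<le> 2 * \<beta> / real G"
  proof (rule divide_right_mono)
    have "expectation (\<lambda>z. grid_sq \<beta> (X z)) \<le> expectation (\<lambda>z. \<beta> * (1 + 3 * (X z)\<^sup>2) / 2)"
      using iv iX2 grid_sq_bound[OF \<beta>] by (intro integral_mono) auto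
    also have "\<dots> = \<beta> * (1 + 3 * expectation (\<lambda>z. (X z)\<^sup>2)) / 2" using iX2 by (simp add: prob_space)
    also have "\<dots> \<le> 2 * \<beta>" using EX2 \<beta> by (simp add: field_simps)
    finally show "expectation (\<lambda>z. grid_sq \<beta> (X z)) \<le> 2 * \<beta>" .
  qed simp
  finally have V: "(\<Sum>q\<leftarrow>?qs. yes a q * (fst q)\<^sup>2) \<le> 2 * \<beta> / real G" .
  have "\<bar>?m - (\<mu> a - c) / R\<bar> = \<bar>expectation (\<lambda>z. grid_val \<beta> (X z) - X z)\<bar>"
    using iv iX by (simp add: EX[symmetric])
  also have "\<dots> \<le> expectation (\<lambda>z. \<bar>grid_val \<beta> (X z) - X z\<bar>)" by (rule integral_abs_bound)
  also have "\<dots> \<le> expectation (\<lambda>z. \<beta> * (7 + 5 * (X z)\<^sup>2) / 2)"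
    using iv iX iX2 grid_bias[OF \<beta>] by (intro integral_mono) auto
  also have "\<dots> = \<beta> * (7 + 5 * expectation (\<lambda>z. (X z)\<^sup>2)) / 2" using iX2 by (simp add: prob_space)
  also have "\<dots> \<le> 6 * \<beta>" using EX2 \<beta> by (simp add: field_simps)
  finally have bias: "\<bar>?m - (\<mu> a - c) / R\<bar> \<le> 6 * \<beta>" .
  have w: "\<bar>real G / 3 * fst q\<bar> \<le> 1" if q: "q \<in> set ?qs" for q
  proof -
    obtain k where k: "k < ?n" "\<bar>fst q\<bar> = grid_wt \<beta> k / real G"
      using q \<beta> G by (auto simp: grid_queries_def grid_wt_nonneg)
    have "\<bar>real G / 3 * fst q\<bar> = grid_wt \<beta> k / 3"
      using G k by (simp add: abs_mult)
    then show ?thesis using grid_wt_le_3[OF \<beta> k(1)] by simp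
  qed
  \<comment> \<open>The exponent G / 3 is the largest one allowed by weights of size up to 3 / G; it
    yields (2 / 9 - 6 / 9) * \<beta> * G.\<close>
  have "fail (ask_all a ?qs 0) (\<lambda>r k. \<bar>r - ?m\<bar> \<le> 2 * \<beta> \<and> k = real (length ?qs) * g a)
      \<le> 2 * exp ((real G / 3)\<^sup>2 * (2 * \<beta> / real G) - real G / 3 * (2 * \<beta>))"
    using G by (intro fail_ask_all[OF _ w m V]) auto
  also have "(real G / 3)\<^sup>2 * (2 * \<beta> / real G) - real G / 3 * (2 * \<beta>) = - (4 / 9) * \<beta> * real G"
    using G by (simp add: power2_eq_square field_simps)
  finally have *: "fail (ask_all a ?qs 0) (\<lambda>r k. \<bar>r - ?m\<bar> \<le> 2 * \<beta> \<and> k = real (length ?qs) * g a)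
      \<le> 2 * exp (- (4 / 9) * \<beta> * real G)" .
  show ?thesis
    unfolding refine_def fail_bind_Ret
  proof (rule order_trans[OF fail_mono *])
    fix r k assume "\<bar>r - ?m\<bar> \<le> 2 * \<beta> \<and> k = real (length ?qs) * g a"
    then have rk: "\<bar>r - ?m\<bar> \<le> 2 * \<beta>" "k = real (2 * ?n * G) * g a"
      by (simp_all add: length_grid_queries)
    have "\<bar>c + R * r - \<mu> a\<bar> = R * \<bar>r - (\<mu> a - c) / R\<bar>"
    proof -
      have "c + R * r - \<mu> a = R * (r - (\<mu> a - c) / R)" using R by (simp add: field_simps)
      then show ?thesis using R by (simp add: abs_mult)
    qed
    also have "\<dots> \<le> R * (8 * \<beta>)" using bias rk(1) R by (intro mult_left_mono) auto
    finally show "\<bar>c + R * r - \<mu> a\<bar> \<le> 8 * \<beta> * R \<and> k = real (2 * ?n * G) * g a"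
      using rk(2) by (simp add: mult_ac)
  qed
qed

end

section \<open>Locating arms and eliminating them in phases\<close>

text \<open>After \<open>i\<close> steps the error is at most \<open>(1 / 2) ^ i + s\<close>; the scale adds the standard deviation \<open>s\<close> of the
  batch means.\<close>

primrec locate :: "'a \<Rightarrow> real \<Rightarrow> real \<Rightarrow> nat \<Rightarrow> nat \<Rightarrow> ('a, real) prot" where
  "locate a s \<beta> G 0 = Ret 0"
| "locate a s \<beta> G (Suc i) = bind_prot (locate a s \<beta> G i) (\<lambda>c. refine a \<beta> G c ((1 / 2) ^ i + 2 * s))"

primrec measure_all :: "(nat \<Rightarrow> 'a) \<Rightarrow> real \<Rightarrow> real \<Rightarrow> nat \<Rightarrow> nat \<Rightarrow> nat \<Rightarrow> ('a, nat \<Rightarrow> real) prot" where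
  "measure_all F s \<beta> G J 0 = Ret (\<lambda>_. 0)"
| "measure_all F s \<beta> G J (Suc j) = bind_prot (measure_all F s \<beta> G J j)
     (\<lambda>m. bind_prot (locate (F j) s \<beta> G J) (\<lambda>c. Ret (m(j := c))))"

lemma all_prot_refine: "P a \<Longrightarrow> all_prot P (\<lambda>_. True) (refine a \<beta> G c R)"
  unfolding refine_def by (intro all_prot_bind[where Q = "\<lambda>_. True"] all_prot_ask_all) auto

lemma all_prot_locate: "P a \<Longrightarrow> all_prot P (\<lambda>_. True) (locate a s \<beta> G i)"
  by (induction i) (auto intro!: all_prot_bind[where Q = "\<lambda>_. True"] all_prot_refine)

lemma all_prot_measure_all:
  "(\<And>j. j < n \<Longrightarrow> P (F j)) \<Longrightarrow> all_prot P (\<lambda>_. True) (measure_all F s \<beta> G J n)"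
  by (induction n) (auto intro!: all_prot_bind[where Q = "\<lambda>_. True"] all_prot_locate)

context batch_noise
begin

text \<open>The guess 0 has error at most 1. Since 16 * \<beta> * s <= s, the invariant keeps the
  next scale admissible for \<open>fail_refine\<close>; the new error 8 * \<beta> * (2^-i + 2 * s)
  halves the first term and reproduces the floor 16 * \<beta> * s, which therefore does not
  accumulate.\<close>

lemma fail_locate:
  assumes \<beta>: "0 < \<beta>" "\<beta> \<le> 1 / 16" and G: "0 < G" and \<mu>: "\<bar>\<mu> a\<bar> \<le> 1"
  shows "fail (locate a s \<beta> G i)
     (\<lambda>r k. \<bar>r - \<mu> a\<bar> \<le> (1 / 2) ^ i + 16 * \<beta> * s \<and> k = real i * real (2 * grid_size \<beta> * G) * g a)
     \<le> real i * (2 * exp (- (4 / 9) * \<beta> * real G))"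
proof (induction i)
  case 0
  have "0 \<le> 16 * \<beta> * s" using \<beta> s_nonneg by simp
  then show ?case using \<mu> by (simp add: fail_Ret abs_minus_commute)
next
  case (Suc i)
  let ?K = "real (2 * grid_size \<beta> * G)" and ?R = "(1 / 2) ^ i + 2 * s" and ?e = "2 * exp (- (4 / 9) * \<beta> * real G)"
  have R: "0 < ?R" using s_nonneg by (simp add: add_pos_nonneg)
  have \<beta>s: "16 * \<beta> * s \<le> s" using \<beta> s_nonneg mult_right_mono[of "16 * \<beta>" 1 s] by simp
  have "fail (locate a s \<beta> G (Suc i))
     (\<lambda>r k. \<bar>r - \<mu> a\<bar> \<le> (1 / 2) ^ Suc i + 16 * \<beta> * s \<and> k = real (Suc i) * ?K * g a)
     \<le> real i * ?e + ?e"
    unfolding locate.simps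
  proof (rule fail_bind[OF Suc])
    fix c k assume c: "\<bar>c - \<mu> a\<bar> \<le> (1 / 2) ^ i + 16 * \<beta> * s \<and> k = real i * ?K * g a"
    let ?q = "(1 / 2 :: real) ^ i"
    have "\<bar>\<mu> a - c\<bar> \<le> ?q + s" using c \<beta>s by linarith
    then have "(\<mu> a - c)\<^sup>2 \<le> (?q + s)\<^sup>2" by (rule power2_le_iff_abs_le[THEN iffD2, rotated]) (use s_nonneg in simp)
    moreover have "(?q + s)\<^sup>2 + s\<^sup>2 \<le> ?R\<^sup>2"
      using s_nonneg by (simp add: power2_eq_square algebra_simps)
    ultimately have near: "(\<mu> a - c)\<^sup>2 + s\<^sup>2 \<le> ?R\<^sup>2" by linarith
    show "fail (refine a \<beta> G c ?R)
       (\<lambda>r k'. \<bar>r - \<mu> a\<bar> \<le> (1 / 2) ^ Suc i + 16 * \<beta> * s \<and> k + k' = real (Suc i) * ?K * g a) \<le> ?e"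
    proof (rule order_trans[OF fail_mono fail_refine[OF _ _ G R near]])
      fix r k' assume r: "\<bar>r - \<mu> a\<bar> \<le> 8 * \<beta> * ?R \<and> k' = ?K * g a"
      have "8 * \<beta> * ?R = 8 * \<beta> * ?q + 16 * \<beta> * s" by (simp add: algebra_simps)
      moreover have "8 * \<beta> * ?q \<le> 1 / 2 * ?q" using \<beta> by (intro mult_right_mono) auto
      ultimately have "\<bar>r - \<mu> a\<bar> \<le> 1 / 2 * ?q + 16 * \<beta> * s" using r by linarith
      then show "\<bar>r - \<mu> a\<bar> \<le> (1 / 2) ^ Suc i + 16 * \<beta> * s \<and> k + k' = real (Suc i) * ?K * g a"
        using r c by (simp add: distrib_right)
    qed (use \<beta> in auto)
  qed simp
  then show ?case by (simp add: algebra_simps)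
qed

lemma fail_measure_all:
  assumes \<beta>: "0 < \<beta>" "\<beta> \<le> 1 / 16" and G: "0 < G"
    and F: "\<And>j. j < n \<Longrightarrow> \<bar>\<mu> (F j)\<bar> \<le> 1" "\<And>j. j < n \<Longrightarrow> g (F j) \<le> h"
  shows "fail (measure_all F s \<beta> G J n)
     (\<lambda>m k. (\<forall>j<n. \<bar>m j - \<mu> (F j)\<bar> \<le> (1 / 2) ^ J + 16 * \<beta> * s) \<and>
       k \<le> real n * (real J * real (2 * grid_size \<beta> * G) * h))
     \<le> real n * (real J * (2 * exp (- (4 / 9) * \<beta> * real G)))"
  using F
proof (induction n)
  case 0
  then show ?case by (simp add: fail_Ret)
next
  case (Suc n)
  let ?K = "real J * real (2 * grid_size \<beta> * G)" and ?e = "real J * (2 * exp (- (4 / 9) * \<beta> * real G))"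
  let ?r = "(1 / 2) ^ J + 16 * \<beta> * s"
  have "fail (measure_all F s \<beta> G J (Suc n))
     (\<lambda>m k. (\<forall>j<Suc n. \<bar>m j - \<mu> (F j)\<bar> \<le> ?r) \<and> k \<le> real (Suc n) * (?K * h)) \<le> real n * ?e + ?e"
    unfolding measure_all.simps
  proof (rule fail_bind[OF Suc.IH])
    fix m k assume m: "(\<forall>j<n. \<bar>m j - \<mu> (F j)\<bar> \<le> ?r) \<and> k \<le> real n * (?K * h)"
    show "fail (bind_prot (locate (F n) s \<beta> G J) (\<lambda>c. Ret (m(n := c))))
       (\<lambda>m' k'. (\<forall>j<Suc n. \<bar>m' j - \<mu> (F j)\<bar> \<le> ?r) \<and> k + k' \<le> real (Suc n) * (?K * h)) \<le> ?e"
      unfolding fail_bind_Ret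
    proof (rule order_trans[OF fail_mono fail_locate[OF \<beta> G]])
      fix r k' assume r: "\<bar>r - \<mu> (F n)\<bar> \<le> ?r \<and> k' = ?K * g (F n)"
      have "?K * g (F n) \<le> ?K * h" using Suc.prems(2)[of n] by (intro mult_left_mono) auto
      then have "k + k' \<le> real (Suc n) * (?K * h)" using r m by (simp add: algebra_simps)
      then show "(\<forall>j<Suc n. \<bar>(m(n := r)) j - \<mu> (F j)\<bar> \<le> ?r) \<and> k + k' \<le> real (Suc n) * (?K * h)"
        using r m by (auto simp: less_Suc_eq)
    qed (use Suc.prems in auto)
  qed (use Suc.prems in auto)
  then show ?case by (simp add: algebra_simps)
qed

end

section \<open>Phased elimination from design-based estimates\<close>

definition eliminate :: "('a \<Rightarrow> real) \<Rightarrow> real \<Rightarrow> 'a set \<Rightarrow> 'a set" where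
  "eliminate e \<epsilon> A = {a \<in> A. \<forall>a'\<in>A. e a' - 2 * \<epsilon> \<le> e a}"

lemma eliminate_subset: "eliminate e \<epsilon> A \<subseteq> A"
  by (auto simp: eliminate_def)

lemma eliminate_nonempty:
  assumes "finite A" "A \<noteq> {}" "0 \<le> \<epsilon>"
  shows "eliminate e \<epsilon> A \<noteq> {}"
proof -
  have "Max (e ` A) \<in> e ` A" using assms by (intro Max_in) auto
  then obtain a where a: "a \<in> A" "e a = Max (e ` A)" by auto
  have "e a' - 2 * \<epsilon> \<le> e a" if "a' \<in> A" for a'
  proof -
    have "e a' \<le> e a" using that assms a by simp
    then show ?thesis using assms(3) by linarith
  qed
  with a show ?thesis by (auto simp: eliminate_def)
qed

text \<open>A design for \<open>A\<close> consists of arms \<open>F j\<close>, \<open>j < N\<close>, and coefficients \<open>c a\<close> with \<open>a = (\<Sum>j<N. c a j * F j)\<close>.\<close>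

primrec phases :: "('a set \<Rightarrow> nat \<Rightarrow> 'a) \<Rightarrow> ('a set \<Rightarrow> 'a \<Rightarrow> nat \<Rightarrow> real) \<Rightarrow> nat \<Rightarrow> real \<Rightarrow> (nat \<Rightarrow> real) \<Rightarrow>
    (nat \<Rightarrow> nat) \<Rightarrow> nat \<Rightarrow> 'a set \<Rightarrow> nat \<Rightarrow> ('a, 'a set) prot" where
  "phases F c N s \<beta> G J A 0 = Ret A"
| "phases F c N s \<beta> G J A (Suc p) = bind_prot (phases F c N s \<beta> G J A p) (\<lambda>A'.
     bind_prot (measure_all (F A') s (\<beta> p) (G p) J N)
       (\<lambda>m. Ret (eliminate (\<lambda>a. \<Sum>j<N. c A' a j * m j) ((1 / 2) ^ p) A')))"

text \<open>Valid on every branch, also where estimates are wrong and the best arm is lost: the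
  algorithm must always have an arm of \<open>A\<close> to play.\<close>

lemma all_prot_phases:
  assumes "finite A" "A \<noteq> {}"
    and F: "\<And>A' j. A' \<subseteq> A \<Longrightarrow> A' \<noteq> {} \<Longrightarrow> j < N \<Longrightarrow> F A' j \<in> A'"
  shows "all_prot (\<lambda>a. a \<in> A) (\<lambda>A'. A' \<subseteq> A \<and> A' \<noteq> {}) (phases F c N s \<beta> G J A p)"
proof (induction p)
  case 0
  then show ?case using assms by simp
next
  case (Suc p)
  show ?case
    unfolding phases.simps
  proof (rule all_prot_bind[OF Suc])
    fix A' assume A': "A' \<subseteq> A \<and> A' \<noteq> {}"
    have "all_prot (\<lambda>a. a \<in> A) (\<lambda>_. True) (measure_all (F A') s (\<beta> p) (G p) J N)"
      using F[of A'] A' by (intro all_prot_measure_all) auto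
    then show "all_prot (\<lambda>a. a \<in> A) (\<lambda>A'. A' \<subseteq> A \<and> A' \<noteq> {})
       (bind_prot (measure_all (F A') s (\<beta> p) (G p) J N)
         (\<lambda>m. Ret (eliminate (\<lambda>a. \<Sum>j<N. c A' a j * m j) ((1 / 2) ^ p) A')))"
    proof (rule all_prot_bind)
      fix m
      have "eliminate (\<lambda>a. \<Sum>j<N. c A' a j * m j) ((1 / 2) ^ p) A' \<noteq> {}"
        using A' assms(1) finite_subset[of A' A] by (intro eliminate_nonempty) auto
      then show "all_prot (\<lambda>a. a \<in> A) (\<lambda>A'. A' \<subseteq> A \<and> A' \<noteq> {})
          (Ret (eliminate (\<lambda>a. \<Sum>j<N. c A' a j * m j) ((1 / 2) ^ p) A'))"
        using A' eliminate_subset by fastforce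
    qed
  qed
qed

lemma abs_design_error:
  fixes c x :: "nat \<Rightarrow> real"
  assumes c: "(\<Sum>j<N. (c j)\<^sup>2) \<le> 1" and x: "\<And>j. j < N \<Longrightarrow> \<bar>x j\<bar> \<le> \<epsilon> / sqrt (real N)" and \<epsilon>: "0 \<le> \<epsilon>"
  shows "\<bar>\<Sum>j<N. c j * x j\<bar> \<le> \<epsilon>"
proof (cases "N = 0")
  case False
  have "(\<Sum>j<N. (x j)\<^sup>2) \<le> (\<Sum>j<N. \<epsilon>\<^sup>2 / real N)"
  proof (rule sum_mono)
    fix j assume "j \<in> {..<N}"
    then have "\<bar>x j\<bar>\<^sup>2 \<le> (\<epsilon> / sqrt (real N))\<^sup>2" by (intro power_mono x) auto
    then show "(x j)\<^sup>2 \<le> \<epsilon>\<^sup>2 / real N" by (simp add: power_divide)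
  qed
  then have x2: "(\<Sum>j<N. (x j)\<^sup>2) \<le> \<epsilon>\<^sup>2" using False by simp
  have "(\<Sum>j<N. c j * x j)\<^sup>2 \<le> (\<Sum>j<N. (c j)\<^sup>2) * (\<Sum>j<N. (x j)\<^sup>2)"
    by (rule Cauchy_Schwarz_ineq_sum)
  also have "\<dots> \<le> 1 * \<epsilon>\<^sup>2" using c x2 by (intro mult_mono) (auto intro: sum_nonneg)
  finally show ?thesis using \<epsilon> abs_le_square_iff[of _ \<epsilon>] by simp
qed (use \<epsilon> in simp)

context batch_noise
begin

text \<open>With all estimates within \<epsilon> = 2^-p, the best arm survives a cut at 2 *
  \<epsilon>, and survivors have gap at most 4 * \<epsilon> = 8 * 2^-(p+1). This reproduces the
  invariant, which holds initially because gaps are at most 2. Every arm asked in phase p thus has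
  gap at most 8 * 2^-p, which prices its batches.\<close>

lemma fail_phases:
  assumes A: "finite A" "a_opt \<in> A" and opt: "\<And>a. a \<in> A \<Longrightarrow> \<mu> a \<le> \<mu> a_opt"
    and \<mu>: "\<And>a. a \<in> A \<Longrightarrow> \<bar>\<mu> a\<bar> \<le> 1" and g: "\<And>a. a \<in> A \<Longrightarrow> g a = b * (\<mu> a_opt - \<mu> a)" and b: "0 \<le> b"
    and F: "\<And>A' j. A' \<subseteq> A \<Longrightarrow> A' \<noteq> {} \<Longrightarrow> j < N \<Longrightarrow> F A' j \<in> A'"
    and c: "\<And>A' a. A' \<subseteq> A \<Longrightarrow> a \<in> A' \<Longrightarrow> (\<Sum>j<N. (c A' a j)\<^sup>2) \<le> 1 \<and> \<mu> a = (\<Sum>j<N. c A' a j * \<mu> (F A' j))"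
    and \<beta>: "\<And>p. 0 < \<beta> p" "\<And>p. \<beta> p \<le> 1 / 16" and G: "\<And>p. 0 < G p"
    and fine: "\<And>p. p < P \<Longrightarrow> (1 / 2) ^ J + 16 * \<beta> p * s \<le> (1 / 2) ^ p / sqrt (real N)"
    and conf: "\<And>p. p < P \<Longrightarrow> 2 * exp (- (4 / 9) * \<beta> p * real (G p)) \<le> e"
  shows "fail (phases F c N s \<beta> G J A P)
     (\<lambda>A' k. A' \<subseteq> A \<and> a_opt \<in> A' \<and> (\<forall>a\<in>A'. \<mu> a_opt - \<mu> a \<le> 8 * (1 / 2) ^ P) \<and>
        k \<le> (\<Sum>p<P. real N * (real J * real (2 * grid_size (\<beta> p) * G p) * (b * (8 * (1 / 2) ^ p)))))
     \<le> real P * (real N * (real J * e))"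
  using fine conf
proof (induction P)
  case 0
  have "\<mu> a_opt - \<mu> a \<le> 8" if "a \<in> A" for a using \<mu>[OF that] \<mu>[OF A(2)] by linarith
  then show ?case using A by (simp add: fail_Ret)
next
  case (Suc p)
  let ?E = "real N * (real J * e)"
  let ?cost = "\<lambda>p. real N * (real J * real (2 * grid_size (\<beta> p) * G p) * (b * (8 * (1 / 2) ^ p)))"
  let ?\<epsilon> = "(1 / 2 :: real) ^ p"
  have e: "0 \<le> e" using Suc.prems(2)[of p] by (smt (verit) exp_gt_zero lessI)
  have "fail (phases F c N s \<beta> G J A (Suc p))
     (\<lambda>A' k. A' \<subseteq> A \<and> a_opt \<in> A' \<and> (\<forall>a\<in>A'. \<mu> a_opt - \<mu> a \<le> 8 * (1 / 2) ^ Suc p) \<and> k \<le> (\<Sum>p<Suc p. ?cost p))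
     \<le> real p * ?E + ?E"
    unfolding phases.simps
  proof (rule fail_bind[OF Suc.IH])
    fix A' k
    assume "A' \<subseteq> A \<and> a_opt \<in> A' \<and> (\<forall>a\<in>A'. \<mu> a_opt - \<mu> a \<le> 8 * ?\<epsilon>) \<and> k \<le> (\<Sum>p<p. ?cost p)"
    then have A': "A' \<subseteq> A" "a_opt \<in> A'" "\<And>a. a \<in> A' \<Longrightarrow> \<mu> a_opt - \<mu> a \<le> 8 * ?\<epsilon>" and k: "k \<le> (\<Sum>p<p. ?cost p)"
      by auto
    have FA': "F A' j \<in> A'" if "j < N" for j using F[OF A'(1) _ that] A'(2) by auto
    have "fail (bind_prot (measure_all (F A') s (\<beta> p) (G p) J N)
         (\<lambda>m. Ret (eliminate (\<lambda>a. \<Sum>j<N. c A' a j * m j) ?\<epsilon> A')))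
       (\<lambda>A'' k'. A'' \<subseteq> A \<and> a_opt \<in> A'' \<and> (\<forall>a\<in>A''. \<mu> a_opt - \<mu> a \<le> 8 * (1 / 2) ^ Suc p) \<and>
          k + k' \<le> (\<Sum>p<Suc p. ?cost p))
       \<le> real N * (real J * (2 * exp (- (4 / 9) * \<beta> p * real (G p))))"
      unfolding fail_bind_Ret
    proof (rule order_trans[OF fail_mono fail_measure_all[OF \<beta> G]])
      fix m k'
      assume m: "(\<forall>j<N. \<bar>m j - \<mu> (F A' j)\<bar> \<le> (1 / 2) ^ J + 16 * \<beta> p * s) \<and> k' \<le> ?cost p"
      let ?e = "\<lambda>a. \<Sum>j<N. c A' a j * m j"
      have est: "\<bar>?e a - \<mu> a\<bar> \<le> ?\<epsilon>" if a: "a \<in> A'" for a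
      proof -
        have "?e a - \<mu> a = (\<Sum>j<N. c A' a j * (m j - \<mu> (F A' j)))"
          using c[OF A'(1) a] by (simp add: right_diff_distrib sum_subtractf)
        moreover have "\<bar>\<Sum>j<N. c A' a j * (m j - \<mu> (F A' j))\<bar> \<le> ?\<epsilon>"
        proof (rule abs_design_error)
          fix j assume "j < N"
          with m Suc.prems(1)[of p] show "\<bar>m j - \<mu> (F A' j)\<bar> \<le> ?\<epsilon> / sqrt (real N)"
            by (meson lessI order_trans)
        qed (use c[OF A'(1) a] in auto)
        ultimately show ?thesis by simp
      qed
      have "a_opt \<in> eliminate ?e ?\<epsilon> A'"
        unfolding eliminate_def
      proof (intro CollectI conjI ballI)
        fix a' assume a': "a' \<in> A'"
        then have "\<mu> a' \<le> \<mu> a_opt" using A'(1) opt by blast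
        then show "?e a' - 2 * ?\<epsilon> \<le> ?e a_opt" using est[OF a'] est[OF A'(2)] by (simp add: abs_le_iff)
      qed (rule A'(2))
      moreover have "\<mu> a_opt - \<mu> a \<le> 8 * (1 / 2) ^ Suc p" if a: "a \<in> eliminate ?e ?\<epsilon> A'" for a
      proof -
        have "a \<in> A'" "?e a_opt - 2 * ?\<epsilon> \<le> ?e a" using a A'(2) by (auto simp: eliminate_def)
        with est[of a] est[OF A'(2)] show ?thesis by (simp add: abs_le_iff)
      qed
      ultimately show "eliminate ?e ?\<epsilon> A' \<subseteq> A \<and> a_opt \<in> eliminate ?e ?\<epsilon> A' \<and>
          (\<forall>a\<in>eliminate ?e ?\<epsilon> A'. \<mu> a_opt - \<mu> a \<le> 8 * (1 / 2) ^ Suc p) \<and> k + k' \<le> (\<Sum>p<Suc p. ?cost p)"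
        using A'(1) eliminate_subset[of ?e ?\<epsilon> A'] m k by auto
    next
      fix j assume j: "j < N"
      show "\<bar>\<mu> (F A' j)\<bar> \<le> 1" using FA'[OF j] A'(1) \<mu> by blast
      show "g (F A' j) \<le> b * (8 * ?\<epsilon>)"
        using mult_left_mono[OF A'(3)[OF FA'[OF j]] b] FA'[OF j] A'(1) g[of "F A' j"] by auto
    qed
    also have "\<dots> \<le> ?E" using Suc.prems(2)[of p] by (intro mult_left_mono) auto
    finally show "fail (bind_prot (measure_all (F A') s (\<beta> p) (G p) J N)
         (\<lambda>m. Ret (eliminate (\<lambda>a. \<Sum>j<N. c A' a j * m j) ?\<epsilon> A')))
       (\<lambda>A'' k'. A'' \<subseteq> A \<and> a_opt \<in> A'' \<and> (\<forall>a\<in>A''. \<mu> a_opt - \<mu> a \<le> 8 * (1 / 2) ^ Suc p) \<and>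
          k + k' \<le> (\<Sum>p<Suc p. ?cost p)) \<le> ?E" .
  qed (use Suc.prems e in auto)
  then show ?case by (simp add: algebra_simps)
qed

end

section \<open>The law of the bits\<close>

lemma indep_vars_PiM_coordinates:
  assumes "prob_space \<nu>" and I: "finite I"
  shows "prob_space.indep_vars (\<Pi>\<^sub>M i\<in>I. \<nu>) (\<lambda>_. \<nu>) (\<lambda>i x. x i) I"
proof (cases "I = {}")
  case True
  interpret P: prob_space "\<Pi>\<^sub>M i\<in>I. \<nu>" using assms by (intro prob_space_PiM)
  show ?thesis unfolding P.indep_vars_def P.indep_sets_def using True by auto
next
  case False
  interpret P: prob_space "\<Pi>\<^sub>M i\<in>I. \<nu>" using assms by (intro prob_space_PiM)
  have "distr (\<Pi>\<^sub>M i\<in>I. \<nu>) (\<Pi>\<^sub>M i\<in>I. \<nu>) (\<lambda>x. \<lambda>i\<in>I. x i) = distr (\<Pi>\<^sub>M i\<in>I. \<nu>) (\<Pi>\<^sub>M i\<in>I. \<nu>) (\<lambda>x. x)"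
    by (rule distr_cong) (auto simp: space_PiM)
  also have "\<dots> = (\<Pi>\<^sub>M i\<in>I. \<nu>)" by simp
  also have "\<dots> = (\<Pi>\<^sub>M i\<in>I. distr (\<Pi>\<^sub>M i\<in>I. \<nu>) \<nu> (\<lambda>x. x i))"
    using assms by (intro PiM_cong refl distr_PiM_component[symmetric])
  finally show ?thesis
    using False I by (subst P.indep_vars_iff_distr_eq_PiM') auto
qed

text \<open>Independence removes the cross terms, so the second moments of the summands add up and
  the mean gains the factor 1 / B.\<close>

lemma noise_mean_moments:
  fixes \<nu> :: "real measure"
  assumes "prob_space \<nu>" and sets: "sets \<nu> = sets borel"
    and int1: "integrable \<nu> (\<lambda>x. x)" and mean: "(LINT x|\<nu>. x) = 0"
    and int2: "integrable \<nu> (\<lambda>x. x\<^sup>2)" and var: "(LINT x|\<nu>. x\<^sup>2) \<le> v"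
    and B: "1 \<le> B"
  defines "\<zeta> \<equiv> distr (\<Pi>\<^sub>M i\<in>{..<B}. \<nu>) borel (\<lambda>x. (\<Sum>i<B. x i) / real B)"
  shows "prob_space \<zeta>" "sets \<zeta> = sets borel" "integrable \<zeta> (\<lambda>z. z)" "(LINT z|\<zeta>. z) = 0"
    "integrable \<zeta> (\<lambda>z. z\<^sup>2)" "(LINT z|\<zeta>. z\<^sup>2) \<le> v / real B"
proof -
  note [measurable_cong] = sets
  let ?M = "\<Pi>\<^sub>M i\<in>{..<B}. \<nu>"
  interpret P: prob_space ?M using assms(1) by (intro prob_space_PiM)
  have comp: "distr ?M \<nu> (\<lambda>x. x i) = \<nu>" if "i < B" for i
    using that assms(1) by (intro distr_PiM_component) auto
  have meas: "(\<lambda>x. x i) \<in> measurable ?M \<nu>" if "i < B" for i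
    using that by (intro measurable_component_singleton) simp
  have i1: "integrable ?M (\<lambda>x. x i)" and m1: "(LINT x|?M. x i) = 0"
    and i2: "integrable ?M (\<lambda>x. (x i)\<^sup>2)" and m2: "(LINT x|?M. (x i)\<^sup>2) \<le> v" if i: "i < B" for i
  proof -
    show "integrable ?M (\<lambda>x. x i)"
      using integrable_distr_eq[OF meas[OF i], of "\<lambda>x. x"] int1 by (simp add: comp[OF i])
    show "integrable ?M (\<lambda>x. (x i)\<^sup>2)"
      using integrable_distr_eq[OF meas[OF i], of "\<lambda>x. x\<^sup>2"] int2 by (simp add: comp[OF i])
    show "(LINT x|?M. x i) = 0"
      using integral_distr[OF meas[OF i], of "\<lambda>x. x"] mean by (simp add: comp[OF i])
    show "(LINT x|?M. (x i)\<^sup>2) \<le> v"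
      using integral_distr[OF meas[OF i], of "\<lambda>x. x\<^sup>2"] var by (simp add: comp[OF i])
  qed
  have indep: "P.indep_vars (\<lambda>_. borel) (\<lambda>i x. x i) {..<B}"
    using P.indep_vars_compose2[OF indep_vars_PiM_coordinates[OF assms(1), of "{..<B}"], of "\<lambda>_ x. x" "\<lambda>_. borel"]
    by simp
  have S: "integrable ?M (\<lambda>x. (\<Sum>i<n. x i)\<^sup>2) \<and> (LINT x|?M. (\<Sum>i<n. x i)\<^sup>2) \<le> real n * v" if "n \<le> B" for n
    using that
  proof (induction n)
    case (Suc n)
    then have n: "n < B" by simp
    have iS: "integrable ?M (\<lambda>x. \<Sum>i<n. x i)" using n i1 by (intro Bochner_Integration.integrable_sum) auto
    have "P.indep_var borel (\<lambda>x. x n) borel (\<lambda>x. \<Sum>i<n. x i)"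
    proof (rule P.indep_vars_sum)
      show "P.indep_vars (\<lambda>_. borel) (\<lambda>i x. x i) (insert n {..<n})"
        using n by (intro P.indep_vars_subset[OF indep]) auto
    qed auto
    then have cross: "(LINT x|?M. x n * (\<Sum>i<n. x i)) = 0" "integrable ?M (\<lambda>x. x n * (\<Sum>i<n. x i))"
      using P.indep_var_lebesgue_integral[OF _ i1[OF n] iS] P.indep_var_integrable[OF _ i1[OF n] iS] m1[OF n]
      by simp_all
    have eq: "(\<Sum>i<Suc n. x i)\<^sup>2 = (\<Sum>i<n. x i)\<^sup>2 + (2 * (x n * (\<Sum>i<n. x i)) + (x n)\<^sup>2)" for x :: "nat \<Rightarrow> real"
      by (simp add: power2_eq_square algebra_simps)
    show ?case
      unfolding eq using Suc.IH n cross i2[OF n] m2[OF n] by (simp add: distrib_right)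
  qed simp
  have Zm: "(\<lambda>x. (\<Sum>i<B. x i) / real B) \<in> measurable ?M borel" by measurable
  show "prob_space \<zeta>" unfolding \<zeta>_def by (rule P.prob_space_distr[OF Zm])
  show "sets \<zeta> = sets borel" by (simp add: \<zeta>_def)
  have i1s: "integrable ?M (\<lambda>x. \<Sum>i<B. x i)" using i1 by (intro Bochner_Integration.integrable_sum) auto
  show "integrable \<zeta> (\<lambda>z. z)" unfolding \<zeta>_def integrable_distr_eq[OF Zm measurable_ident_sets[OF refl]]
    using i1s by simp
  show "(LINT z|\<zeta>. z) = 0" unfolding \<zeta>_def integral_distr[OF Zm measurable_ident_sets[OF refl]]
    using i1 m1 by simp
  have sq: "(\<lambda>z :: real. z\<^sup>2) \<in> borel_measurable borel" by measurable
  show "integrable \<zeta> (\<lambda>z. z\<^sup>2)" unfolding \<zeta>_def integrable_distr_eq[OF Zm sq]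
    using S[of B] by (simp add: power_divide)
  have "(LINT z|\<zeta>. z\<^sup>2) = (LINT x|?M. (\<Sum>i<B. x i)\<^sup>2) / (real B)\<^sup>2"
    unfolding \<zeta>_def integral_distr[OF Zm sq] by (simp add: power_divide)
  also have "\<dots> \<le> real B * v / (real B)\<^sup>2" using S[of B] by (intro divide_right_mono) auto
  also have "\<dots> = v / real B" using B by (simp add: power2_eq_square)
  finally show "(LINT z|\<zeta>. z\<^sup>2) \<le> v / real B" .
qed

text \<open>Complete batches read disjoint blocks of the noise, so their means are independent, and
  reindexing a block gives each of them the law \<zeta>.\<close>

lemma prob_batch_means:
  fixes \<nu> :: "real measure"
  assumes "prob_space \<nu>" and sets: "sets \<nu> = sets borel" and T: "m * B \<le> T" and S: "\<And>k. k < m \<Longrightarrow> S k \<in> sets borel"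
  defines "\<zeta> \<equiv> distr (\<Pi>\<^sub>M i\<in>{..<B}. \<nu>) borel (\<lambda>x. (\<Sum>i<B. x i) / real B)"
  shows "{x \<in> space (\<Pi>\<^sub>M t\<in>{..<T}. \<nu>). \<forall>k<m. (\<Sum>i<B. x (k * B + i)) / real B \<in> S k} \<in> sets (\<Pi>\<^sub>M t\<in>{..<T}. \<nu>)"
    and "measure (\<Pi>\<^sub>M t\<in>{..<T}. \<nu>) {x \<in> space (\<Pi>\<^sub>M t\<in>{..<T}. \<nu>). \<forall>k<m. (\<Sum>i<B. x (k * B + i)) / real B \<in> S k} =
      (\<Prod>k<m. measure \<zeta> (S k))"
proof -
  note [measurable_cong] = sets
  let ?M = "\<Pi>\<^sub>M t\<in>{..<T}. \<nu>" and ?N = "\<Pi>\<^sub>M i\<in>{..<B}. \<nu>"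
  let ?Z = "\<lambda>k x. (\<Sum>i<B. x (k * B + i)) / real B"
  interpret P: prob_space ?M using assms(1) by (intro prob_space_PiM)
  have idx: "k * B + i < T" if "k < m" "i < B" for k i
  proof -
    have "k * B + i < Suc k * B" using that by simp
    also have "\<dots> \<le> m * B" using that by (intro mult_right_mono) auto
    finally show ?thesis using T by simp
  qed
  have Zm: "?Z k \<in> measurable ?M borel" if "k < m" for k
  proof -
    have "(\<lambda>x. x (k * B + i)) \<in> borel_measurable ?M" if "i < B" for i
      using measurable_component_singleton[of "k * B + i" "{..<T}" "\<lambda>_. \<nu>"] idx[OF \<open>k < m\<close> that]
      by (simp add: measurable_cong_sets[OF refl sets])
    then show ?thesis by (intro borel_measurable_divide borel_measurable_sum) auto
  qed
  have law: "distr ?M borel (?Z k) = \<zeta>" if k: "k < m" for k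
  proof -
    have "distr ?M ?N (\<lambda>x. \<lambda>i\<in>{..<B}. x (k * B + i)) = ?N"
      using distr_PiM_reindex[of "{..<T}" "\<lambda>_. \<nu>" "\<lambda>i. k * B + i" "{..<B}"] assms(1) idx[OF k]
      by (auto simp: inj_on_def)
    moreover have "distr (distr ?M ?N (\<lambda>x. \<lambda>i\<in>{..<B}. x (k * B + i))) borel (\<lambda>x. (\<Sum>i<B. x i) / real B) =
        distr ?M borel (?Z k)"
      using idx[OF k] by (subst distr_distr) (auto simp: o_def intro!: measurable_restrict distr_cong)
    ultimately show ?thesis by (simp add: \<zeta>_def)
  qed
  have set_eq: "{x \<in> space ?M. \<forall>k<m. ?Z k x \<in> S k} = {x \<in> space ?M. \<forall>k\<in>{..<m}. x \<in> ?Z k -` S k}" by auto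
  show "{x \<in> space ?M. \<forall>k<m. ?Z k x \<in> S k} \<in> sets ?M"
    unfolding set_eq using Zm S by (intro sets.sets_Collect_finite_All) (auto simp: vimage_def intro!: measurable_sets_borel)
  show "P.prob {x \<in> space ?M. \<forall>k<m. ?Z k x \<in> S k} = (\<Prod>k<m. measure \<zeta> (S k))"
  proof (cases "m = 0")
    case True
    then show ?thesis by (simp add: P.prob_space)
  next
    case False
    let ?K = "\<lambda>k. {k * B..<Suc k * B}"
    have "P.indep_vars (\<lambda>k. PiM (?K k) (\<lambda>_. \<nu>)) (\<lambda>k x. restrict (\<lambda>i. x i) (?K k)) {..<m}"
    proof (rule P.indep_vars_restrict[OF indep_vars_PiM_coordinates[OF assms(1)]])
      show "?K k \<subseteq> {..<T}" if "k \<in> {..<m}" for k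
      proof -
        have "Suc k * B \<le> m * B" using that by (intro mult_right_mono) auto
        then show ?thesis using T by auto
      qed
      show "disjoint_family_on ?K {..<m}"
      proof (unfold disjoint_family_on_def, intro ballI impI)
        fix a b :: nat assume "a \<noteq> b"
        have "x div B = k" if "x \<in> ?K k" for x k
          using that by (intro div_nat_eqI) (auto simp: mult.commute)
        then show "?K a \<inter> ?K b = {}" using \<open>a \<noteq> b\<close> by blast
      qed
    qed simp
    then have "P.indep_vars (\<lambda>_. borel) (\<lambda>k x. (\<Sum>i<B. restrict (\<lambda>i. x i) (?K k) (k * B + i)) / real B) {..<m}"
      by (rule P.indep_vars_compose2) measurable
    then have ind: "P.indep_vars (\<lambda>_. borel) ?Z {..<m}"
      by (rule P.indep_vars_cong[THEN iffD1, rotated 3]) (auto intro!: sum.cong ext)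
    have "P.prob {x \<in> space ?M. \<forall>k<m. ?Z k x \<in> S k} = P.prob (\<Inter>k\<in>{..<m}. ?Z k -` S k \<inter> space ?M)"
      using False by (intro arg_cong[where f = P.prob]) auto
    also have "\<dots> = (\<Prod>k<m. P.prob (?Z k -` S k \<inter> space ?M))"
      using False S by (intro P.indep_varsD[OF ind]) auto
    also have "\<dots> = (\<Prod>k<m. measure \<zeta> (S k))"
      using Zm S by (intro prod.cong refl) (simp add: measure_distr flip: law)
    finally show ?thesis .
  qed
qed

section \<open>Protocols as decision trees cut off at a horizon\<close>

primrec arm :: "('a, 'a) prot \<Rightarrow> 'a" where
  "arm (Ret a) = a"
| "arm (Ask a s t k) = a"

text \<open>After learning the bit is constantly \<open>False\<close> and \<open>next_prot\<close>
  stays at the leaf, so a finished protocol repeats its returned arm; \<open>bit_prob\<close> gives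
  this default bit probability 1.\<close>

primrec answer :: "('a, 'r) prot \<Rightarrow> real \<Rightarrow> bool" where
  "answer (Ret r) x = False"
| "answer (Ask a s t k) x \<longleftrightarrow> t < s * x"

primrec next_prot :: "('a, 'r) prot \<Rightarrow> bool \<Rightarrow> ('a, 'r) prot" where
  "next_prot (Ret r) b = Ret r"
| "next_prot (Ask a s t k) b = k b"

definition after :: "('a, 'r) prot \<Rightarrow> bool list \<Rightarrow> ('a, 'r) prot" where
  "after p h = foldl next_prot p h"

lemma after_Nil [simp]: "after p [] = p" and after_Cons [simp]: "after p (b # h) = after (next_prot p b) h"
  by (simp_all add: after_def)

lemma all_prot_arm: "all_prot P P p \<Longrightarrow> P (arm p)"
  by (cases p) auto

lemma all_prot_after: "all_prot P Q p \<Longrightarrow> all_prot P Q (after p h)"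
proof (induction h arbitrary: p)
  case (Cons b h)
  then have "all_prot P Q (next_prot p b)" by (cases p) auto
  then show ?case using Cons.IH by simp
qed simp

text \<open>Only prefixes of length below \<open>n\<close> occur, so the cost of \<open>n\<close>
  batches is determined by \<open>n - 1\<close> bits.\<close>

definition path_cost :: "('a \<Rightarrow> real) \<Rightarrow> nat \<Rightarrow> ('a, 'a) prot \<Rightarrow> bool list \<Rightarrow> real" where
  "path_cost g n p h = (\<Sum>m<n. g (arm (after p (take m h))))"

lemma path_cost_Cons: "path_cost g (Suc n) p (b # h) = g (arm p) + path_cost g n (next_prot p b) h"
  unfolding path_cost_def sum.lessThan_Suc_shift by simp

lemma sum_bool_lists_Suc:
  "(\<Sum>h | length h = Suc n. f h) = (\<Sum>h | length h = n. f (True # h)) + (\<Sum>h | length h = n. f (False # h :: bool list))"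
proof -
  have fin: "finite {h :: bool list. length h = n}"
    using finite_lists_length_eq[of "UNIV :: bool set" n] by simp
  have "{h :: bool list. length h = Suc n} = (#) True ` {h. length h = n} \<union> (#) False ` {h. length h = n}"
    by (auto simp: length_Suc_conv image_iff)
  then have "(\<Sum>h | length h = Suc n. f h) =
      (\<Sum>h\<in>(#) True ` {h. length h = n}. f h) + (\<Sum>h\<in>(#) False ` {h. length h = n}. f h)"
    using fin by (simp only:) (rule sum.union_disjoint, auto)
  then show ?thesis by (simp add: sum.reindex)
qed

context answer_model
begin

primrec bit_prob :: "('a, 'r) prot \<Rightarrow> bool \<Rightarrow> real" where
  "bit_prob (Ret r) b = of_bool (\<not> b)"
| "bit_prob (Ask a s t k) b = (if b then pr a s t else 1 - pr a s t)"

primrec path_prob :: "('a, 'r) prot \<Rightarrow> bool list \<Rightarrow> real" where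
  "path_prob p [] = 1"
| "path_prob p (b # h) = bit_prob p b * path_prob (next_prot p b) h"


text \<open>Needed where learning is cut off: dropping the cost still to come is an upper estimate
  only for nonnegative costs.\<close>

lemma ex_mono_nonneg:
  assumes g: "\<And>a. 0 \<le> g a"
  shows "(\<And>r c. 0 \<le> c \<Longrightarrow> F r c \<le> H r c) \<Longrightarrow> ex p F \<le> ex p H"
proof (induction p arbitrary: F H)
  case (Ask a s t k)
  then show ?case
    using g by (auto intro!: add_mono mult_left_mono simp: pr_nonneg pr_le_1)
qed simp

lemma bit_prob_nonneg: "0 \<le> bit_prob p b"
  by (cases p) (auto simp: pr_nonneg pr_le_1)

lemma path_prob_nonneg: "0 \<le> path_prob p h"
  by (induction h arbitrary: p) (auto simp: bit_prob_nonneg)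

lemma path_prob_eq_prod: "path_prob p h = (\<Prod>k<length h. bit_prob (after p (take k h)) (h ! k))"
  by (induction h arbitrary: p) (simp_all add: prod.lessThan_Suc_shift del: prod.lessThan_Suc)

text \<open>Compares n + 1 batches with the complete tree. If a leaf is reached in time, the rest is
  at most n + 1 batches of the returned arm; if not, the path pays only a prefix of what the tree
  pays. Both are at most c + (n + 1) * g r because \<open>g\<close> is nonnegative.\<close>

lemma sum_path_prob_le_ex:
  fixes p :: "('a, 'a) prot"
  assumes g: "\<And>a. 0 \<le> g a"
  shows "(\<Sum>h | length h = n. path_prob p h * of_bool (bd < path_cost g (Suc n) p h)) \<le>
    ex p (\<lambda>r c. of_bool (bd < c + real (Suc n) * g r))"
proof (induction n arbitrary: p bd)
  case 0
  show ?case
  proof (cases p)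
    case (Ask a s t k)
    have "ex p (\<lambda>r c. of_bool (bd < c + real (Suc 0) * g r)) =
        pr a s t * ex (k True) (\<lambda>r c. of_bool (bd < g a + c + g r)) +
        (1 - pr a s t) * ex (k False) (\<lambda>r c. of_bool (bd < g a + c + g r))"
      by (simp add: Ask)
    also have "\<dots> \<ge> pr a s t * ex (k True) (\<lambda>r c. of_bool (bd < g a)) +
        (1 - pr a s t) * ex (k False) (\<lambda>r c. of_bool (bd < g a))"
      using g pr_le_1 pr_nonneg
      by (intro add_mono mult_left_mono ex_mono_nonneg) (auto simp: of_bool_def add.assoc intro: less_le_trans)
    finally show ?thesis by (simp add: Ask ex_const path_cost_def algebra_simps)
  qed (simp add: path_cost_def)
next
  case (Suc n)
  have "(\<Sum>h | length h = Suc n. path_prob p h * of_bool (bd < path_cost g (Suc (Suc n)) p h)) =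
     bit_prob p True * (\<Sum>h | length h = n. path_prob (next_prot p True) h *
       of_bool (bd - g (arm p) < path_cost g (Suc n) (next_prot p True) h)) +
     bit_prob p False * (\<Sum>h | length h = n. path_prob (next_prot p False) h *
       of_bool (bd - g (arm p) < path_cost g (Suc n) (next_prot p False) h))"
    unfolding sum_bool_lists_Suc path_prob.simps path_cost_Cons
    by (simp add: sum_distrib_left mult.assoc diff_less_eq add.commute)
  also have "\<dots> \<le> bit_prob p True * ex (next_prot p True) (\<lambda>r c. of_bool (bd - g (arm p) < c + real (Suc n) * g r)) +
      bit_prob p False * ex (next_prot p False) (\<lambda>r c. of_bool (bd - g (arm p) < c + real (Suc n) * g r))"
    using Suc.IH bit_prob_nonneg by (intro add_mono mult_left_mono) auto
  also have "\<dots> \<le> ex p (\<lambda>r c. of_bool (bd < c + real (Suc (Suc n)) * g r))"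
  proof (cases p)
    case (Ret r)
    then show ?thesis by (simp add: algebra_simps)
  next
    case (Ask a s t k)
    have "of_bool (bd - g a < c + real (Suc n) * g r) \<le> (of_bool (bd < g a + c + real (Suc (Suc n)) * g r) :: real)" for c r
      using g[of r] by (auto simp: of_bool_def algebra_simps)
    then have *: "ex q (\<lambda>r c. of_bool (bd - g a < c + real (Suc n) * g r)) \<le>
        ex q (\<lambda>r c. of_bool (bd < g a + c + real (Suc (Suc n)) * g r))" for q
      by (rule ex_mono)
    show ?thesis
      unfolding Ask using * pr_nonneg pr_le_1 by (simp add: add_mono mult_left_mono)
  qed
  finally show ?case .
qed

end

text \<open>The seed is degenerate. Division by \<open>B\<close> gives the mean of each complete
  batch; every action rests on bits of complete batches, since a shorter one can only be the
  last.\<close>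

definition prot_alg :: "nat \<Rightarrow> nat \<Rightarrow> (real vec, real vec) prot \<Rightarrow> bandit_alg" where
  "prot_alg T B p = \<lparr>seed_law = return borel 0, action = \<lambda>u h i. arm (after p h),
     quantizer = \<lambda>u h y. answer (after p h) ((\<Sum>i<batch_len T B (length h). y i) / real B)\<rparr>"

lemma valid_prot_alg:
  assumes p: "all_prot (\<lambda>a. a \<in> A) (\<lambda>a. a \<in> A) p"
  shows "valid_alg A T B (prot_alg T B p)"
proof -
  have arm: "arm (after p h) \<in> A" for h
    using all_prot_arm[OF all_prot_after[OF p]] .
  have quant: "(\<lambda>(u, y). answer q ((\<Sum>i<L. y i) / real B))
      \<in> measurable (return borel (0 :: real) \<Otimes>\<^sub>M (\<Pi>\<^sub>M i\<in>{..<L}. borel)) (count_space UNIV)"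
    for q :: "(real vec, real vec) prot" and L
  proof (cases q)
    case (Ask a s t k)
    have "(\<lambda>x. snd x i) \<in> borel_measurable (return borel (0 :: real) \<Otimes>\<^sub>M (\<Pi>\<^sub>M i\<in>{..<L}. (borel :: real measure)))"
      if "i < L" for i
      using that by (intro measurable_compose[OF measurable_snd] measurable_component_singleton) auto
    then have "(\<lambda>x. s * ((\<Sum>i<L. snd x i) / real B)) \<in>
        borel_measurable (return borel (0 :: real) \<Otimes>\<^sub>M (\<Pi>\<^sub>M i\<in>{..<L}. (borel :: real measure)))"
      by (intro borel_measurable_times borel_measurable_divide borel_measurable_sum) auto
    then show ?thesis unfolding Ask split_beta' by simp
  qed simp
  show ?thesis
    unfolding valid_alg_def prot_alg_def bandit_alg.simps
  proof (intro conjI allI impI)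
    show "prob_space (return borel (0 :: real))" by (rule prob_space_return) simp
    show "sets (return borel (0 :: real)) = sets borel" by simp
    show "(\<lambda>u. arm (after p h)) \<in> measurable (return borel (0 :: real)) (count_space A)" for h
      using arm by simp
  qed (rule quant)
qed

section \<open>Feedback and regret of the algorithm built from a protocol\<close>

lemma length_feedback [simp]: "length (feedback T B \<theta> alg \<omega> m) = m"
  by (induction m) (simp_all add: Let_def)

lemma feedback_take: "m \<le> n \<Longrightarrow> feedback T B \<theta> alg \<omega> m = take m (feedback T B \<theta> alg \<omega> n)"
  by (induction n) (auto simp: Let_def le_Suc_eq)

text \<open>Resolves the adaptivity: for a fixed history \<open>h\<close> all arms and thresholds
  are fixed, so receiving \<open>h\<close> becomes one condition per batch on the mean noise of that
  batch alone.\<close>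

lemma feedback_prot_alg_iff:
  assumes "m * B \<le> T" and B: "1 \<le> B"
  shows "feedback T B \<theta> (prot_alg T B p) \<omega> m = h \<longleftrightarrow> length h = m \<and>
    (\<forall>k<m. answer (after p (take k h))
      (scalar_prod (arm (after p (take k h))) \<theta> + (\<Sum>i<B. snd \<omega> (k * B + i)) / real B) = h ! k)"
  using assms(1)
proof (induction m arbitrary: h)
  case (Suc m)
  have len: "batch_len T B m = B" using Suc.prems by (simp add: batch_len_def)
  let ?f = "feedback T B \<theta> (prot_alg T B p) \<omega> m"
  let ?b = "\<lambda>k h. answer (after p (take k h))
      (scalar_prod (arm (after p (take k h))) \<theta> + (\<Sum>i<B. snd \<omega> (k * B + i)) / real B)"
  have step: "feedback T B \<theta> (prot_alg T B p) \<omega> (Suc m) = ?f @ [?b m ?f]"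
    using B by (simp add: Let_def prot_alg_def len sum.distrib add_divide_distrib)
  show ?case
  proof (cases h rule: rev_cases)
    case (snoc h' b)
    have "feedback T B \<theta> (prot_alg T B p) \<omega> (Suc m) = h \<longleftrightarrow> ?f = h' \<and> ?b m h' = b"
      unfolding step snoc using length_feedback[of T B \<theta> "prot_alg T B p" \<omega> m] by auto
    also have "\<dots> \<longleftrightarrow> length h' = m \<and> (\<forall>k<m. ?b k h' = h' ! k) \<and> ?b m h' = b"
      using Suc by simp
    also have "\<dots> \<longleftrightarrow> length h = Suc m \<and> (\<forall>k<Suc m. ?b k h = h ! k)"
      by (auto simp: snoc less_Suc_eq nth_append)
    finally show ?thesis .
  qed (simp add: Let_def)
qed auto

lemma sum_blocks: "(\<Sum>t<k * B. f (t div B)) = real B * (\<Sum>m<k. f m)" if "1 \<le> B" for f :: "nat \<Rightarrow> real"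
proof (induction k)
  case (Suc k)
  have "(\<Sum>t<Suc k * B. f (t div B)) = (\<Sum>t<k * B. f (t div B)) + (\<Sum>t\<in>{k * B..<k * B + B}. f (t div B))"
    by (subst sum.union_disjoint[symmetric]) (auto intro!: sum.cong simp: add.commute)
  also have "(\<Sum>t\<in>{k * B..<k * B + B}. f (t div B)) = (\<Sum>t\<in>{k * B..<k * B + B}. f k)"
    by (intro sum.cong refl arg_cong[where f = f] div_nat_eqI) (auto simp: mult.commute)
  finally show ?case using Suc by (simp add: algebra_simps)
qed simp

lemma arg_max_on_finite:
  fixes f :: "'a \<Rightarrow> 'b :: linorder"
  assumes "finite A" "A \<noteq> {}"
  shows "arg_max_on f A \<in> A" "a \<in> A \<Longrightarrow> f a \<le> f (arg_max_on f A)"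
proof -
  have "Max (f ` A) \<in> f ` A" using assms by (intro Max_in) auto
  then obtain x where "x \<in> A" "f x = Max (f ` A)" by auto
  then have "is_arg_max f (\<lambda>x. x \<in> A) x" using assms by (simp add: is_arg_max_linorder)
  then have *: "is_arg_max f (\<lambda>x. x \<in> A) (arg_max_on f A)"
    unfolding arg_max_on_def arg_max_def by (rule someI)
  then show "arg_max_on f A \<in> A" by (simp add: is_arg_max_def)
  show "a \<in> A \<Longrightarrow> f a \<le> f (arg_max_on f A)" using * by (simp add: is_arg_max_linorder)
qed

text \<open>Transfers a bound on the abstract tree to the probability space of runs. The actions
  depend on finitely many bits, and each bit string is received on a product event whose probability
  is its \<open>path_prob\<close>.\<close>

lemma regret_prot_alg:
  fixes A :: "real vec set" and \<theta> :: "real vec" and p :: "(real vec, real vec) prot"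
  assumes A: "finite A" "A \<noteq> {}" "A \<subseteq> carrier_vec d" and \<theta>: "\<theta> \<in> carrier_vec d"
    and \<nu>: "prob_space \<nu>" "sets \<nu> = sets borel" and B: "1 \<le> B" "B \<le> T"
    and p: "all_prot (\<lambda>a. a \<in> A) (\<lambda>a. a \<in> A) p"
  defines "\<mu> \<equiv> \<lambda>a. scalar_prod a \<theta>"
  defines "g \<equiv> \<lambda>a. if a \<in> A then real B * (\<mu> (arg_max_on \<mu> A) - \<mu> a) else 0"
  defines "\<zeta> \<equiv> distr (\<Pi>\<^sub>M i\<in>{..<B}. \<nu>) borel (\<lambda>x. (\<Sum>i<B. x i) / real B)"
  defines "pr \<equiv> \<lambda>a s t. measure \<zeta> {z. t < s * (\<mu> a + z)}"
  assumes fail: "answer_model.ex pr g p (\<lambda>r c. of_bool (bd < c + real (num_batches T B) * g r)) \<le> \<delta>"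
  shows "1 - \<delta> \<le> measure (run_space T \<nu> (prot_alg T B p))
    {\<omega> \<in> space (run_space T \<nu> (prot_alg T B p)). regret A T B \<theta> (prot_alg T B p) \<omega> \<le> bd}"
proof -
  let ?M = "\<Pi>\<^sub>M t\<in>{..<T}. \<nu>" and ?alg = "prot_alg T B p"
  have Zm: "(\<lambda>x. (\<Sum>i<B. x i) / real B) \<in> borel_measurable (\<Pi>\<^sub>M i\<in>{..<B}. \<nu>)"
  proof -
    have "(\<lambda>x. x i) \<in> borel_measurable (\<Pi>\<^sub>M i\<in>{..<B}. \<nu>)" if "i < B" for i
      using measurable_component_singleton[of i "{..<B}" "\<lambda>_. \<nu>"] that
      by (simp add: measurable_cong_sets[OF refl \<nu>(2)])
    then show ?thesis by (intro borel_measurable_divide borel_measurable_sum) auto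
  qed
  interpret N: prob_space "\<Pi>\<^sub>M i\<in>{..<B}. \<nu>" using \<nu> by (intro prob_space_PiM)
  interpret Z: prob_space \<zeta> unfolding \<zeta>_def by (rule N.prob_space_distr[OF Zm])
  interpret M: prob_space ?M using \<nu> by (intro prob_space_PiM)
  interpret E: answer_model pr g by unfold_locales (simp_all add: pr_def)
  have setsZ: "sets \<zeta> = sets borel" and spaceZ: "space \<zeta> = UNIV" by (simp_all add: \<zeta>_def)
  define a_opt where "a_opt = arg_max_on \<mu> A"
  have opt: "a_opt \<in> A" "\<And>a. a \<in> A \<Longrightarrow> \<mu> a \<le> \<mu> a_opt"
    unfolding a_opt_def using arg_max_on_finite[OF A(1,2), where f = \<mu>] by auto
  \<comment> \<open>Valid for every vector because \<open>g\<close> is set to 0 outside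
    \<open>A\<close>.\<close>
  have g0: "0 \<le> g a" for a using opt by (simp add: g_def flip: a_opt_def)
  \<comment> \<open>The last batch may be shorter, but its actions depend only on the bits of the
    \<open>n\<close> complete batches before it.\<close>
  define n where "n = num_batches T B - 1"
  have TB: "0 < real T / real B" using B by simp
  then have M: "num_batches T B = Suc n" unfolding n_def num_batches_def by simp
  have "real n < real T / real B" "real T / real B \<le> real (Suc n)"
    using TB M unfolding num_batches_def by linarith+
  then have "real (n * B) < real T" "real T \<le> real (Suc n * B)" using B by (simp_all add: field_simps)
  then have nB: "n * B < T" "T \<le> Suc n * B" by linarith+
  have arm: "arm (after p h) \<in> A" for h using all_prot_arm[OF all_prot_after[OF p]] .
  define Rg where "Rg h = (\<Sum>t<T. \<mu> a_opt - \<mu> (arm (after p (take (t div B) h))))" for h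
  have regret: "regret A T B \<theta> ?alg \<omega> = Rg (feedback T B \<theta> ?alg \<omega> n)" for \<omega>
  proof -
    have "scalar_prod (a_opt - played T B \<theta> ?alg \<omega> t) \<theta> =
        \<mu> a_opt - \<mu> (arm (after p (take (t div B) (feedback T B \<theta> ?alg \<omega> n))))" if "t < T" for t
    proof -
      have "t < Suc n * B" using that nB by linarith
      then have "t div B \<le> n" using B by (simp add: less_mult_imp_div_less less_Suc_eq_le[symmetric])
      then have "played T B \<theta> ?alg \<omega> t = arm (after p (take (t div B) (feedback T B \<theta> ?alg \<omega> n)))"
        unfolding played_def using feedback_take[of "t div B" n] by (simp add: prot_alg_def)
      then show ?thesis
        using arm opt A(3) \<theta> unfolding \<mu>_def by (auto intro!: minus_scalar_prod_distrib)
    qed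
    then show ?thesis by (simp add: regret_def Rg_def flip: \<mu>_def a_opt_def)
  qed
  \<comment> \<open>Filling the last batch up to \<open>B\<close> rounds adds nonnegative
    gaps.\<close>
  have Rg_le: "Rg h \<le> path_cost g (Suc n) p h" for h
  proof -
    have "Rg h \<le> (\<Sum>t<Suc n * B. \<mu> a_opt - \<mu> (arm (after p (take (t div B) h))))"
      unfolding Rg_def using nB opt arm by (intro sum_mono2) auto
    also have "\<dots> = real B * (\<Sum>m<Suc n. \<mu> a_opt - \<mu> (arm (after p (take m h))))"
      by (rule sum_blocks[OF B(1)])
    also have "\<dots> = path_cost g (Suc n) p h"
      unfolding path_cost_def sum_distrib_left
      using arm by (intro sum.cong refl) (simp add: g_def flip: a_opt_def)
    finally show ?thesis .
  qed
  define S where "S h k = {z. answer (after p (take k h)) (\<mu> (arm (after p (take k h))) + z) = h ! k}" for h k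
  define Ev where "Ev h = {x \<in> space ?M. \<forall>k<n. (\<Sum>i<B. x (k * B + i)) / real B \<in> S h k}" for h
  have S: "S h k \<in> sets borel \<and> measure \<zeta> (S h k) = E.bit_prob (after p (take k h)) (h ! k)" for h k
  proof (cases "after p (take k h)")
    case (Ret a)
    then have "S h k = (if h ! k then {} else UNIV)" by (auto simp: S_def)
    then show ?thesis using Ret Z.prob_space spaceZ by auto
  next
    case (Ask a s t q)
    let ?Y = "{z. t < s * (\<mu> a + z)}"
    have Y: "?Y \<in> sets borel" by measurable
    have "S h k = (if h ! k then ?Y else - ?Y)" by (auto simp: S_def Ask)
    moreover have "measure \<zeta> (- ?Y) = 1 - measure \<zeta> ?Y"
      using Z.prob_compl[of ?Y] Y by (simp add: setsZ spaceZ Compl_eq_Diff_UNIV)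
    moreover have "pr a s t = measure \<zeta> ?Y" by (simp add: pr_def)
    ultimately show ?thesis using Y unfolding Ask E.bit_prob.simps by (simp add: borel_comp)
  qed
  have Ev: "Ev h \<in> sets ?M" "length h = n \<Longrightarrow> M.prob (Ev h) = E.path_prob p h" for h
  proof -
    have nT: "n * B \<le> T" using nB by simp
    show "Ev h \<in> sets ?M"
      unfolding Ev_def using S by (intro prob_batch_means(1)[OF \<nu> nT]) auto
    have "M.prob (Ev h) = (\<Prod>k<n. measure \<zeta> (S h k))"
      unfolding Ev_def \<zeta>_def using S by (intro prob_batch_means(2)[OF \<nu> nT]) auto
    then show "length h = n \<Longrightarrow> M.prob (Ev h) = E.path_prob p h"
      using S by (simp add: E.path_prob_eq_prod)
  qed
  have fb: "feedback T B \<theta> ?alg \<omega> n = h \<longleftrightarrow> length h = n \<and> snd \<omega> \<in> Ev h" if "snd \<omega> \<in> space ?M" for \<omega> h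
    using that nB B
      feedback_prot_alg_iff[where m = n and B = B and T = T and \<theta> = \<theta> and p = p and \<omega> = \<omega> and h = h]
    by (auto simp: Ev_def S_def \<mu>_def)
  have fin: "finite {h :: bool list. length h = n}"
    using finite_lists_length_eq[of "UNIV :: bool set" n] by simp
  let ?H = "{h. length h = n \<and> bd < Rg h}"
  have finH: "finite ?H" by (rule finite_subset[OF _ fin]) auto
  \<comment> \<open>The regret is a function of the history, so the bad event is a finite union of
    measurable events.\<close>
  define bad where "bad = (\<Union>h\<in>?H. Ev h)"
  have bad: "bad \<in> sets ?M" unfolding bad_def using Ev(1) finH by (intro sets.finite_UN) auto
  have good_eq: "{\<omega> \<in> space (run_space T \<nu> ?alg). regret A T B \<theta> ?alg \<omega> \<le> bd} = UNIV \<times> (space ?M - bad)"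
  proof -
    have iff: "regret A T B \<theta> ?alg (u, x) \<le> bd \<longleftrightarrow> x \<notin> bad" if x: "x \<in> space ?M" for u x
    proof -
      define h where "h = feedback T B \<theta> ?alg (u, x) n"
      have h: "length h' = n \<and> x \<in> Ev h' \<longleftrightarrow> h = h'" for h'
        using fb[of "(u, x)" h'] x by (simp add: h_def)
      have "x \<in> bad \<longleftrightarrow> (\<exists>h'. (length h' = n \<and> x \<in> Ev h') \<and> bd < Rg h')"
        by (auto simp: bad_def)
      also have "\<dots> \<longleftrightarrow> bd < Rg h" unfolding h by simp
      finally have "x \<in> bad \<longleftrightarrow> bd < Rg h" .
      then show ?thesis by (simp add: regret h_def not_less)
    qed
    have space: "space (run_space T \<nu> ?alg) = UNIV \<times> space ?M"
      by (simp add: run_space_def prot_alg_def space_pair_measure)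
    show ?thesis
    proof (rule Set.set_eqI)
      fix \<omega>
      show "\<omega> \<in> {\<omega> \<in> space (run_space T \<nu> ?alg). regret A T B \<theta> ?alg \<omega> \<le> bd} \<longleftrightarrow>
          \<omega> \<in> UNIV \<times> (space ?M - bad)"
        unfolding space using iff[of "snd \<omega>" "fst \<omega>"] by (cases \<omega>) auto
    qed
  qed
  have "measure (run_space T \<nu> ?alg) (UNIV \<times> (space ?M - bad)) = M.prob (space ?M - bad)"
  proof -
    have "emeasure (return borel (0 :: real) \<Otimes>\<^sub>M ?M) (UNIV \<times> (space ?M - bad)) = emeasure ?M (space ?M - bad)"
      using bad by (subst M.emeasure_pair_measure_Times) auto
    then show ?thesis by (simp add: run_space_def prot_alg_def measure_def)
  qed
  also have "\<dots> = 1 - M.prob bad" by (rule M.prob_compl[OF bad])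
  finally have good: "measure (run_space T \<nu> ?alg)
      {\<omega> \<in> space (run_space T \<nu> ?alg). regret A T B \<theta> ?alg \<omega> \<le> bd} = 1 - M.prob bad"
    unfolding good_eq .
  have "M.prob bad \<le> (\<Sum>h\<in>?H. M.prob (Ev h))"
    unfolding bad_def using Ev(1) finH by (intro M.finite_measure_subadditive_finite) auto
  also have "\<dots> = (\<Sum>h\<in>?H. E.path_prob p h * of_bool (bd < path_cost g (Suc n) p h))"
  proof (rule sum.cong[OF refl])
    fix h assume "h \<in> ?H"
    then show "M.prob (Ev h) = E.path_prob p h * of_bool (bd < path_cost g (Suc n) p h)"
      using Ev(2)[of h] Rg_le[of h] by simp
  qed
  also have "\<dots> \<le> (\<Sum>h | length h = n. E.path_prob p h * of_bool (bd < path_cost g (Suc n) p h))"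
    using fin by (intro sum_mono2) (auto simp: E.path_prob_nonneg)
  also have "\<dots> \<le> E.ex p (\<lambda>r c. of_bool (bd < c + real (Suc n) * g r))"
    by (rule E.sum_path_prob_le_ex[OF g0])
  also have "\<dots> \<le> \<delta>" using fail M by simp
  finally show ?thesis using good by simp
qed

section \<open>Choice of the parameters\<close>

lemma grid_size_le:
  assumes "0 < \<beta>" "\<beta> \<le> 1" "ln (1 / \<beta>) \<le> \<Lambda>" "1 \<le> \<Lambda>"
  shows "real (grid_size \<beta>) \<le> 2 * \<Lambda> / \<beta>"
proof -
  have "0 \<le> ln (1 / \<beta>) / \<beta>" using assms by (intro divide_nonneg_pos) auto
  then have "real (grid_size \<beta>) \<le> ln (1 / \<beta>) / \<beta> + 1" unfolding grid_size_def by linarith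
  also have "\<dots> \<le> \<Lambda> / \<beta> + \<Lambda> / \<beta>"
  proof (intro add_mono divide_right_mono)
    show "1 \<le> \<Lambda> / \<beta>" using assms by (simp add: le_divide_eq)
  qed (use assms in auto)
  finally show ?thesis by simp
qed

lemma nat_ceiling_le_4:
  assumes "0 < \<beta>" "\<beta> \<le> 1" "1 \<le> L"
  shows "real (nat \<lceil>3 * L / \<beta>\<rceil>) \<le> 4 * L / \<beta>"
proof -
  have "0 \<le> 3 * L / \<beta>" using assms by (intro divide_nonneg_pos) auto
  then have "real (nat \<lceil>3 * L / \<beta>\<rceil>) \<le> 3 * L / \<beta> + 1" by linarith
  also have "1 \<le> L / \<beta>" using assms by (simp add: le_divide_eq)
  finally show ?thesis by (simp add: field_simps)
qed

text \<open>The number of batches is of order 1 / \<beta>^2, and (16 + y)^2 <= 512 + 2 * y^2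
  separates the floor of the resolution from the noise term. Because s^2 * b = S^2, the noise term
  loses its dependence on the batch size.\<close>

lemma phase_cost_le:
  fixes s S b :: real
  assumes s: "s = S / sqrt b" and S: "0 \<le> S" and b: "0 < b" and N: "0 \<le> N"
    and \<beta>: "\<beta> = 1 / (16 + 32 * s * sqrt N * 2 ^ p)" and \<Lambda>: "ln (1 / \<beta>) \<le> \<Lambda>" "1 \<le> \<Lambda>" and L: "1 \<le> L"
  shows "real (2 * grid_size \<beta> * nat \<lceil>3 * L / \<beta>\<rceil>) * (b * (8 * (1 / 2) ^ p))
    \<le> \<Lambda> * L * (2 ^ 16 * b * (1 / 2) ^ p + 2 ^ 18 * S\<^sup>2 * N * 2 ^ p)"
proof -
  let ?y = "32 * s * sqrt N * 2 ^ p"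
  have s0: "0 \<le> s" using s S b by simp
  then have y0: "0 \<le> ?y" using N by simp
  have \<beta>1: "0 < \<beta>" "\<beta> \<le> 1" unfolding \<beta> using y0 by (simp_all add: divide_le_eq add_pos_nonneg)
  have "real (2 * grid_size \<beta> * nat \<lceil>3 * L / \<beta>\<rceil>) = 2 * (real (grid_size \<beta>) * real (nat \<lceil>3 * L / \<beta>\<rceil>))" by simp
  also have "\<dots> \<le> 2 * ((2 * \<Lambda> / \<beta>) * (4 * L / \<beta>))"
    using grid_size_le[OF \<beta>1 \<Lambda>] nat_ceiling_le_4[OF \<beta>1 L] \<beta>1 \<Lambda> by (intro mult_left_mono mult_mono) auto
  also have "\<dots> = 16 * \<Lambda> * L * (1 / \<beta>)\<^sup>2" by (simp add: power2_eq_square)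
  also have "\<dots> \<le> 16 * \<Lambda> * L * (512 + 2048 * s\<^sup>2 * N * (2 ^ p)\<^sup>2)"
  proof (rule mult_left_mono)
    have "(1 / \<beta>)\<^sup>2 = (16 + ?y)\<^sup>2" by (simp add: \<beta>)
    also have "\<dots> \<le> 2 * 16\<^sup>2 + 2 * ?y\<^sup>2"
      using zero_le_power2[of "16 - ?y"] by (simp add: power2_eq_square algebra_simps)
    also have "?y\<^sup>2 = 1024 * s\<^sup>2 * N * (2 ^ p)\<^sup>2" using N by (simp add: power_mult_distrib)
    finally show "(1 / \<beta>)\<^sup>2 \<le> 512 + 2048 * s\<^sup>2 * N * (2 ^ p)\<^sup>2" by simp
  qed (use \<Lambda> L in simp)
  finally have "real (2 * grid_size \<beta> * nat \<lceil>3 * L / \<beta>\<rceil>) * (b * (8 * (1 / 2) ^ p)) \<le>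
      16 * \<Lambda> * L * (512 + 2048 * s\<^sup>2 * N * (2 ^ p)\<^sup>2) * (b * (8 * (1 / 2) ^ p))"
    using b by (intro mult_right_mono) auto
  also have "\<dots> = \<Lambda> * L * (2 ^ 16 * b * (1 / 2) ^ p + 2 ^ 18 * (s\<^sup>2 * b) * N * ((2 ^ p)\<^sup>2 * (1 / 2) ^ p))"
    by (simp add: algebra_simps)
  also have "s\<^sup>2 * b = S\<^sup>2" using b by (simp add: s power_divide)
  also have "(2 ^ p)\<^sup>2 * (1 / 2) ^ p = (2 ^ p :: real)"
    by (simp add: power2_eq_square power_one_over)
  finally show ?thesis .
qed

lemma sum_phase_cost_le:
  assumes b: "0 \<le> b" and c: "0 \<le> (c :: real)"
  shows "(\<Sum>p<P. b * (1 / 2) ^ p + c * 2 ^ p) \<le> 2 * b + c * 2 ^ P"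
proof -
  have "(\<Sum>p<P. b * (1 / 2) ^ p + c * 2 ^ p) = b * (2 - 2 * (1 / 2) ^ P) + c * (2 ^ P - 1)"
    by (induction P) (simp_all add: algebra_simps)
  also have "\<dots> \<le> b * 2 + c * 2 ^ P"
    using b c by (intro add_mono mult_left_mono) auto
  finally show ?thesis by simp
qed

text \<open>\<open>nat\<close> cuts negative logarithms off at 0, where the power is 1 and may
  exceed 2 * x; hence the condition in the second part.\<close>

lemma nat_ceiling_log2:
  fixes x :: real
  assumes "0 < x"
  shows "x \<le> 2 ^ nat \<lceil>log 2 x\<rceil>" and "0 < nat \<lceil>log 2 x\<rceil> \<Longrightarrow> 2 ^ nat \<lceil>log 2 x\<rceil> \<le> 2 * x"
proof -
  let ?P = "nat \<lceil>log 2 x\<rceil>"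
  have "log 2 x \<le> real ?P" by linarith
  then have "2 powr log 2 x \<le> 2 powr real ?P" by simp
  then show "x \<le> 2 ^ ?P" using assms by (simp add: powr_realpow)
  assume "0 < ?P"
  then have "real ?P \<le> 1 + log 2 x" by linarith
  then have "2 powr real ?P \<le> 2 powr (1 + log 2 x)" by simp
  then show "2 ^ ?P \<le> 2 * x" using assms by (simp add: powr_realpow powr_add)
qed

lemma nat_ceiling_log2_le_ln:
  fixes x y :: real
  assumes "0 < x" "x \<le> y" "1 \<le> y"
  shows "real (nat \<lceil>log 2 x\<rceil>) \<le> 2 * ln y + 1"
proof -
  have l2: "1 / 2 \<le> ln (2 :: real)" using ln2_ge_two_thirds by simp
  have "log 2 x \<le> log 2 y" using assms by simp
  also have "\<dots> = ln y / ln 2" by (simp add: log_def)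
  also have "\<dots> \<le> ln y / (1 / 2)" using l2 assms by (intro divide_left_mono) auto
  finally have "log 2 x \<le> 2 * ln y" by simp
  moreover have "0 \<le> ln y" using assms by simp
  ultimately show ?thesis by linarith
qed

text \<open>The schedule: \<open>P\<close> phases with \<open>2 ^ P \<approx> sqrt (T / L) / d\<close>, so that the \<open>d\<^sup>2 * L * 2 ^ P\<close> regret of
  learning to precision \<open>2 ^ - P\<close> balances the \<open>T / 2 ^ P\<close> regret of committing afterwards.\<close>

definition log_conf :: "real \<Rightarrow> real" where
  "log_conf \<delta> = max 1 (ln (1 / \<delta>))"

definition n_phases :: "nat \<Rightarrow> nat \<Rightarrow> real \<Rightarrow> nat" where
  "n_phases d T \<delta> = nat \<lceil>log 2 (sqrt (real T / log_conf \<delta>) / real d)\<rceil>"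

text \<open>The initial error must shrink to half of 2^-p / sqrt (2 * d) for every phase p: the
  summands pay for 2^-p, for the root and for the half. The other half is left to the floor of
  \<open>fail_locate\<close>.\<close>

definition n_rounds :: "nat \<Rightarrow> nat \<Rightarrow> real \<Rightarrow> nat" where
  "n_rounds d T \<delta> = n_phases d T \<delta> + nat \<lceil>log 2 (real (2 * d))\<rceil> + 1"

text \<open>Implements the union bound: the product counts the refinements along a branch and 2
  counts the tails. The added 1 keeps the logarithm nonnegative when there is no phase.\<close>

definition step_conf :: "nat \<Rightarrow> nat \<Rightarrow> real \<Rightarrow> real" where
  "step_conf d T \<delta> = log_conf \<delta> + ln (2 * (real (n_phases d T \<delta>) * (real (2 * d) * real (n_rounds d T \<delta>))) + 1)"

text \<open>The 16 guarantees \<beta> <= 1 / 16, as \<open>fail_locate\<close> requires; the 32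
  makes the floor 16 * \<beta> * s at most half of 2^-p / sqrt (2 * d).\<close>

definition resolution :: "real \<Rightarrow> nat \<Rightarrow> nat \<Rightarrow> real" where
  "resolution s d p = 1 / (16 + 32 * s * sqrt (real (2 * d)) * 2 ^ p)"

text \<open>The factor 3 outweighs the 4 / 9 in the exponent of \<open>fail_refine\<close>.\<close>

definition n_copies :: "real \<Rightarrow> nat \<Rightarrow> nat \<Rightarrow> real \<Rightarrow> nat \<Rightarrow> nat" where
  "n_copies s d T \<delta> p = nat \<lceil>3 * step_conf d T \<delta> / resolution s d p\<rceil>"

lemma log_conf_ge_1: "1 \<le> log_conf \<delta>"
  by (simp add: log_conf_def)

lemma step_conf_ge_1: "1 \<le> step_conf d T \<delta>"
  using log_conf_ge_1[of \<delta>] by (simp add: step_conf_def add_increasing2)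

lemma resolution_bounds:
  assumes "0 \<le> s"
  shows "0 < resolution s d p" "resolution s d p \<le> 1 / 16"
proof -
  define y where "y = 32 * s * sqrt (real (2 * d)) * 2 ^ p"
  have "0 \<le> y" using assms by (simp add: y_def)
  then show "0 < resolution s d p" "resolution s d p \<le> 1 / 16"
    unfolding resolution_def y_def[symmetric] by (simp_all add: divide_le_eq)
qed

lemma n_copies_pos:
  assumes "0 \<le> s"
  shows "0 < n_copies s d T \<delta> p"
proof -
  have "0 < 3 * step_conf d T \<delta> / resolution s d p"
    using step_conf_ge_1[of d T \<delta>] resolution_bounds(1)[OF assms, of d p] by (intro divide_pos_pos) linarith+
  then show ?thesis by (simp add: n_copies_def)
qed

lemma schedule_fine:
  assumes s: "0 \<le> s" and d: "1 \<le> d" and p: "p < n_phases d T \<delta>"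
  shows "(1 / 2) ^ n_rounds d T \<delta> + 16 * resolution s d p * s \<le> (1 / 2) ^ p / sqrt (real (2 * d))"
proof -
  let ?N = "real (2 * d)" and ?k = "nat \<lceil>log 2 (real (2 * d))\<rceil>"
  have N: "1 \<le> ?N" "0 < sqrt ?N" "sqrt ?N \<le> ?N" using d real_sqrt_le_mono[of 1 ?N] 
    by (auto simp: real_le_lsqrt power2_eq_square)
  have "16 * resolution s d p * s = 16 * s / (16 + 32 * s * sqrt ?N * 2 ^ p)"
    by (simp add: resolution_def)
  also have "\<dots> \<le> 1 / (2 * (sqrt ?N * 2 ^ p))"
  proof -
    define q where "q = sqrt ?N * 2 ^ p"
    have q: "0 < q" using N by (simp add: q_def)
    have "16 * s \<le> 1 / (2 * q) * (16 + 32 * s * q)" using q by (simp add: field_simps)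
    moreover have "0 < 16 + 32 * s * q" using s q by (simp add: add_pos_nonneg)
    ultimately have "16 * s / (16 + 32 * s * q) \<le> 1 / (2 * q)" by (intro mult_imp_div_pos_le)
    then show ?thesis by (simp add: q_def mult.assoc)
  qed
  finally have a: "16 * resolution s d p * s \<le> (1 / 2) ^ p / sqrt ?N / 2" by (simp add: power_one_over field_simps)
  have "sqrt ?N \<le> 2 ^ ?k" using N nat_ceiling_log2(1)[of ?N] by linarith
  then have k: "(1 / 2) ^ ?k \<le> 1 / sqrt ?N" using N by (simp add: power_one_over field_simps)
  have "(1 / 2 :: real) ^ n_rounds d T \<delta> = (1 / 2) ^ n_phases d T \<delta> * (1 / 2) ^ ?k / 2"
    by (simp add: n_rounds_def power_add)
  also have "\<dots> \<le> (1 / 2) ^ p * (1 / sqrt ?N) / 2"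
    using p k by (intro divide_right_mono mult_mono power_decreasing) auto
  finally show ?thesis using a by simp
qed

lemma schedule_conf:
  assumes "0 \<le> s"
  shows "2 * exp (- (4 / 9) * resolution s d p * real (n_copies s d T \<delta> p)) \<le> 2 * exp (- step_conf d T \<delta>)"
proof -
  let ?\<beta> = "resolution s d p"
  have \<beta>: "0 < ?\<beta>" using resolution_bounds[OF assms] by blast
  have "3 * step_conf d T \<delta> / ?\<beta> \<le> real (n_copies s d T \<delta> p)"
    unfolding n_copies_def by (rule real_nat_ceiling_ge)
  then have "3 * step_conf d T \<delta> \<le> ?\<beta> * real (n_copies s d T \<delta> p)" using \<beta> by (simp add: field_simps)
  then show ?thesis using step_conf_ge_1[of d T \<delta>] by simp
qed

lemma schedule_total_fail:
  assumes \<delta>: "0 < \<delta>"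
  shows "real (n_phases d T \<delta>) * (real (2 * d) * (real (n_rounds d T \<delta>) * (2 * exp (- step_conf d T \<delta>)))) \<le> \<delta>"
proof -
  define X where "X = real (n_phases d T \<delta>) * (real (2 * d) * real (n_rounds d T \<delta>))"
  have X: "0 \<le> X" by (simp add: X_def)
  have "exp (- step_conf d T \<delta>) = exp (- log_conf \<delta>) / (2 * X + 1)"
  proof -
    have "step_conf d T \<delta> = log_conf \<delta> + ln (2 * X + 1)" by (simp add: step_conf_def X_def)
    then show ?thesis using X by (simp add: exp_diff)
  qed
  then have "real (n_phases d T \<delta>) * (real (2 * d) * (real (n_rounds d T \<delta>) * (2 * exp (- step_conf d T \<delta>)))) =
      2 * X / (2 * X + 1) * exp (- log_conf \<delta>)" by (simp add: X_def)
  also have "\<dots> \<le> 1 * exp (- log_conf \<delta>)" using X by (intro mult_right_mono) auto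
  also have "\<dots> \<le> exp (- ln (1 / \<delta>))" by (simp add: log_conf_def)
  also have "\<dots> = \<delta>" using \<delta> by (simp add: ln_div)
  finally show ?thesis .
qed

lemma num_batches_mult_le:
  assumes "1 \<le> B" "B \<le> T"
  shows "real (num_batches T B) * real B \<le> 2 * real T"
proof -
  have "0 \<le> real T / real B" by simp
  then have "real (num_batches T B) \<le> real T / real B + 1" unfolding num_batches_def by linarith
  then have "real (num_batches T B) * real B \<le> (real T / real B + 1) * real B" by (intro mult_right_mono) auto
  also have "\<dots> = real T + real B" using assms by (simp add: distrib_right)
  finally show ?thesis using assms by simp
qed

definition log_factor :: "nat \<Rightarrow> nat \<Rightarrow> real" where
  "log_factor d T = 1 + ln (real d) + ln (real T)"

lemma schedule_logs:
  assumes d: "1 \<le> d" and T: "1 \<le> T"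
  shows "real (n_phases d T \<delta>) \<le> 2 * log_factor d T" "real (n_rounds d T \<delta>) \<le> 4 * log_factor d T"
    "step_conf d T \<delta> \<le> 36 * log_factor d T * log_conf \<delta>"
    "s \<le> S \<Longrightarrow> 0 \<le> s \<Longrightarrow> 1 \<le> S \<Longrightarrow> p < n_phases d T \<delta> \<Longrightarrow> ln (1 / resolution s d p) \<le> 144 * S * log_factor d T"
proof -
  let ?l = "log_factor d T" and ?L = "log_conf \<delta>"
  let ?x = "sqrt (real T / ?L) / real d"
  have ld: "0 \<le> ln (real d)" "0 \<le> ln (real T)" using d T by simp_all
  then have l1: "1 \<le> ?l" by (simp add: log_factor_def)
  have L: "1 \<le> ?L" by (rule log_conf_ge_1)
  have x0: "0 < ?x" using d T L by simp
  have "?x \<le> sqrt (real T / ?L) / 1" using d L by (intro divide_left_mono) auto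
  then have "?x \<le> sqrt (real T / ?L)" by simp
  also have "\<dots> \<le> sqrt (real T)" using L by (simp add: divide_le_eq mult_le_cancel_left1)
  also have "\<dots> \<le> real T" using T by (simp add: real_le_lsqrt power2_eq_square)
  finally have xT: "?x \<le> real T" .
  have P: "real (n_phases d T \<delta>) \<le> 2 * ln (real T) + 1"
    unfolding n_phases_def using x0 xT T by (intro nat_ceiling_log2_le_ln) auto
  then show P2: "real (n_phases d T \<delta>) \<le> 2 * ?l" using ld by (simp add: log_factor_def)
  have "real (nat \<lceil>log 2 (real (2 * d))\<rceil>) \<le> 2 * ln (real d) + 2"
  proof -
    have "log 2 (real (2 * d)) = log 2 (real d) + 1" using d by (simp add: log_mult)
    then have "\<lceil>log 2 (real (2 * d))\<rceil> = \<lceil>log 2 (real d)\<rceil> + 1" by (simp only: ceiling_add_one)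
    then have "real (nat \<lceil>log 2 (real (2 * d))\<rceil>) \<le> 1 + real (nat \<lceil>log 2 (real d)\<rceil>)" by linarith
    then show ?thesis using nat_ceiling_log2_le_ln[of "real d" "real d"] d by simp
  qed
  then show J: "real (n_rounds d T \<delta>) \<le> 4 * ?l"
    using P ld by (simp add: n_rounds_def log_factor_def)
  have "2 * (real (n_phases d T \<delta>) * (real (2 * d) * real (n_rounds d T \<delta>))) + 1 \<le>
      2 * (2 * ?l * (real (2 * d) * (4 * ?l))) + 1"
    using P2 J l1 by (intro add_mono mult_mono) auto
  also have "\<dots> \<le> 33 * (real d * (?l * ?l))"
  proof -
    have "1 * (1 * 1) \<le> real d * (?l * ?l)" using d l1 by (intro mult_mono) auto
    then show ?thesis by (simp add: algebra_simps)
  qed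
  finally have "ln (2 * (real (n_phases d T \<delta>) * (real (2 * d) * real (n_rounds d T \<delta>))) + 1) \<le> ln (33 * (real d * (?l * ?l)))"
    by (intro ln_mono) (auto intro: add_nonneg_pos)
  also have "\<dots> = ln 33 + (ln (real d) + 2 * ln ?l)"
    using d l1 by (simp add: ln_mult)
  also have "\<dots> \<le> 32 + (?l + 2 * ?l)"
  proof (intro add_mono mult_left_mono)
    show "ln (33 :: real) \<le> 32" using ln_le_minus_one[of "33 :: real"] by simp
    show "ln ?l \<le> ?l" using ln_le_minus_one[of ?l] l1 by simp
    show "ln (real d) \<le> ?l" using ld by (simp add: log_factor_def)
  qed simp
  also have "\<dots> \<le> 35 * ?l" using l1 by simp
  finally have "step_conf d T \<delta> \<le> ?L + 35 * ?l" by (simp add: step_conf_def)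
  also have "\<dots> \<le> ?L * ?l + 35 * ?l * ?L"
  proof (intro add_mono)
    show "?L \<le> ?L * ?l" using L l1 by simp
    have "35 * ?l * 1 \<le> 35 * ?l * ?L" using L l1 by (intro mult_left_mono) auto
    then show "35 * ?l \<le> 35 * ?l * ?L" by simp
  qed
  finally show "step_conf d T \<delta> \<le> 36 * ?l * ?L" by (simp add: algebra_simps)
  show "ln (1 / resolution s d p) \<le> 144 * S * ?l"
    if s: "s \<le> S" "0 \<le> s" "1 \<le> S" and p: "p < n_phases d T \<delta>"
  proof -
    have "2 ^ p \<le> (2 :: real) ^ n_phases d T \<delta>" using p by (intro power_increasing) auto
    also have "\<dots> \<le> 2 * ?x"
      using p unfolding n_phases_def by (intro nat_ceiling_log2(2)[OF x0]) linarith
    finally have pT: "2 ^ p \<le> 2 * real T" using xT by linarith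
    have "sqrt (real (2 * d)) \<le> real (2 * d)" using d by (simp add: real_le_lsqrt power2_eq_square)
    then have "32 * s * sqrt (real (2 * d)) * 2 ^ p \<le> 32 * S * real (2 * d) * (2 * real T)"
      using pT s by (intro mult_mono) auto
    moreover have "1 * 1 * 1 \<le> S * real d * real T" using s d T by (intro mult_mono) auto
    ultimately have le: "1 / resolution s d p \<le> 144 * S * (real d * real T)"
      by (simp add: resolution_def algebra_simps)
    have "0 < 1 / resolution s d p" using resolution_bounds(1)[OF s(2), of d p] by simp
    then have "ln (1 / resolution s d p) \<le> ln (144 * S * (real d * real T))" using le by (intro ln_mono) auto
    also have "\<dots> = ln (144 * S) + (ln (real d) + ln (real T))" using s d T by (simp add: ln_mult)
    also have "\<dots> \<le> 144 * S - 1 + ?l"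
      using ln_le_minus_one[of "144 * S"] s by (simp add: log_factor_def)
    also have "\<dots> \<le> 144 * S * ?l"
    proof -
      have "0 \<le> (144 * S - 1) * (?l - 1)" using s l1 by (intro mult_nonneg_nonneg) auto
      then show ?thesis by (simp add: algebra_simps)
    qed
    finally show ?thesis .
  qed
qed

text \<open>The three logarithmic factors come from the halving rounds, the grid size and the
  confidence per step. One power of \<open>S\<close> comes from the bound on ln (1 / \<beta>), two
  from the variance.\<close>

lemma schedule_cost:
  fixes S \<delta> :: real
  assumes d: "1 \<le> d" and B: "1 \<le> B" "B \<le> T" and S: "1 \<le> S" and s: "s = S / sqrt (real B)"
  defines "X \<equiv> real d * real B * log_conf \<delta> + real d * sqrt (real T * log_conf \<delta>)"
  shows "(\<Sum>p<n_phases d T \<delta>. real (2 * d) * (real (n_rounds d T \<delta>) *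
        real (2 * grid_size (resolution s d p) * n_copies s d T \<delta> p) * (real B * (8 * (1 / 2) ^ p)))) +
      real (num_batches T B) * (real B * (8 * (1 / 2) ^ n_phases d T \<delta>))
    \<le> 2 ^ 37 * S ^ 3 * log_factor d T ^ 3 * X"
proof -
  let ?l = "log_factor d T" and ?L = "log_conf \<delta>" and ?P = "n_phases d T \<delta>" and ?J = "n_rounds d T \<delta>"
  let ?x = "sqrt (real T / ?L) / real d" and ?\<Lambda> = "144 * S * ?l" and ?L' = "step_conf d T \<delta>"
  have T: "1 \<le> T" using B by simp
  have l1: "1 \<le> ?l" using d T by (simp add: log_factor_def)
  have L: "1 \<le> ?L" by (rule log_conf_ge_1)
  have x0: "0 < ?x" using d T L by simp
  have sqB: "1 \<le> sqrt (real B)" using B by simp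
  have s0: "0 \<le> s" "s \<le> S" using s S sqB by (auto simp: divide_le_eq mult_le_cancel_left1)
  have TL: "?L * sqrt (real T / ?L) = sqrt (real T * ?L)" "real T / sqrt (real T / ?L) = sqrt (real T * ?L)"
  proof -
    have "?L = sqrt ?L * sqrt ?L" "real T = sqrt (real T) * sqrt (real T)" using L by simp_all
    then show "?L * sqrt (real T / ?L) = sqrt (real T * ?L)" "real T / sqrt (real T / ?L) = sqrt (real T * ?L)"
      using L T by (simp_all add: real_sqrt_divide real_sqrt_mult field_simps)
  qed
  have X0: "0 \<le> X" "real d * real B * ?L \<le> X" "real d * sqrt (real T * ?L) \<le> X" using L by (simp_all add: X_def)
  have learn: "(\<Sum>p<?P. real (2 * d) * (real ?J *
        real (2 * grid_size (resolution s d p) * n_copies s d T \<delta> p) * (real B * (8 * (1 / 2) ^ p))))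
      \<le> 2 ^ 36 * S ^ 3 * ?l ^ 3 * X"
  \<comment> \<open>Without phases there is nothing to sum; otherwise 2^P is at most twice its
    unrounded target \<open>?x\<close>.\<close>
  proof (cases "?P = 0")
    case False
    have "(\<Sum>p<?P. real (2 * d) * (real ?J *
        real (2 * grid_size (resolution s d p) * n_copies s d T \<delta> p) * (real B * (8 * (1 / 2) ^ p))))
      \<le> (\<Sum>p<?P. real (2 * d) * (real ?J * (?\<Lambda> * ?L' * (2 ^ 16 * real B * (1 / 2) ^ p + 2 ^ 18 * S\<^sup>2 * real (2 * d) * 2 ^ p))))"
    proof (rule sum_mono)
      fix p assume "p \<in> {..<?P}"
      then have p: "p < ?P" by simp
      have "real (2 * grid_size (resolution s d p) * n_copies s d T \<delta> p) * (real B * (8 * (1 / 2) ^ p))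
          \<le> ?\<Lambda> * ?L' * (2 ^ 16 * real B * (1 / 2) ^ p + 2 ^ 18 * S\<^sup>2 * real (2 * d) * 2 ^ p)"
        unfolding n_copies_def
      proof (rule phase_cost_le[OF s])
        show "ln (1 / resolution s d p) \<le> ?\<Lambda>" by (rule schedule_logs(4)[OF d T s0(2,1) S p])
        have "1 * 1 \<le> 144 * S * ?l" using S l1 by (intro mult_mono) auto
        then show "1 \<le> ?\<Lambda>" by simp
      qed (use S B step_conf_ge_1 in \<open>auto simp: resolution_def\<close>)
      then show "real (2 * d) * (real ?J *
        real (2 * grid_size (resolution s d p) * n_copies s d T \<delta> p) * (real B * (8 * (1 / 2) ^ p)))
        \<le> real (2 * d) * (real ?J * (?\<Lambda> * ?L' * (2 ^ 16 * real B * (1 / 2) ^ p + 2 ^ 18 * S\<^sup>2 * real (2 * d) * 2 ^ p)))"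
        unfolding mult.assoc[of "real ?J"] by (intro mult_left_mono) auto
    qed
    also have "\<dots> = real (2 * d) * (real ?J * (?\<Lambda> * ?L')) *
        (\<Sum>p<?P. (2 ^ 16 * real B) * (1 / 2) ^ p + (2 ^ 18 * S\<^sup>2 * real (2 * d)) * 2 ^ p)"
      unfolding sum_distrib_left by (intro sum.cong refl) (simp only: mult.assoc)
    also have "\<dots> \<le> real (2 * d) * ((4 * ?l) * (?\<Lambda> * (36 * ?l * ?L))) *
        (2 * (2 ^ 16 * real B) + (2 ^ 18 * S\<^sup>2 * real (2 * d)) * 2 ^ ?P)"
    proof (rule mult_mono)
      show "real (2 * d) * (real ?J * (?\<Lambda> * ?L')) \<le> real (2 * d) * ((4 * ?l) * (?\<Lambda> * (36 * ?l * ?L)))"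
        using schedule_logs(2,3)[OF d T, of \<delta>] S l1 step_conf_ge_1[of d T \<delta>] by (intro mult_left_mono mult_mono) auto
      show "(\<Sum>p<?P. (2 ^ 16 * real B) * (1 / 2) ^ p + (2 ^ 18 * S\<^sup>2 * real (2 * d)) * 2 ^ p) \<le>
          2 * (2 ^ 16 * real B) + (2 ^ 18 * S\<^sup>2 * real (2 * d)) * 2 ^ ?P"
        by (rule sum_phase_cost_le) auto
    qed (use S l1 L in \<open>auto intro!: sum_nonneg mult_nonneg_nonneg add_nonneg_nonneg\<close>)
    \<comment> \<open>41472 = 2 * 4 * 144 * 36, from the number of arms and the three bounds of
      \<open>schedule_logs\<close>.\<close>
    also have "\<dots> = 41472 * S * ?l ^ 3 * (2 ^ 17 * (real d * real B * ?L) + 2 ^ 19 * S\<^sup>2 * real d * (real d * ?L * 2 ^ ?P))"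
      by (simp add: power3_eq_cube algebra_simps)
    also have "\<dots> \<le> 41472 * S * ?l ^ 3 * (2 ^ 17 * X + 2 ^ 19 * S\<^sup>2 * (2 * X))"
    proof (intro mult_left_mono add_mono)
      show "real d * real B * ?L \<le> X" by (rule X0)
      have "real d * ?L * 2 ^ ?P \<le> real d * ?L * (2 * ?x)"
        using nat_ceiling_log2(2)[OF x0] False L by (intro mult_left_mono) (auto simp: n_phases_def)
      also have "\<dots> = 2 * sqrt (real T * ?L)" using d by (simp flip: TL(1))
      finally have "real d * (real d * ?L * 2 ^ ?P) \<le> real d * (2 * sqrt (real T * ?L))" by (intro mult_left_mono) auto
      also have "\<dots> \<le> 2 * X" using X0 by simp
      finally have "2 ^ 19 * S\<^sup>2 * (real d * (real d * ?L * 2 ^ ?P)) \<le> 2 ^ 19 * S\<^sup>2 * (2 * X)"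
        by (intro mult_left_mono) auto
      then show "2 ^ 19 * S\<^sup>2 * real d * (real d * ?L * 2 ^ ?P) \<le> 2 ^ 19 * S\<^sup>2 * (2 * X)"
        by (simp only: mult.assoc)
    qed (use S l1 in auto)
    also have "\<dots> \<le> 41472 * S * ?l ^ 3 * (2 ^ 17 * (S\<^sup>2 * X) + 2 ^ 19 * S\<^sup>2 * (2 * X))"
    proof (intro mult_left_mono add_mono)
      have "1 * X \<le> S\<^sup>2 * X" using S X0 by (intro mult_right_mono) (auto simp: one_le_power)
      then show "X \<le> S\<^sup>2 * X" by simp
    qed (use S l1 in auto)
    also have "\<dots> = 41472 * (2 ^ 17 + 2 ^ 20) * (S ^ 3 * ?l ^ 3 * X)"
      by (simp add: power3_eq_cube power2_eq_square algebra_simps)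
    also have "\<dots> \<le> 2 ^ 36 * (S ^ 3 * ?l ^ 3 * X)" using S l1 X0 by (intro mult_right_mono) auto
    finally show ?thesis by (simp add: mult.assoc)
  qed (use S l1 X0 in auto)
  \<comment> \<open>The committed arm is charged for all batches, at most 2 * T rounds, with gap 8 *
    2^-P.\<close>
  have "real (num_batches T B) * (real B * (8 * (1 / 2) ^ ?P)) = 8 * (real (num_batches T B) * real B) * (1 / 2) ^ ?P"
    by simp
  also have "\<dots> \<le> 8 * (2 * real T) * (1 / ?x)"
  proof (rule mult_mono)
    show "8 * (real (num_batches T B) * real B) \<le> 8 * (2 * real T)"
      using num_batches_mult_le[OF B] by linarith
    show "(1 / 2) ^ ?P \<le> 1 / ?x"
      unfolding n_phases_def power_one_over by (rule frac_le[OF _ _ x0 nat_ceiling_log2(1)[OF x0]]) auto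
  qed auto
  also have "\<dots> = 16 * (real d * sqrt (real T * ?L))" by (simp flip: TL(2))
  also have "\<dots> \<le> 16 * X" using X0 by simp
  also have "\<dots> \<le> 2 ^ 36 * S ^ 3 * ?l ^ 3 * X"
  proof (rule mult_right_mono[OF _ X0(1)])
    have "1 * 1 \<le> S ^ 3 * ?l ^ 3" using S l1 by (intro mult_mono one_le_power) auto
    then show "16 \<le> 2 ^ 36 * S ^ 3 * ?l ^ 3" by simp
  qed
  finally have commit: "real (num_batches T B) * (real B * (8 * (1 / 2) ^ ?P)) \<le> 2 ^ 36 * S ^ 3 * ?l ^ 3 * X" .
  have "2 ^ 36 * S ^ 3 * ?l ^ 3 * X + 2 ^ 36 * S ^ 3 * ?l ^ 3 * X = 2 ^ 37 * S ^ 3 * ?l ^ 3 * X" by simp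
  with add_mono[OF learn commit] show ?thesis by linarith
qed

section \<open>The regret bound\<close>

text \<open>One design is chosen for every possible set of survivors before \<theta> is known. Its
  identity between vectors becomes one between mean rewards, valid for all \<theta> at once.\<close>

lemma designs_exist:
  fixes A :: "real vec set"
  assumes A: "finite A" "A \<subseteq> carrier_vec d" and d: "1 \<le> d"
  shows "\<exists>(F :: real vec set \<Rightarrow> nat \<Rightarrow> real vec) c. \<forall>A'. A' \<subseteq> A \<longrightarrow> A' \<noteq> {} \<longrightarrow>
    (\<forall>j<2 * d. F A' j \<in> A') \<and> (\<forall>a\<in>A'. (\<Sum>j<2 * d. (c A' a j)\<^sup>2) \<le> 1 \<and>
      (\<forall>\<theta>\<in>carrier_vec d. scalar_prod a \<theta> = (\<Sum>j<2 * d. c A' a j * scalar_prod (F A' j) \<theta>)))"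
proof -
  define good where "good A' F c \<longleftrightarrow> (\<forall>j<2 * d. F j \<in> A') \<and> (\<forall>a\<in>A'. (\<Sum>j<2 * d. (c a j)\<^sup>2) \<le> 1 \<and>
       (\<forall>i<d. a $ i = (\<Sum>j<2 * d. c a j * F j $ i)))"
    for A' :: "real vec set" and F :: "nat \<Rightarrow> real vec" and c :: "real vec \<Rightarrow> nat \<Rightarrow> real"
  have "\<forall>A'. \<exists>Fc. A' \<subseteq> A \<longrightarrow> A' \<noteq> {} \<longrightarrow> good A' (fst Fc) (snd Fc)"
  proof (intro allI)
    fix A'
    show "\<exists>Fc. A' \<subseteq> A \<longrightarrow> A' \<noteq> {} \<longrightarrow> good A' (fst Fc) (snd Fc)"
    proof (cases "A' \<subseteq> A \<and> A' \<noteq> {}")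
      case True
      then have "finite A'" "A' \<noteq> {}" "A' \<subseteq> carrier_vec d" using A by (auto intro: finite_subset)
      from small_design[OF this d] obtain F c where "good A' F c" unfolding good_def by (elim exE)
      then show ?thesis by (intro exI[of _ "(F, c)"]) simp
    qed auto
  qed
  from choice[OF this] obtain Fc where "\<forall>A'. A' \<subseteq> A \<longrightarrow> A' \<noteq> {} \<longrightarrow> good A' (fst (Fc A')) (snd (Fc A'))"
    by (rule exE)
  then have Fc: "good A' (fst (Fc A')) (snd (Fc A'))" if "A' \<subseteq> A" "A' \<noteq> {}" for A'
    using that by simp
  show ?thesis
  proof (rule exI[of _ "\<lambda>A'. fst (Fc A')"], rule exI[of _ "\<lambda>A'. snd (Fc A')"], intro allI impI conjI ballI)
    fix A' assume A': "A' \<subseteq> A" "A' \<noteq> {}"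
    have good: "good A' (fst (Fc A')) (snd (Fc A'))" by (rule Fc[OF A'])
    show "fst (Fc A') j \<in> A'" if "j < 2 * d" for j
      using conjunct1[OF good[unfolded good_def]] that by (elim allE impE)
    fix a assume a: "a \<in> A'"
    note good_a = bspec[OF conjunct2[OF good[unfolded good_def]] a]
    show "(\<Sum>j<2 * d. (snd (Fc A') a j)\<^sup>2) \<le> 1" by (rule conjunct1[OF good_a])
    fix \<theta> :: "real vec" assume \<theta>: "\<theta> \<in> carrier_vec d"
    have "scalar_prod a \<theta> = (\<Sum>i<d. (\<Sum>j<2 * d. snd (Fc A') a j * fst (Fc A') j $ i) * \<theta> $ i)"
      unfolding scalar_prod_def carrier_vecD[OF \<theta>] atLeast0LessThan
      using conjunct2[OF good_a] by (intro sum.cong refl arg_cong2[where f = "(*)"]) simp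
    also have "\<dots> = (\<Sum>j<2 * d. snd (Fc A') a j * (\<Sum>i<d. fst (Fc A') j $ i * \<theta> $ i))"
      unfolding sum_distrib_right sum_distrib_left by (subst sum.swap) (simp add: mult.assoc)
    also have "\<dots> = (\<Sum>j<2 * d. snd (Fc A') a j * scalar_prod (fst (Fc A') j) \<theta>)"
      using \<theta> by (simp add: scalar_prod_def atLeast0LessThan)
    finally show "scalar_prod a \<theta> = (\<Sum>j<2 * d. snd (Fc A') a j * scalar_prod (fst (Fc A') j) \<theta>)" .
  qed
qed

lemma spans_nonempty:
  assumes "spans d A" "1 \<le> d"
  shows "A \<noteq> {}"
proof
  assume "A = {}"
  interpret vec_module "TYPE(real)" d .
  have "carrier_vec d = {0\<^sub>v d :: real vec}"
    using assms(1) span_empty unfolding spans_def \<open>A = {}\<close> by (simp add: span_def)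
  then have "unit_vec d 0 = (0\<^sub>v d :: real vec)" by (metis singletonD unit_vec_carrier)
  then have "unit_vec d 0 $ 0 = (0\<^sub>v d :: real vec) $ 0" by simp
  then show False using assms(2) by simp
qed

lemma regret_phases:
  fixes A :: "real vec set" and \<sigma> S \<delta> :: real
  assumes d: "1 \<le> d" and A: "finite A" "A \<noteq> {}" "A \<subseteq> carrier_vec d" and B: "1 \<le> B" "B \<le> T"
    and S: "1 \<le> S" "0 \<le> \<sigma>" "\<sigma> \<le> S" and \<delta>: "0 < \<delta>"
    and bd: "2 ^ 37 * S ^ 3 * log_factor d T ^ 3 *
          (real d * real B * log_conf \<delta> + real d * sqrt (real T * log_conf \<delta>)) \<le> bd"
  shows "\<exists>alg. valid_alg A T B alg \<and>
    (\<forall>\<theta> \<nu>. admissible_param d A \<theta> \<longrightarrow> noise_law \<sigma> \<nu> \<longrightarrow>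
      1 - \<delta> \<le> measure (run_space T \<nu> alg) {\<omega> \<in> space (run_space T \<nu> alg).
        regret A T B \<theta> alg \<omega> \<le> bd})"
proof -
  \<comment> \<open>Built from \<open>S\<close> and not from the actual \<sigma>, so the resulting
    cost bound is uniform over the allowed range.\<close>
  define s where "s = S / sqrt (real B)"
  have s0: "0 \<le> s" using S by (simp add: s_def)
  from designs_exist[OF A(1,3) d] obtain F :: "real vec set \<Rightarrow> nat \<Rightarrow> real vec" and c where
    Fc: "\<forall>A'. A' \<subseteq> A \<longrightarrow> A' \<noteq> {} \<longrightarrow>
    (\<forall>j<2 * d. F A' j \<in> A') \<and> (\<forall>a\<in>A'. (\<Sum>j<2 * d. (c A' a j)\<^sup>2) \<le> 1 \<and>
      (\<forall>\<theta>\<in>carrier_vec d. scalar_prod a \<theta> = (\<Sum>j<2 * d. c A' a j * scalar_prod (F A' j) \<theta>)))"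
    by (elim exE)
  have F: "F A' j \<in> A'" if "A' \<subseteq> A" "A' \<noteq> {}" "j < 2 * d" for A' j
    using Fc[rule_format, OF that(1,2)] that(3) by blast
  have c: "(\<Sum>j<2 * d. (c A' a j)\<^sup>2) \<le> 1 \<and>
      scalar_prod a \<theta> = (\<Sum>j<2 * d. c A' a j * scalar_prod (F A' j) \<theta>)"
    if "A' \<subseteq> A" "a \<in> A'" "\<theta> \<in> carrier_vec d" for A' a \<theta>
  proof -
    have "A' \<noteq> {}" using that by auto
    note a = bspec[OF conjunct2[OF Fc[rule_format, OF that(1) this]] that(2)]
    show ?thesis by (rule conjI[OF conjunct1[OF a] bspec[OF conjunct2[OF a] that(3)]])
  qed
  let ?\<beta> = "resolution s d" and ?G = "n_copies s d T \<delta>" and ?J = "n_rounds d T \<delta>" and ?P = "n_phases d T \<delta>"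
  define learn where "learn = phases F c (2 * d) s ?\<beta> ?G ?J A ?P"
  \<comment> \<open>Any survivor serves for the commitment, as all of them have gap at most 8 * 2^-P
    on the good event.\<close>
  define p where "p = bind_prot learn (\<lambda>A'. Ret (SOME a. a \<in> A'))"
  have p: "all_prot (\<lambda>a. a \<in> A) (\<lambda>a. a \<in> A) p"
    unfolding p_def
  proof (rule all_prot_bind)
    show "all_prot (\<lambda>a. a \<in> A) (\<lambda>A'. A' \<subseteq> A \<and> A' \<noteq> {}) learn"
      unfolding learn_def by (rule all_prot_phases[OF A(1,2) F])
    fix A' assume "A' \<subseteq> A \<and> A' \<noteq> {}"
    then show "all_prot (\<lambda>a. a \<in> A) (\<lambda>a. a \<in> A) (Ret (SOME a. a \<in> A'))"
      using some_in_eq[of A'] by auto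
  qed
  have "1 - \<delta> \<le> measure (run_space T \<nu> (prot_alg T B p)) {\<omega> \<in> space (run_space T \<nu> (prot_alg T B p)).
      regret A T B \<theta> (prot_alg T B p) \<omega> \<le> bd}"
    if \<theta>: "admissible_param d A \<theta>" and noise: "noise_law \<sigma> \<nu>" for \<theta> \<nu>
  proof -
    have \<theta>c: "\<theta> \<in> carrier_vec d" and \<theta>1: "\<And>a. a \<in> A \<Longrightarrow> \<bar>scalar_prod a \<theta>\<bar> \<le> 1"
      using \<theta> by (auto simp: admissible_param_def)
    have \<nu>: "prob_space \<nu>" "sets \<nu> = sets borel" using noise by (auto simp: noise_law_def)
    define \<mu> where "\<mu> a = scalar_prod a \<theta>" for a
    define a_opt where "a_opt = arg_max_on \<mu> A"
    define g where "g a = (if a \<in> A then real B * (\<mu> a_opt - \<mu> a) else 0)" for a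
    define \<zeta> where "\<zeta> = distr (\<Pi>\<^sub>M i\<in>{..<B}. \<nu>) borel (\<lambda>x. (\<Sum>i<B. x i) / real B)"
    have opt: "a_opt \<in> A" "\<And>a. a \<in> A \<Longrightarrow> \<mu> a \<le> \<mu> a_opt"
      unfolding a_opt_def using arg_max_on_finite[OF A(1,2), where f = \<mu>] by auto
    have "\<sigma>\<^sup>2 \<le> S\<^sup>2" using S by (intro power_mono) auto
    then have var: "(LINT x|\<nu>. x\<^sup>2) \<le> S\<^sup>2" using noise by (simp add: noise_law_def)
    have moments: "prob_space \<zeta>" "sets \<zeta> = sets borel" "integrable \<zeta> (\<lambda>z. z)" "(LINT z|\<zeta>. z) = 0"
      "integrable \<zeta> (\<lambda>z. z\<^sup>2)" "(LINT z|\<zeta>. z\<^sup>2) \<le> S\<^sup>2 / real B"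
      unfolding \<zeta>_def using noise noise_mean_moments[OF \<nu> _ _ _ var B(1)] by (auto simp: noise_law_def)
    interpret Z: prob_space \<zeta> by (rule moments(1))
    interpret N: batch_noise \<zeta> \<mu> g s
      by unfold_locales (use moments s0 in \<open>auto simp: s_def power_divide\<close>)
    have learn: "N.fail learn (\<lambda>A' k. A' \<subseteq> A \<and> a_opt \<in> A' \<and> (\<forall>a\<in>A'. \<mu> a_opt - \<mu> a \<le> 8 * (1 / 2) ^ ?P) \<and>
        k \<le> (\<Sum>p<?P. real (2 * d) * (real ?J * real (2 * grid_size (?\<beta> p) * ?G p) * (real B * (8 * (1 / 2) ^ p)))))
      \<le> real ?P * (real (2 * d) * (real ?J * (2 * exp (- step_conf d T \<delta>))))"
      unfolding learn_def
    proof (rule N.fail_phases[OF A(1) opt])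
      show "(\<Sum>j<2 * d. (c A' a j)\<^sup>2) \<le> 1 \<and> \<mu> a = (\<Sum>j<2 * d. c A' a j * \<mu> (F A' j))"
        if "A' \<subseteq> A" "a \<in> A'" for A' a
        unfolding \<mu>_def using c[OF that \<theta>c] .
    qed (use \<theta>1 F s0 resolution_bounds[OF s0] n_copies_pos[OF s0] schedule_fine[OF s0 d] schedule_conf[OF s0]
        in \<open>simp_all add: g_def \<mu>_def\<close>)
    have "N.ex p (\<lambda>r k. of_bool (bd < k + real (num_batches T B) * g r)) \<le>
        N.fail learn (\<lambda>A' k. A' \<subseteq> A \<and> a_opt \<in> A' \<and> (\<forall>a\<in>A'. \<mu> a_opt - \<mu> a \<le> 8 * (1 / 2) ^ ?P) \<and>
        k \<le> (\<Sum>p<?P. real (2 * d) * (real ?J * real (2 * grid_size (?\<beta> p) * ?G p) * (real B * (8 * (1 / 2) ^ p)))))"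
      unfolding p_def N.ex_bind N.fail_def
    proof (rule N.ex_mono)
      fix A' k
      let ?Q = "A' \<subseteq> A \<and> a_opt \<in> A' \<and> (\<forall>a\<in>A'. \<mu> a_opt - \<mu> a \<le> 8 * (1 / 2) ^ ?P) \<and>
        k \<le> (\<Sum>p<?P. real (2 * d) * (real ?J * real (2 * grid_size (?\<beta> p) * ?G p) * (real B * (8 * (1 / 2) ^ p))))"
      let ?r = "SOME a. a \<in> A'"
      have "k + real (num_batches T B) * g ?r \<le> bd" if Q: ?Q
      proof -
        have r: "?r \<in> A'" using Q someI[of "\<lambda>a. a \<in> A'" a_opt] by blast
        then have "g ?r = real B * (\<mu> a_opt - \<mu> ?r)" using Q by (auto simp: g_def)
        also have "\<dots> \<le> real B * (8 * (1 / 2) ^ ?P)" using Q r by (intro mult_left_mono) auto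
        finally have "real (num_batches T B) * g ?r \<le> real (num_batches T B) * (real B * (8 * (1 / 2) ^ ?P))"
          by (intro mult_left_mono) auto
        then show ?thesis
          using Q schedule_cost[OF d B S(1) s_def, of \<delta>] bd by linarith
      qed
      then show "N.ex (Ret ?r) (\<lambda>r' c'. of_bool (bd < k + c' + real (num_batches T B) * g r')) \<le> (if ?Q then 0 else 1)"
        by auto
    qed
    also note learn
    also have "real ?P * (real (2 * d) * (real ?J * (2 * exp (- step_conf d T \<delta>)))) \<le> \<delta>"
      by (rule schedule_total_fail[OF \<delta>])
    finally have "N.ex p (\<lambda>r k. of_bool (bd < k + real (num_batches T B) * g r)) \<le> \<delta>" .
    then show ?thesis
      using regret_prot_alg[OF A \<theta>c \<nu> B p, of bd \<delta>]
      unfolding g_def a_opt_def \<mu>_def \<zeta>_def by blast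
  qed
  then show ?thesis using valid_prot_alg[OF p] by blast
qed

theorem theorem3:
  fixes \<sigma>_lo \<sigma>_hi :: real
  assumes "0 < \<sigma>_lo" and "\<sigma>_lo \<le> \<sigma>_hi"
  shows "\<exists>C>0. \<forall>(d::nat) (A::real vec set) (T::nat) (B::nat) (\<sigma>::real) (\<delta>::real).
           1 \<le> d \<longrightarrow> finite A \<longrightarrow> A \<subseteq> carrier_vec d \<longrightarrow> spans d A \<longrightarrow>
           B \<in> {1..T} \<longrightarrow> \<sigma> \<in> {\<sigma>_lo..\<sigma>_hi} \<longrightarrow> \<delta> \<in> {0<..<1} \<longrightarrow>
           (\<exists>alg. valid_alg A T B alg \<and>
              (\<forall>\<theta> \<nu>. admissible_param d A \<theta> \<longrightarrow> noise_law \<sigma> \<nu> \<longrightarrow>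
                 measure (run_space T \<nu> alg)
                   {\<omega> \<in> space (run_space T \<nu> alg).
                      regret A T B \<theta> alg \<omega> \<le> regret_bound C d T B \<delta>} \<ge> 1 - \<delta>))"
proof -
  define S where "S = max 1 \<sigma>_hi"
  \<comment> \<open>\<open>C\<close> is both factor and exponent: since C >= 3 and the logarithmic
    factor is at least 1, its cube is below its power \<open>C\<close>.\<close>
  define C where "C = 2 ^ 37 * S ^ 3"
  have S: "1 \<le> S" by (simp add: S_def)
  then have "1 \<le> S ^ 3" by (rule one_le_power)
  then have C: "3 \<le> C" by (simp add: C_def)
  have "\<exists>alg. valid_alg A T B alg \<and>
              (\<forall>\<theta> \<nu>. admissible_param d A \<theta> \<longrightarrow> noise_law \<sigma> \<nu> \<longrightarrow>
                 1 - \<delta> \<le> measure (run_space T \<nu> alg)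
                   {\<omega> \<in> space (run_space T \<nu> alg).
                      regret A T B \<theta> alg \<omega> \<le> regret_bound C d T B \<delta>})"
    if d: "1 \<le> d" and A: "finite A" "A \<subseteq> carrier_vec d" "spans d A" and B: "B \<in> {1..T}"
      and \<sigma>: "\<sigma> \<in> {\<sigma>_lo..\<sigma>_hi}" and \<delta>: "\<delta> \<in> {0<..<1}" for d A T B \<sigma> \<delta>
  proof -
    let ?X = "real d * real B * log_conf \<delta> + real d * sqrt (real T * log_conf \<delta>)"
    let ?bd = "2 ^ 37 * S ^ 3 * log_factor d T ^ 3 * ?X"
    have l: "1 \<le> log_factor d T" using d B by (simp add: log_factor_def)
    have X: "0 \<le> ?X" using log_conf_ge_1[of \<delta>] by simp
    have "log_factor d T ^ 3 = log_factor d T powr 3"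
      using l powr_realpow[of "log_factor d T" 3] by simp
    also have "\<dots> \<le> log_factor d T powr C" using l C by (intro powr_mono) auto
    finally have "?bd \<le> C * log_factor d T powr C * ?X"
      unfolding C_def[symmetric] using C X by (intro mult_right_mono mult_left_mono) auto
    then have bd: "?bd \<le> regret_bound C d T B \<delta>"
      by (simp add: regret_bound_def Let_def log_factor_def log_conf_def)
    have "1 \<le> B" "B \<le> T" "0 \<le> \<sigma>" "\<sigma> \<le> S" "0 < \<delta>" using B \<sigma> \<delta> assms by (auto simp: S_def)
    from regret_phases[OF d A(1) spans_nonempty[OF A(3) d] A(2) this(1,2) S this(3,4,5) bd]
    show ?thesis .
  qed
  then show ?thesis
  proof (intro exI[of _ C] conjI allI impI)
    show "0 < C" using C by simp
  qed
qed

end
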